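(* Let $\{\nu_n\}_{n\in\mathbb{N}}$ be a sequence of Borel probability measures on $\mathbb{R}$ that converges weakly to a $\boxplus$-infinitely divisible measure $\nu$. Suppose that for every $\alpha,\beta>0$ there exists $N\in\mathbb{N}$ such that the Voiculescu transform $\varphi_{\nu_n}$ is defined in $\Gamma_{\alpha,\beta}$ for every $n\ge N$. Let $J\subset\mathbb{R}$ be a compact interval such that $\nu$ is absolutely continuous and $d\nu/dx>0$ in a neighborhood of $J$. Then, for all sufficiently large $n$, $\nu_n$ is absolutely continuous on a neighborhood of $J$ with a real-analytic density, and the densities $d\nu_n/dx$ converge uniformly on $J$, along with all their derivatives, to $d\nu/dx$ as $n\to\infty$.
   Context: Let $\mathbb{H}=\{z\in\mathbb{C}:\Im z>0\}$. For $\alpha,\beta>0$ set $\Gamma_{\alpha,\beta}=\{x+iy\in\mathbb{C}: y\ge\max\{\beta,\alpha|x|\}\}$. A function is called analytic on $\Gamma_{\alpha,\beta}$ if it is analytic on an open neighborhood of $\Gamma_{\alpha,\beta}$. For a Borel probability measure $\mu$ on $\mathbb{R}$ set $G_\mu(z)=\int_{\mathbb{R}}\frac{d\mu(t)}{z-t}$ and $F_\mu(z)=1/G_\mu(z)$ for $z\in\mathbb{H}$. For every $\alpha>0$ there exist $\beta>0$ and an analytic function $H_\mu:\Gamma_{\alpha,\beta}\to\mathbb{H}$ with $F_\mu(H_\mu(z))=z$ on $\Gamma_{\alpha,\beta}$, normalized by $H_\mu(z)/z\to1$ as $z\to\infty$ in $\Gamma_{\alpha,\beta}$. The Voiculescu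 transform of $\mu$ is $\varphi_\mu(z)=H_\mu(z)-z$; it satisfies $\Im\varphi_\mu\le 0$ on $\Gamma_{\alpha,\beta}$. Any analytic continuation of $\varphi_\mu$ to a region $\Gamma_{\alpha',\beta'}$ that still satisfies $\Im\varphi_\mu\le0$ on that region is also denoted by $\varphi_\mu$ (any two such continuations agree on their common domain). Thus "$\varphi_\mu$ is defined in $\Gamma_{\alpha,\beta}$" means that $\varphi_\mu$ has an analytic continuation to $\Gamma_{\alpha,\beta}$ with $\Im\varphi_\mu\le 0$ there. The free additive convolution $\mu_1\boxplus\mu_2$ is the distribution of the sum of two freely independent selfadjoint random variables with distributions $\mu_1$, $\mu_2$. A Borel probability measure $\nu$ on $\mathbb{R}$ is $\boxplus$-infinitely divisible if for every $k\in\mathbb{N}$ it is the $k$-fold free additive convolution of some Borel probability measure on $\mathbb{R}$ with itself; equivalently, $\varphi_\nu$ is defined on all of $\mathbb{H}$ and $\varphi_\nu(\mathbb{H})\subset\mathbb{C}\setminus\mathbb{H}$. The density $d\nu/dx$ denotes the (finite) continuous version of the density; the hypothesis on $J$ means that on some open set containing $J$ the measure $\nu$ is absolutely continuous with respect to Lebesgue measure with a continuous, strictly positive density. *)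

theory Defs
  imports "HOL-Probability.Probability" "HOL-Complex_Analysis.Complex_Analysis"
begin

section \<open>The Voiculescu transform\<close>

definition upper_half_plane :: "complex set" where
  "upper_half_plane = {z. Im z > 0}"

definition Gamma_region :: "real \<Rightarrow> real \<Rightarrow> complex set" where
  "Gamma_region \<alpha> \<beta> = {z. Im z \<ge> max \<beta> (\<alpha> * \<bar>Re z\<bar>)}"

definition cauchy_transform :: "real measure \<Rightarrow> complex \<Rightarrow> complex" where
  "cauchy_transform \<mu> z = (\<integral>t. 1 / (z - complex_of_real t) \<partial>\<mu>)"

definition F_transform :: "real measure \<Rightarrow> complex \<Rightarrow> complex" where
  "F_transform \<mu> z = 1 / cauchy_transform \<mu> z"

text \<open>In the library, \<open>H analytic_on S\<close> for an arbitrary set \<open>S\<close> means that \<open>H\<close> is analytic on an open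
  neighbourhood of \<open>S\<close>. The normalisation at infinity singles out the relevant right inverse.\<close>

definition is_F_inverse :: "real measure \<Rightarrow> real \<Rightarrow> real \<Rightarrow> (complex \<Rightarrow> complex) \<Rightarrow> bool" where
  "is_F_inverse \<mu> \<alpha> \<beta> H \<longleftrightarrow>
     H analytic_on Gamma_region \<alpha> \<beta> \<and>
     (\<forall>z\<in>Gamma_region \<alpha> \<beta>. H z \<in> upper_half_plane \<and> F_transform \<mu> (H z) = z) \<and>
     ((\<lambda>z. H z / z) \<longlongrightarrow> 1) (inf at_infinity (principal (Gamma_region \<alpha> \<beta>)))"

text \<open>\<open>\<phi>\<close> is the Voiculescu transform of \<open>\<mu>\<close> on \<open>\<Gamma>\<^sub>\<alpha>\<^sub>,\<^sub>\<beta>\<close>, possibly by analytic continuation of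
  \<open>H z - z\<close> from the region \<open>\<Gamma>\<^sub>\<alpha>\<^sub>0\<^sub>,\<^sub>\<beta>\<^sub>0\<close> on which a normalised inverse \<open>H\<close> lives. The intersection
  \<open>\<Gamma>\<^sub>\<alpha>\<^sub>0\<^sub>,\<^sub>\<beta>\<^sub>0 \<inter> \<Gamma>\<^sub>\<alpha>\<^sub>,\<^sub>\<beta>\<close> is again such a region (with the maxima of the parameters), hence connected
  with nonempty interior.\<close>

definition is_voiculescu_transform ::
    "real measure \<Rightarrow> real \<Rightarrow> real \<Rightarrow> (complex \<Rightarrow> complex) \<Rightarrow> bool" where
  "is_voiculescu_transform \<mu> \<alpha> \<beta> \<phi> \<longleftrightarrow>
     \<phi> analytic_on Gamma_region \<alpha> \<beta> \<and>
     (\<forall>z\<in>Gamma_region \<alpha> \<beta>. Im (\<phi> z) \<le> 0) \<and>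
     (\<exists>\<alpha>0>0. \<exists>\<beta>0>0. \<exists>H. is_F_inverse \<mu> \<alpha>0 \<beta>0 H \<and>
        (\<forall>z\<in>Gamma_region \<alpha>0 \<beta>0 \<inter> Gamma_region \<alpha> \<beta>. \<phi> z = H z - z))"

definition voiculescu_defined_in :: "real measure \<Rightarrow> real \<Rightarrow> real \<Rightarrow> bool" where
  "voiculescu_defined_in \<mu> \<alpha> \<beta> \<longleftrightarrow> (\<exists>\<phi>. is_voiculescu_transform \<mu> \<alpha> \<beta> \<phi>)"


section \<open>The Hilbert space of square-summable sequences\<close>

text \<open>Free random variables are modelled by operators on \<open>\<ell>\<^sup>2\<close>, the infinite-dimensional separable
  complex Hilbert space. This is no restriction: a W*-probability space generated by two selfadjoint
  random variables has a separable (possibly finite-dimensional) standard representation, which can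
  be amplified to \<open>\<ell>\<^sup>2\<close>.\<close>

type_synonym cseq = "nat \<Rightarrow> complex"

definition ell2 :: "cseq set" where
  "ell2 = {x. summable (\<lambda>n. (cmod (x n))\<^sup>2)}"

definition ell2_inner :: "cseq \<Rightarrow> cseq \<Rightarrow> complex" where
  "ell2_inner x y = (\<Sum>n. x n * cnj (y n))"

definition ell2_norm :: "cseq \<Rightarrow> real" where
  "ell2_norm x = sqrt (\<Sum>n. (cmod (x n))\<^sup>2)"

text \<open>Bounded operators are extended by zero outside \<open>\<ell>\<^sup>2\<close>, so that equality of operators is equality
  of functions.\<close>

definition bounded_ops :: "(cseq \<Rightarrow> cseq) set" where
  "bounded_ops = {A.
     (\<forall>x\<in>ell2. A x \<in> ell2) \<and>
     (\<forall>x. x \<notin> ell2 \<longrightarrow> A x = (\<lambda>_. 0)) \<and>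
     (\<forall>x\<in>ell2. \<forall>y\<in>ell2. \<forall>a b. A (\<lambda>n. a * x n + b * y n) = (\<lambda>n. a * A x n + b * A y n)) \<and>
     (\<exists>K. \<forall>x\<in>ell2. ell2_norm (A x) \<le> K * ell2_norm x)}"

definition id_op :: "cseq \<Rightarrow> cseq" where
  "id_op x = (if x \<in> ell2 then x else (\<lambda>_. 0))"

definition adjoint_ops :: "(cseq \<Rightarrow> cseq) \<Rightarrow> (cseq \<Rightarrow> cseq) \<Rightarrow> bool" where
  "adjoint_ops A B \<longleftrightarrow> (\<forall>x\<in>ell2. \<forall>y\<in>ell2. ell2_inner (A x) y = ell2_inner x (B y))"

definition commutant :: "(cseq \<Rightarrow> cseq) set \<Rightarrow> (cseq \<Rightarrow> cseq) set" where
  "commutant S = {A\<in>bounded_ops. \<forall>C\<in>S. A \<circ> C = C \<circ> A}"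

definition von_neumann_algebra :: "(cseq \<Rightarrow> cseq) set \<Rightarrow> bool" where
  "von_neumann_algebra \<A> \<longleftrightarrow>
     \<A> \<subseteq> bounded_ops \<and>
     (\<forall>A\<in>\<A>. \<forall>B\<in>bounded_ops. adjoint_ops A B \<longrightarrow> B \<in> \<A>) \<and>
     commutant (commutant \<A>) = \<A>"

definition vec_state :: "cseq \<Rightarrow> (cseq \<Rightarrow> cseq) \<Rightarrow> complex" where
  "vec_state \<xi> A = ell2_inner (A \<xi>) \<xi>"

text \<open>A W*-probability space: a von Neumann algebra with a faithful normal tracial state. The state
  is taken to be a vector state (hence normal), as it is in the standard representation.\<close>

definition wstar_probability_space :: "(cseq \<Rightarrow> cseq) set \<Rightarrow> cseq \<Rightarrow> bool" where
  "wstar_probability_space \<A> \<xi> \<longleftrightarrow>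
     von_neumann_algebra \<A> \<and>
     \<xi> \<in> ell2 \<and> ell2_norm \<xi> = 1 \<and>
     (\<forall>A\<in>\<A>. \<forall>B\<in>\<A>. vec_state \<xi> (A \<circ> B) = vec_state \<xi> (B \<circ> A)) \<and>
     (\<forall>A\<in>\<A>. \<forall>B\<in>\<A>. adjoint_ops A B \<and> vec_state \<xi> (B \<circ> A) = 0 \<longrightarrow> A = (\<lambda>_ _. 0))"


section \<open>Selfadjoint random variables\<close>

text \<open>Possibly unbounded operators are given by their graphs.\<close>

definition graph_adjoint :: "(cseq \<times> cseq) set \<Rightarrow> (cseq \<times> cseq) set" where
  "graph_adjoint T = {(y, w). y \<in> ell2 \<and> w \<in> ell2 \<and>
     (\<forall>(x, v)\<in>T. ell2_inner v y = ell2_inner x w)}"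

text \<open>Linearity of the graph is implied by \<open>graph_adjoint T = T\<close>.\<close>

definition selfadjoint :: "(cseq \<times> cseq) set \<Rightarrow> bool" where
  "selfadjoint T \<longleftrightarrow>
     T \<subseteq> ell2 \<times> ell2 \<and> single_valued T \<and>
     (\<forall>x\<in>ell2. \<forall>e>0. \<exists>y\<in>Domain T. ell2_norm (\<lambda>n. x n - y n) < e) \<and>
     graph_adjoint T = T"

definition graph_commutant :: "(cseq \<times> cseq) set \<Rightarrow> (cseq \<Rightarrow> cseq) set" where
  "graph_commutant T = {C\<in>bounded_ops. \<forall>(x, v)\<in>T. (C x, C v) \<in> T}"

definition affiliated :: "(cseq \<Rightarrow> cseq) set \<Rightarrow> (cseq \<times> cseq) set \<Rightarrow> bool" where
  "affiliated \<A> T \<longleftrightarrow> commutant \<A> \<subseteq> graph_commutant T"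

text \<open>For selfadjoint \<open>T\<close>, the von Neumann algebra generated by (the bounded Borel functions of) \<open>T\<close>.\<close>

definition generated_vN :: "(cseq \<times> cseq) set \<Rightarrow> (cseq \<Rightarrow> cseq) set" where
  "generated_vN T = commutant (graph_commutant T)"

definition graph_closed_sum ::
    "(cseq \<times> cseq) set \<Rightarrow> (cseq \<times> cseq) set \<Rightarrow> (cseq \<times> cseq) set" where
  "graph_closed_sum S T = {(x, z). x \<in> ell2 \<and> z \<in> ell2 \<and>
     (\<forall>e>0. \<exists>y u v. (y, u) \<in> S \<and> (y, v) \<in> T \<and>
        ell2_norm (\<lambda>n. x n - y n) < e \<and> ell2_norm (\<lambda>n. z n - (u n + v n)) < e)}"

definition projection_valued_measure :: "(real set \<Rightarrow> cseq \<Rightarrow> cseq) \<Rightarrow> bool" where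
  "projection_valued_measure E \<longleftrightarrow>
     (\<forall>B\<in>sets borel. E B \<in> bounded_ops \<and> E B \<circ> E B = E B \<and> adjoint_ops (E B) (E B)) \<and>
     E UNIV = id_op \<and>
     (\<forall>B :: nat \<Rightarrow> real set. range B \<subseteq> sets borel \<longrightarrow> disjoint_family B \<longrightarrow>
        (\<forall>x\<in>ell2. \<forall>y\<in>ell2.
           (\<lambda>i. ell2_inner (E (B i) x) y) sums ell2_inner (E (\<Union>i. B i) x) y))"

definition scalar_spectral_measure :: "(real set \<Rightarrow> cseq \<Rightarrow> cseq) \<Rightarrow> cseq \<Rightarrow> real measure" where
  "scalar_spectral_measure E x =
     measure_of UNIV (sets (borel :: real measure)) (\<lambda>B. ennreal (Re (ell2_inner (E B x) x)))"

text \<open>\<open>T = \<integral> t dE(t)\<close>: the domain of \<open>T\<close> is that of the spectral integral, and the quadratic forms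
  agree; by polarization the latter determines \<open>T\<close>.\<close>

definition is_spectral_measure ::
    "(real set \<Rightarrow> cseq \<Rightarrow> cseq) \<Rightarrow> (cseq \<times> cseq) set \<Rightarrow> bool" where
  "is_spectral_measure E T \<longleftrightarrow>
     projection_valued_measure E \<and>
     Domain T = {x\<in>ell2. integrable (scalar_spectral_measure E x) (\<lambda>t. t\<^sup>2)} \<and>
     (\<forall>(x, v)\<in>T. ell2_inner v x = complex_of_real (\<integral>t. t \<partial>scalar_spectral_measure E x))"

definition has_distribution :: "cseq \<Rightarrow> (cseq \<times> cseq) set \<Rightarrow> real measure \<Rightarrow> bool" where
  "has_distribution \<xi> T \<mu> \<longleftrightarrow>
     (\<exists>E. is_spectral_measure E T \<and>
        (\<forall>B\<in>sets borel. vec_state \<xi> (E B) = complex_of_real (measure \<mu> B)))"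


section \<open>Free independence, free additive convolution, infinite divisibility\<close>

text \<open>Alternating products of centred elements of the two algebras are centred.\<close>

definition free_algebras ::
    "cseq \<Rightarrow> (cseq \<Rightarrow> cseq) set \<Rightarrow> (cseq \<Rightarrow> cseq) set \<Rightarrow> bool" where
  "free_algebras \<xi> \<A>1 \<A>2 \<longleftrightarrow>
     (\<forall>as s. as \<noteq> [] \<and>
        (\<forall>k<length as. as ! k \<in> (if even k = s then \<A>1 else \<A>2) \<and> vec_state \<xi> (as ! k) = 0)
        \<longrightarrow> vec_state \<xi> (foldr (\<circ>) as id) = 0)"

text \<open>\<open>\<mu> = \<mu>\<^sub>1 \<boxplus> \<mu>\<^sub>2\<close>. The sum of the unbounded operators \<open>X\<close> and \<open>Y\<close> is the closure of the
  algebraic sum. The law of the sum depends only on \<open>\<mu>\<^sub>1\<close> and \<open>\<mu>\<^sub>2\<close>, so the choice of the realisation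
  is immaterial.\<close>

definition is_free_convolution :: "real measure \<Rightarrow> real measure \<Rightarrow> real measure \<Rightarrow> bool" where
  "is_free_convolution \<mu>1 \<mu>2 \<mu> \<longleftrightarrow>
     real_distribution \<mu>1 \<and> real_distribution \<mu>2 \<and> real_distribution \<mu> \<and>
     (\<exists>\<A> \<xi> X Y. wstar_probability_space \<A> \<xi> \<and>
        selfadjoint X \<and> affiliated \<A> X \<and> has_distribution \<xi> X \<mu>1 \<and>
        selfadjoint Y \<and> affiliated \<A> Y \<and> has_distribution \<xi> Y \<mu>2 \<and>
        free_algebras \<xi> (generated_vN X) (generated_vN Y) \<and>
        selfadjoint (graph_closed_sum X Y) \<and>
        has_distribution \<xi> (graph_closed_sum X Y) \<mu>)"

inductive is_free_convolution_power :: "real measure \<Rightarrow> nat \<Rightarrow> real measure \<Rightarrow> bool"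
  for \<mu> :: "real measure" where
  "is_free_convolution_power \<mu> 1 \<mu>"
| "is_free_convolution_power \<mu> k \<rho> \<Longrightarrow> is_free_convolution \<rho> \<mu> \<nu> \<Longrightarrow>
     is_free_convolution_power \<mu> (Suc k) \<nu>"

definition freely_infinitely_divisible :: "real measure \<Rightarrow> bool" where
  "freely_infinitely_divisible \<nu> \<longleftrightarrow>
     (\<forall>k\<ge>1. \<exists>\<mu>. real_distribution \<mu> \<and> is_free_convolution_power \<mu> k \<nu>)"


section \<open>Densities\<close>

definition has_density_on :: "real measure \<Rightarrow> (real \<Rightarrow> real) \<Rightarrow> real set \<Rightarrow> bool" where
  "has_density_on \<mu> f U \<longleftrightarrow>
     (\<forall>x\<in>U. f x \<ge> 0) \<and>
     (\<forall>B\<in>sets borel. B \<subseteq> U \<longrightarrow> emeasure \<mu> B = (\<integral>\<^sup>+x\<in>B. ennreal (f x) \<partial>lborel))"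

definition real_analytic_on :: "(real \<Rightarrow> real) \<Rightarrow> real set \<Rightarrow> bool" where
  "real_analytic_on f U \<longleftrightarrow>
     (\<forall>x\<in>U. \<exists>r>0. \<exists>c. \<forall>y. \<bar>y - x\<bar> < r \<longrightarrow> (\<lambda>k. c k * (y - x) ^ k) sums f y)"

definition smooth_real_on :: "(real \<Rightarrow> real) \<Rightarrow> real set \<Rightarrow> bool" where
  "smooth_real_on f U \<longleftrightarrow> (\<forall>k. \<forall>x\<in>U. (deriv ^^ k) f differentiable (at x))"

end

theory Submission
  imports Defs
begin

text \<open>
Write \<open>G\<close> for the Cauchy transform, \<open>F = 1 / G\<close>, and \<open>P = - \<phi>\<close> for the negative of a Voiculescu transform, so
that \<open>P\<close> has nonnegative imaginary part and \<open>w - P w\<close> inverts \<open>F\<close>.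

By hypothesis the functions \<open>P\<close> of the approximating measures live on regions that exhaust the upper
half-plane. Functions with nonnegative imaginary part form a normal family, and the identity
\<open>F z - P (F z) = z\<close> determines the limit of any subsequence. Hence they converge locally uniformly to a
function \<open>P\<close> on the whole upper half-plane, for which \<open>w - P w\<close> inverts the \<open>F\<close>-transform of the limit measure
(lemma \<open>voiculescu_transforms_converge\<close>).

The main point is to show that over the compact interval this inverse is used only inside the upper
half-plane, away from the real axis and from infinity (lemma \<open>F_transform_near_positive_density\<close>). A continuous positive
density bounds \<open>- Im G\<close> from above and below. This confines \<open>F\<close> to the region between two horocycles at \<open>0\<close>,
which still has a cusp at \<open>0\<close>. The Schwarz-Pick inequality for \<open>P\<close> closes the cusp: \<open>w - P w\<close>
keeps mapping to the upper half-plane as \<open>w\<close> moves up a vertical ray, and moves its image only a little,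
so an \<open>F\<close>-value near \<open>0\<close> would force \<open>- Im G\<close> to be large at a nearby point.

Consequently each point \<open>x\<close> of the interval is the value of \<open>w - P w\<close> at a point \<open>w0\<close> of the upper half-plane, and the
equality case of the Schwarz lemma shows that \<open>w0\<close> is not critical. Near \<open>w0\<close> the inverse functions of
the approximating measures converge uniformly together with their derivatives, so they have local
inverses on a common disc about \<open>x\<close>, and these inverses converge uniformly (lemma \<open>uniform_local_inverse\<close>). Their
reciprocals extend the Cauchy transforms across the real axis (lemma \<open>cauchy_transform_extension\<close>). By
Stieltjes inversion (lemma \<open>has_density_on_boundary_values\<close>) the densities are the imaginary parts of these extensions, divided by
\<open>- pi\<close>; they are real analytic, and Cauchy's estimates give the convergence of all derivatives.
\<close>

section \<open>The Schwarz-Pick inequality in the upper half-plane\<close>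

lemma norm_diff_cnj_sq:
  "(cmod (w - cnj v))\<^sup>2 = (cmod (w - v))\<^sup>2 + 4 * Im w * Im v"
  unfolding cmod_power2 by (simp add: power2_eq_square algebra_simps)

lemma diff_diff_distrib_swap: "(a - b) - (c - d) = (a - c) - (b - (d::complex))"
  by simp

lemma diff_cnj_nonzero: "Im w > 0 \<Longrightarrow> Im v > 0 \<Longrightarrow> w - cnj v \<noteq> 0"
proof
  assume p: "Im w > 0" "Im v > 0" and e: "w - cnj v = 0"
  have "Im (w - cnj v) = 0" using e by simp
  with p show False by simp
qed

text \<open>The Moebius map of the upper half-plane onto the unit disc that sends \<open>v\<close> to \<open>0\<close>, and its inverse.\<close>

definition disc_of_half :: "complex \<Rightarrow> complex \<Rightarrow> complex" where
  "disc_of_half v w = (w - v) / (w - cnj v)"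

definition half_of_disc :: "complex \<Rightarrow> complex \<Rightarrow> complex" where
  "half_of_disc v \<zeta> = (v - cnj v * \<zeta>) / (1 - \<zeta>)"

lemma norm_disc_of_half_lt:
  assumes "Im w > 0" "Im v > 0"
  shows "cmod (disc_of_half v w) < 1"
proof -
  have "(cmod (w - v))\<^sup>2 < (cmod (w - cnj v))\<^sup>2"
    using assms by (simp add: norm_diff_cnj_sq)
  then have "cmod (w - v) < cmod (w - cnj v)"
    by (simp add: power2_less_imp_less)
  then show ?thesis
    using diff_cnj_nonzero[OF assms] by (simp add: disc_of_half_def norm_divide)
qed

lemma half_of_disc_of_half:
  assumes "Im w > 0" "Im v > 0"
  shows "half_of_disc v (disc_of_half v w) = w"
proof -
  have n: "w - cnj v \<noteq> 0" by (rule diff_cnj_nonzero[OF assms])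
  have nv: "v - cnj v \<noteq> 0" by (rule diff_cnj_nonzero[OF assms(2) assms(2)])
  have "1 - disc_of_half v w = (v - cnj v) / (w - cnj v)"
    using n by (simp add: disc_of_half_def field_simps)
  moreover have "v - cnj v * disc_of_half v w = w * (v - cnj v) / (w - cnj v)"
    using n by (simp add: disc_of_half_def field_simps)
  ultimately show ?thesis using n nv by (simp add: half_of_disc_def)
qed

lemma Im_half_of_disc:
  assumes "Im v > 0" "cmod \<zeta> < 1"
  shows "Im (half_of_disc v \<zeta>) > 0"
proof -
  have "\<zeta> \<noteq> 1" using assms by auto
  have "Im (half_of_disc v \<zeta>) = Im ((v - cnj v * \<zeta>) * cnj (1 - \<zeta>)) / (cmod (1 - \<zeta>))\<^sup>2"
    unfolding half_of_disc_def
    by (subst complex_div_cnj) (simp only: of_real_power[symmetric] Im_divide_of_real)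
  also have "Im ((v - cnj v * \<zeta>) * cnj (1 - \<zeta>)) = Im v * (1 - (cmod \<zeta>)\<^sup>2)"
    unfolding cmod_power2 by (simp add: power2_eq_square algebra_simps)
  finally show ?thesis
    using assms \<open>\<zeta> \<noteq> 1\<close> by (simp add: abs_square_less_1)
qed

text \<open>Conjugating a self-map \<open>P\<close> of the upper half-plane by these Moebius maps gives a self-map of the disc
that fixes \<open>0\<close>, to which the Schwarz lemma applies.\<close>

locale half_plane_map =
  fixes P :: "complex \<Rightarrow> complex" and v :: complex
  assumes hol: "P holomorphic_on upper_half_plane"
    and pos: "\<And>w. Im w > 0 \<Longrightarrow> Im (P w) > 0" and v: "Im v > 0"
begin

definition "disc_map \<zeta> = disc_of_half (P v) (P (half_of_disc v \<zeta>))"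

lemma disc_map_hol: "disc_map holomorphic_on ball 0 1"
proof -
  have 1: "half_of_disc v holomorphic_on ball 0 1"
    unfolding half_of_disc_def by (auto intro!: holomorphic_intros)
  have "(P \<circ> half_of_disc v) holomorphic_on ball 0 1"
    by (rule holomorphic_on_compose_gen[OF 1 hol])
       (auto simp: upper_half_plane_def Im_half_of_disc v)
  then have 2: "(\<lambda>\<zeta>. P (half_of_disc v \<zeta>)) holomorphic_on ball 0 1" by (simp add: o_def)
  show ?thesis unfolding disc_map_def disc_of_half_def
    by (intro holomorphic_intros 2 diff_cnj_nonzero) (auto intro!: pos Im_half_of_disc v)
qed

lemma disc_map_0: "disc_map 0 = 0"
  by (simp add: disc_map_def half_of_disc_def disc_of_half_def)

lemma disc_map_lt: "cmod \<zeta> < 1 \<Longrightarrow> cmod (disc_map \<zeta>) < 1"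
  unfolding disc_map_def by (intro norm_disc_of_half_lt pos Im_half_of_disc v)

lemma disc_map_disc_of_half: "Im w > 0 \<Longrightarrow> disc_map (disc_of_half v w) = disc_of_half (P v) (P w)"
  by (simp add: disc_map_def half_of_disc_of_half v)

lemma deriv_disc_map: "deriv disc_map 0 = deriv P v * of_real (Im v / Im (P v))"
proof -
  have P: "(P has_field_derivative deriv P v) (at (half_of_disc v 0))"
    using hol v by (auto simp: half_of_disc_def upper_half_plane_def open_halfspace_Im_gt
        intro!: holomorphic_derivI)
  have S: "(half_of_disc v has_field_derivative (v - cnj v)) (at 0)"
    unfolding half_of_disc_def by (auto intro!: derivative_eq_intros)
  have nz: "P v - cnj (P v) \<noteq> 0" by (intro diff_cnj_nonzero pos v)
  have T: "(disc_of_half (P v) has_field_derivative (1 / (P v - cnj (P v)))) (at (P (half_of_disc v 0)))"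
    unfolding disc_of_half_def half_of_disc_def using nz by (auto intro!: derivative_eq_intros)
  have "(disc_map has_field_derivative (1 / (P v - cnj (P v))) * (deriv P v * (v - cnj v))) (at 0)"
    unfolding disc_map_def
    using DERIV_chain2[OF T DERIV_chain2[OF P S]] by simp
  then have "deriv disc_map 0 = (1 / (P v - cnj (P v))) * (deriv P v * (v - cnj v))"
    by (rule DERIV_imp_deriv)
  moreover have "v - cnj v = 2 * \<i> * of_real (Im v)" "P v - cnj (P v) = 2 * \<i> * of_real (Im (P v))"
    by (simp_all add: complex_eq_iff)
  ultimately show ?thesis by simp
qed

lemma schwarz_pick:
  assumes w: "Im w > 0"
  shows "(cmod (P w - P v))\<^sup>2 * (Im w * Im v) \<le> Im (P w) * Im (P v) * (cmod (w - v))\<^sup>2"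
proof -
  have "cmod (disc_map (disc_of_half v w)) \<le> cmod (disc_of_half v w)"
    by (rule Schwarz_Lemma(1)[OF disc_map_hol disc_map_0 disc_map_lt norm_disc_of_half_lt[OF w v]])
  then have "cmod (P w - P v) / cmod (P w - cnj (P v)) \<le> cmod (w - v) / cmod (w - cnj v)"
    unfolding disc_map_disc_of_half[OF w] by (simp add: disc_of_half_def norm_divide)
  then have "(cmod (P w - P v) / cmod (P w - cnj (P v)))\<^sup>2 \<le> (cmod (w - v) / cmod (w - cnj v))\<^sup>2"
    by (rule power_mono) auto
  moreover have "cmod (P w - cnj (P v)) > 0" "cmod (w - cnj v) > 0"
    using diff_cnj_nonzero[OF w v] diff_cnj_nonzero[OF pos[OF w] pos[OF v]] by auto
  ultimately have "(cmod (P w - P v))\<^sup>2 * (cmod (w - cnj v))\<^sup>2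
      \<le> (cmod (w - v))\<^sup>2 * (cmod (P w - cnj (P v)))\<^sup>2"
    by (simp add: power_divide divide_simps split: if_splits)
  then show ?thesis by (simp add: norm_diff_cnj_sq algebra_simps)
qed

text \<open>Equality in the derivative part of the Schwarz lemma forces the conjugated map to be a rotation, here
by the angle \<open>0\<close>; a Moebius map \<open>P\<close> that keeps the height of \<open>v\<close> is then a translation.\<close>

lemma translation_if_extremal:
  assumes "Im (P v) = Im v" "deriv P v = 1" "Im w > 0"
  shows "P w = w + (P v - v)"
proof -
  have d1: "deriv disc_map 0 = 1" using assms v by (simp add: deriv_disc_map)
  then obtain \<alpha> where \<alpha>: "\<And>z. norm z < 1 \<Longrightarrow> disc_map z = \<alpha> * z"
    using Schwarz_Lemma(3)[OF disc_map_hol disc_map_0 disc_map_lt, of 0] by auto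
  have "deriv disc_map 0 = deriv (\<lambda>z. \<alpha> * z) 0"
    by (rule deriv_cong_ev)
       (auto intro!: eventually_nhds_in_open[of "ball 0 1", THEN eventually_mono] \<alpha>)
  then have "\<alpha> = 1" using d1 by simp
  then have eq: "disc_of_half (P v) (P w) = disc_of_half v w"
    using disc_map_disc_of_half[OF assms(3)] \<alpha> norm_disc_of_half_lt[OF assms(3) v] by simp
  obtain t where t: "P v = v + of_real t"
  proof
    show "P v = v + of_real (Re (P v) - Re v)" using assms(1) by (simp add: complex_eq_iff)
  qed
  have "disc_of_half (P v) (P w) = disc_of_half v (P w - of_real t)"
    by (simp add: disc_of_half_def t algebra_simps)
  then have "half_of_disc v (disc_of_half v (P w - of_real t)) = half_of_disc v (disc_of_half v w)"
    using eq by simp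
  then have "P w - of_real t = w"
    using assms(3) pos[of w] v by (simp add: half_of_disc_of_half)
  then show ?thesis using t by (simp add: algebra_simps)
qed

end

text \<open>The pseudo-hyperbolic form of the inequality is free of denominators and thus survives the limit
\<open>\<epsilon> \<longlonglongrightarrow> 0\<close> of the maps \<open>P + \<i> * \<epsilon>\<close>. This covers maps that touch the real axis.\<close>

lemma schwarz_pick_nonneg:
  assumes hol: "P holomorphic_on upper_half_plane"
    and pos: "\<And>w. Im w > 0 \<Longrightarrow> Im (P w) \<ge> 0" and v: "Im v > 0" and w: "Im w > 0"
  shows "(cmod (P w - P v))\<^sup>2 * (Im w * Im v) \<le> Im (P w) * Im (P v) * (cmod (w - v))\<^sup>2"
proof (rule LIMSEQ_le)
  let ?e = "\<lambda>n. 1 / real (Suc n)"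
  show "(\<lambda>n. (cmod (P w - P v))\<^sup>2 * (Im w * Im v)) \<longlonglongrightarrow> (cmod (P w - P v))\<^sup>2 * (Im w * Im v)"
    by simp
  have e: "?e \<longlonglongrightarrow> 0" using LIMSEQ_inverse_real_of_nat by (simp add: inverse_eq_divide)
  have "(\<lambda>n. (Im (P w) + ?e n) * (Im (P v) + ?e n) * (cmod (w - v))\<^sup>2)
      \<longlonglongrightarrow> (Im (P w) + 0) * (Im (P v) + 0) * (cmod (w - v))\<^sup>2"
    by (intro tendsto_intros e)
  then show "(\<lambda>n. (Im (P w) + ?e n) * (Im (P v) + ?e n) * (cmod (w - v))\<^sup>2)
      \<longlonglongrightarrow> Im (P w) * Im (P v) * (cmod (w - v))\<^sup>2" by simp
  show "\<exists>N. \<forall>n\<ge>N. (cmod (P w - P v))\<^sup>2 * (Im w * Im v)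
      \<le> (Im (P w) + ?e n) * (Im (P v) + ?e n) * (cmod (w - v))\<^sup>2"
  proof (intro exI allI impI)
    fix n :: nat
    have "?e n > 0" by simp
    interpret half_plane_map "\<lambda>w. P w + \<i> * of_real (?e n)" v
    proof
      show "(\<lambda>w. P w + \<i> * of_real (?e n)) holomorphic_on upper_half_plane"
        by (intro holomorphic_intros hol)
      show "Im (P w + \<i> * of_real (?e n)) > 0" if "Im w > 0" for w
        using pos[OF that] \<open>?e n > 0\<close> by (simp del: of_nat_Suc add: add_nonneg_pos)
    qed (rule v)
    show "(cmod (P w - P v))\<^sup>2 * (Im w * Im v)
      \<le> (Im (P w) + ?e n) * (Im (P v) + ?e n) * (cmod (w - v))\<^sup>2"
      using schwarz_pick[OF w] by (simp del: of_nat_Suc of_real_divide)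
  qed
qed

text \<open>The function \<open>P\<close> stands for the negative of a Voiculescu transform on the whole upper half-plane, and
\<open>w - P w\<close> for the inverse of an \<open>F\<close>-transform. Everything needed about this inverse follows from
the fact that \<open>P\<close> does not increase hyperbolic distances.\<close>

locale subordinate_inverse =
  fixes P :: "complex \<Rightarrow> complex"
  assumes hol: "P holomorphic_on upper_half_plane"
    and nonneg: "\<And>w. Im w > 0 \<Longrightarrow> Im (P w) \<ge> 0"
begin

text \<open>If \<open>v\<close> and \<open>w\<close> have the same image, then \<open>P\<close> displaces them by the same vector, but strictly lowers
both; so \<open>P\<close> would increase their hyperbolic distance.\<close>

lemma inj_over_upper_half_plane:
  assumes "Im v > 0" "Im w > 0" "Im (v - P v) > 0" "Im (w - P w) > 0" "v - P v = w - P w"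
  shows "v = w"
proof (rule ccontr)
  assume "v \<noteq> w"
  have eq: "P w - P v = w - v" using assms(5) by (simp add: algebra_simps)
  have "(cmod (w - v))\<^sup>2 * (Im w * Im v) \<le> Im (P w) * Im (P v) * (cmod (w - v))\<^sup>2"
    using schwarz_pick_nonneg[OF hol nonneg assms(1,2)] by (simp add: eq)
  then have "Im w * Im v \<le> Im (P w) * Im (P v)"
    using \<open>v \<noteq> w\<close> by (simp add: mult.commute)
  moreover have "Im (P w) * Im (P v) < Im w * Im v"
    using assms(1-4) nonneg[of w] nonneg[of v] by (intro mult_strict_mono') auto
  ultimately show False by simp
qed

text \<open>By Harnack's inequality, here a consequence of Schwarz-Pick, \<open>Im (P v) / Im v\<close> does not increase along vertical rays, so the set where
\<open>w - P w\<close> lies in the upper half-plane contains with a point the vertical ray above it. The second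
part bounds how far the image moves while one climbs such a ray.\<close>

lemma vertical_ray_above:
  assumes "Im w > 0" "Im (w - P w) > 0" "y \<ge> Im w"
  defines "v \<equiv> Complex (Re w) y"
  shows "Im (v - P v) > 0" and "cmod ((v - P v) - (w - P w)) \<le> 2 * y"
proof -
  define A b B where "A = Im (P v)" and "b = Im w" and "B = Im (P w)"
  have y: "y > 0" and b: "b > 0" and yb: "b \<le> y" using assms by (auto simp: b_def)
  have A0: "A \<ge> 0" using nonneg[of v] y by (simp add: A_def v_def)
  have B0: "B \<ge> 0" "B < b" using nonneg[of w] assms by (auto simp: B_def b_def)
  have "cmod (v - w) = \<bar>y - b\<bar>" by (simp add: v_def b_def cmod_def)
  then have sp: "(cmod (P v - P w))\<^sup>2 * (y * b) \<le> A * B * (y - b)\<^sup>2"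
    using schwarz_pick_nonneg[OF hol nonneg, of w v] y b by (simp add: v_def A_def B_def b_def)
  have "(A - B)\<^sup>2 \<le> (cmod (P v - P w))\<^sup>2"
    by (simp add: A_def B_def cmod_power2)
  then have AB: "(A - B)\<^sup>2 * (y * b) \<le> A * B * (y - b)\<^sup>2"
    using sp mult_right_mono[of "(A - B)\<^sup>2" "(cmod (P v - P w))\<^sup>2" "y * b"] y b
    by (meson less_imp_le mult_nonneg_nonneg order_trans)
  have Ab: "A * b \<le> B * y"
  proof (rule ccontr)
    assume c: "\<not> A * b \<le> B * y"
    \<comment> \<open>The Schwarz-Pick inequality for the heights \<open>A\<close>, \<open>B\<close> says that this product is not positive.\<close>
    have "(A * b - B * y) * (A * y - B * b) = (A - B)\<^sup>2 * (y * b) - A * B * (y - b)\<^sup>2"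
      by (simp add: power2_eq_square algebra_simps)
    then have "(A * b - B * y) * (A * y - B * b) \<le> 0" using AB by simp
    moreover have "B * b \<le> B * y" "A * b \<le> A * y" using yb A0 B0 by (auto intro: mult_left_mono)
    then have "A * y - B * b > 0" using c by linarith
    then have "(A * b - B * y) * (A * y - B * b) > 0" using c by simp
    ultimately show False by simp
  qed
  also have "B * y < b * y" using B0 y by simp
  finally have "A < y" using b by (simp add: mult.commute)
  then show "Im (v - P v) > 0" by (simp add: A_def v_def)
  have "A * B \<le> y * b" using \<open>A < y\<close> B0 A0 by (intro mult_mono) auto
  then have "A * B * (y - b)\<^sup>2 \<le> y * b * (y - b)\<^sup>2" by (intro mult_right_mono) auto
  with sp have "(cmod (P v - P w))\<^sup>2 * (y * b) \<le> (y - b)\<^sup>2 * (y * b)" by (simp add: mult_ac)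
  then have "(cmod (P v - P w))\<^sup>2 \<le> (y - b)\<^sup>2" using y b by simp
  then have "cmod (P v - P w) \<le> y - b"
    by (rule power2_le_imp_le) (simp add: yb)
  moreover have "cmod ((v - P v) - (w - P w)) \<le> cmod (v - w) + cmod (P v - P w)"
    using norm_triangle_ineq4[of "v - w" "P v - P w"] by (subst diff_diff_distrib_swap)
  ultimately show "cmod ((v - P v) - (w - P w)) \<le> 2 * y"
    using \<open>cmod (v - w) = \<bar>y - b\<bar>\<close> yb b by linarith
qed

text \<open>A critical point with real value would be an extremal point in the Schwarz lemma for \<open>P\<close>, making \<open>P\<close> a
translation and \<open>w - P w\<close> a real constant. If \<open>P\<close> takes a real value at all then it is constant, and
it cannot agree with \<open>w0 - x\<close> at \<open>w0\<close>.\<close>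

lemma deriv_nonzero_at_real_value:
  assumes "Im w0 > 0" "w0 - P w0 = of_real x" and "Im w1 > 0" "Im (w1 - P w1) > 0"
  shows "deriv P w0 \<noteq> 1"
proof
  assume d: "deriv P w0 = 1"
  have I0: "Im (P w0) = Im w0" using assms(2) by (simp add: complex_eq_iff)
  show False
  proof (cases "\<exists>u. Im u > 0 \<and> Im (P u) = 0")
    case True
    then obtain u where u: "Im u > 0" "Im (P u) = 0" by auto
    have "(cmod (P w0 - P u))\<^sup>2 * (Im w0 * Im u) \<le> 0"
      using schwarz_pick_nonneg[OF hol nonneg u(1) assms(1)] u by simp
    then have "P w0 = P u"
      using u(1) assms(1) by (simp add: mult_le_0_iff power2_eq_square zero_le_mult_iff)
    then show False using u I0 assms(1) by simp
  next
    case False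
    then have "Im w > 0 \<Longrightarrow> Im (P w) > 0" for w using nonneg[of w] by fastforce
    then interpret half_plane_map P w0
      by unfold_locales (use hol assms in auto)
    have "P w1 = w1 + (P w0 - w0)" by (rule translation_if_extremal[OF I0 d assms(3)])
    then have "w1 - P w1 = of_real x" using assms(2) by simp
    then have "Im (w1 - P w1) = 0" by (simp only: Im_complex_of_real)
    then show False using assms(4) by (simp only: less_irrefl)
  qed
qed

end

section \<open>Cauchy transforms and reciprocal Cauchy transforms\<close>

lemma norm_minus_of_real_ge: "cmod (z - of_real t) \<ge> \<bar>Im z\<bar>"
  using abs_Im_le_cmod[of "z - of_real t"] by simp

lemma norm_minus_of_real_sq: "(cmod (z - of_real t))\<^sup>2 = (Re z - t)\<^sup>2 + (Im z)\<^sup>2"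
  by (simp add: cmod_power2)

lemma Im_kernel: "Im (1 / (z - of_real t)) = - (Im z / ((Re z - t)\<^sup>2 + (Im z)\<^sup>2))"
  by (simp add: Im_divide power2_eq_square)

lemma kernel_le:
  assumes "Im z > 0"
  shows "cmod (1 / (z - of_real t)) \<le> 1 / Im z"
  using norm_minus_of_real_ge[of z t] assms
  by (simp add: norm_divide divide_simps)

lemma minus_of_real_nonzero: "Im z > 0 \<Longrightarrow> z - of_real t \<noteq> 0"
  using norm_minus_of_real_ge[of z t] by auto

context real_distribution
begin

lemma prob_UNIV: "prob UNIV = 1"
  using prob_space by simp

lemma integrable_kernel:
  assumes "Im z > 0"
  shows "integrable M (\<lambda>t. 1 / (z - complex_of_real t))"
  by (rule integrable_const_bound[where B = "1 / Im z"]) (auto intro!: AE_I2 kernel_le[OF assms])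

lemma integrable_poisson:
  assumes "Im z > 0"
  shows "integrable M (\<lambda>t. Im z / ((Re z - t)\<^sup>2 + (Im z)\<^sup>2))"
proof -
  have "integrable M (\<lambda>t. Im (1 / (z - complex_of_real t)))"
    by (intro integrable_Im integrable_kernel assms)
  then show ?thesis unfolding Im_kernel by simp
qed

lemma Im_cauchy_transform:
  assumes "Im z > 0"
  shows "- Im (cauchy_transform M z) = (\<integral>t. Im z / ((Re z - t)\<^sup>2 + (Im z)\<^sup>2) \<partial>M)"
proof -
  have "Im (cauchy_transform M z) = (\<integral>t. Im (1 / (z - complex_of_real t)) \<partial>M)"
    unfolding cauchy_transform_def by (rule integral_Im[symmetric]) (rule integrable_kernel[OF assms])
  also have "\<dots> = - (\<integral>t. Im z / ((Re z - t)\<^sup>2 + (Im z)\<^sup>2) \<partial>M)"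
    unfolding Im_kernel by simp
  finally show ?thesis by simp
qed

lemma has_field_derivative_cauchy_transform:
  assumes z: "Im z > 0"
  shows "(cauchy_transform M has_field_derivative (\<integral>t. - (1 / (z - of_real t))\<^sup>2 \<partial>M)) (at z)"
proof -
  define y where "y = Im z"
  have y: "y > 0" using z by (simp add: y_def)
  have int2: "integrable M (\<lambda>t. - (1 / (z - complex_of_real t))\<^sup>2)"
  proof (rule integrable_const_bound[where B = "(1 / y)\<^sup>2"])
    show "AE t in M. cmod (- (1 / (z - complex_of_real t))\<^sup>2) \<le> (1 / y)\<^sup>2"
      unfolding norm_minus_cancel norm_power
      by (intro AE_I2 power_mono) (use kernel_le[OF z] in \<open>auto simp: y_def\<close>)
  qed auto
  let ?D = "\<integral>t. - (1 / (z - of_real t))\<^sup>2 \<partial>M"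
  have bound: "cmod ((cauchy_transform M w - cauchy_transform M z) / (w - z) - ?D) \<le> cmod (w - z) * (2 / y ^ 3)"
    if w: "w \<noteq> z" "cmod (w - z) < y / 2" for w
  proof -
    have "\<bar>Im (w - z)\<bar> < y / 2" using abs_Im_le_cmod[of "w - z"] w by linarith
    then have wy: "Im w > y / 2" unfolding y_def minus_complex.sel by arith
    then have w0: "Im w > 0" using y by linarith
    \<comment> \<open>The error of the first-order expansion of the kernel is quadratic, uniformly in \<open>t\<close>.\<close>
    have e: "(1 / (w - of_real t) - 1 / (z - of_real t)) / (w - z) - - (1 / (z - of_real t))\<^sup>2
        = (w - z) * (1 / (w - of_real t)) * (1 / (z - of_real t))\<^sup>2" for t
      using minus_of_real_nonzero[OF z, of t] minus_of_real_nonzero[OF w0, of t] w(1)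
      by (simp add: divide_simps power2_eq_square) (simp add: algebra_simps)
    have b: "cmod ((1 / (w - of_real t) - 1 / (z - of_real t)) / (w - z) - - (1 / (z - of_real t))\<^sup>2)
        \<le> cmod (w - z) * (2 / y ^ 3)" for t
    proof -
      have "cmod (1 / (w - of_real t)) \<le> 2 / y"
      proof -
        have "1 / Im w \<le> 1 / (y / 2)" using wy y by (intro divide_left_mono) auto
        then show ?thesis using kernel_le[OF w0, of t] by simp
      qed
      moreover have "cmod (1 / (z - of_real t)) \<le> 1 / y" using kernel_le[OF z, of t] by (simp add: y_def)
      ultimately have "cmod ((w - z) * (1 / (w - of_real t)) * (1 / (z - of_real t))\<^sup>2)
          \<le> cmod (w - z) * (2 / y) * (1 / y)\<^sup>2"
        unfolding norm_mult norm_power using y by (intro mult_mono power_mono) auto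
      also have "\<dots> = cmod (w - z) * (2 / y ^ 3)"
        using y by (simp add: field_simps power2_eq_square power3_eq_cube)
      finally show ?thesis unfolding e .
    qed
    have iq: "integrable M (\<lambda>t. (1 / (w - of_real t) - 1 / (z - of_real t)) / (w - z))"
      by (intro integrable_divide Bochner_Integration.integrable_diff integrable_kernel z w0)
    have "cauchy_transform M w - cauchy_transform M z = (\<integral>t. 1 / (w - of_real t) - 1 / (z - of_real t) \<partial>M)"
      unfolding cauchy_transform_def
      by (intro Bochner_Integration.integral_diff[symmetric] integrable_kernel w0 z)
    then have "(cauchy_transform M w - cauchy_transform M z) / (w - z)
       = (\<integral>t. (1 / (w - of_real t) - 1 / (z - of_real t)) / (w - z) \<partial>M)"
      by (simp only: integral_divide_zero)
    then have "(cauchy_transform M w - cauchy_transform M z) / (w - z) - ?D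
       = (\<integral>t. (1 / (w - of_real t) - 1 / (z - of_real t)) / (w - z) - - (1 / (z - of_real t))\<^sup>2 \<partial>M)"
      by (simp only: Bochner_Integration.integral_diff[OF iq int2])
    moreover have "cmod (\<integral>t. (1 / (w - of_real t) - 1 / (z - of_real t)) / (w - z) - - (1 / (z - of_real t))\<^sup>2 \<partial>M)
        \<le> cmod (w - z) * (2 / y ^ 3)"
      by (rule order_trans[OF integral_norm_bound integral_le_const])
         (intro integrable_norm Bochner_Integration.integrable_diff iq int2 AE_I2 b)+
    ultimately show ?thesis by (simp only:)
  qed
  have "((\<lambda>w. (cauchy_transform M w - cauchy_transform M z) / (w - z) - ?D) \<longlongrightarrow> 0) (at z)"
  proof (rule Lim_null_comparison)
    show "\<forall>\<^sub>F w in at z. cmod ((cauchy_transform M w - cauchy_transform M z) / (w - z) - ?D) \<le> cmod (w - z) * (2 / y ^ 3)"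
      unfolding eventually_at dist_norm
      by (intro exI[of _ "y / 2"] conjI ballI impI bound) (use y in auto)
    have "((\<lambda>w. cmod (w - z) * (2 / y ^ 3)) \<longlongrightarrow> cmod (z - z) * (2 / y ^ 3)) (at z)"
      by (intro tendsto_intros)
    then show "((\<lambda>w. cmod (w - z) * (2 / y ^ 3)) \<longlongrightarrow> 0) (at z)" by simp
  qed
  then show ?thesis
    unfolding has_field_derivative_iff by (rule LIM_zero_cancel)
qed

lemma holomorphic_cauchy_transform: "cauchy_transform M holomorphic_on upper_half_plane"
  using has_field_derivative_cauchy_transform
  by (auto simp: upper_half_plane_def holomorphic_on_open open_halfspace_Im_gt)

lemma cauchy_transform_at_i_neg: "Im (cauchy_transform M \<i>) < 0"
proof -
  have "(\<integral>t. - (1 / ((0 - t)\<^sup>2 + 1)) \<partial>M) < 0"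
  proof (rule expectation_less)
    show "integrable M (\<lambda>t. - (1 / ((0 - t)\<^sup>2 + 1)))"
      using integrable_poisson[of \<i>] by simp
    show "AE t in M. - (1 / ((0 - t)\<^sup>2 + 1)) < 0"
      by (intro AE_I2) (simp add: add_nonneg_pos)
  qed
  then show ?thesis using Im_cauchy_transform[of \<i>] by simp
qed

text \<open>The Poisson kernel at \<open>z\<close> dominates a multiple of the kernel at \<open>\<i>\<close>, with a factor that does not depend
on the measure. Since the value at \<open>\<i>\<close> converges along a weakly convergent sequence, this replaces
tightness as the source of bounds that are uniform along the sequence.\<close>

lemma poisson_integral_ge:
  assumes z: "Im z > 0"
  shows "- Im (cauchy_transform M \<i>) * (Im z / (2 * (Re z)\<^sup>2 + (Im z)\<^sup>2 + 2)) \<le> - Im (cauchy_transform M z)"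
proof -
  define x y where "x = Re z" and "y = Im z"
  have y: "y > 0" using z by (simp add: y_def)
  have b: "1 / ((0 - t)\<^sup>2 + 1\<^sup>2) * (y / (2 * x\<^sup>2 + y\<^sup>2 + 2)) \<le> y / ((x - t)\<^sup>2 + y\<^sup>2)" for t
  proof -
    have "0 \<le> (x + t)\<^sup>2 + 2 * x\<^sup>2 * t\<^sup>2 + y\<^sup>2 * t\<^sup>2 + 2" by (intro add_nonneg_nonneg) auto
    then have "(x - t)\<^sup>2 + y\<^sup>2 \<le> (2 * x\<^sup>2 + y\<^sup>2 + 2) * ((0 - t)\<^sup>2 + 1\<^sup>2)"
      by (simp add: power2_eq_square algebra_simps)
    moreover have "(x - t)\<^sup>2 + y\<^sup>2 > 0" using y by (simp add: add_nonneg_pos)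
    ultimately have "y / ((2 * x\<^sup>2 + y\<^sup>2 + 2) * ((0 - t)\<^sup>2 + 1\<^sup>2)) \<le> y / ((x - t)\<^sup>2 + y\<^sup>2)"
      using y by (intro divide_left_mono) auto
    then show ?thesis by (simp add: mult.commute)
  qed
  have ii: "integrable M (\<lambda>t. 1 / ((0 - t)\<^sup>2 + 1\<^sup>2))" using integrable_poisson[of \<i>] by simp
  have "- Im (cauchy_transform M \<i>) = (\<integral>t. 1 / ((0 - t)\<^sup>2 + 1\<^sup>2) \<partial>M)"
    using Im_cauchy_transform[of \<i>] by simp
  then have "- Im (cauchy_transform M \<i>) * (y / (2 * x\<^sup>2 + y\<^sup>2 + 2))
      = (\<integral>t. 1 / ((0 - t)\<^sup>2 + 1\<^sup>2) * (y / (2 * x\<^sup>2 + y\<^sup>2 + 2)) \<partial>M)"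
    by (simp only: integral_mult_left_zero)
  also have "\<dots> \<le> (\<integral>t. y / ((x - t)\<^sup>2 + y\<^sup>2) \<partial>M)"
    by (intro integral_mono integrable_mult_left ii b) (use integrable_poisson[OF z] in \<open>simp_all add: x_def y_def\<close>)
  also have "\<dots> = - Im (cauchy_transform M z)" using Im_cauchy_transform[OF z] by (simp add: x_def y_def)
  finally show ?thesis by (simp only: x_def y_def)
qed

lemma Im_cauchy_transform_neg:
  assumes "Im z > 0" shows "Im (cauchy_transform M z) < 0"
proof -
  have "2 * (Re z)\<^sup>2 + (Im z)\<^sup>2 + 2 > 0" by (intro add_nonneg_pos) auto
  then have "- Im (cauchy_transform M \<i>) * (Im z / (2 * (Re z)\<^sup>2 + (Im z)\<^sup>2 + 2)) > 0"
    using assms cauchy_transform_at_i_neg by (intro mult_pos_pos divide_pos_pos) auto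
  then show ?thesis using poisson_integral_ge[OF assms] by linarith
qed

text \<open>This is the Cauchy-Schwarz inequality, in the form that a variance is nonnegative.\<close>

lemma norm_cauchy_transform_sq_le:
  assumes z: "Im z > 0"
  shows "Im z * (cmod (cauchy_transform M z))\<^sup>2 \<le> - Im (cauchy_transform M z)"
proof -
  let ?X = "\<lambda>t. cmod (1 / (z - complex_of_real t))"
  have sq: "(?X t)\<^sup>2 = (1 / Im z) * (Im z / ((Re z - t)\<^sup>2 + (Im z)\<^sup>2))" for t
    using z by (simp add: norm_divide power_divide norm_minus_of_real_sq)
  have i1: "integrable M ?X" by (intro integrable_norm integrable_kernel z)
  have i2: "integrable M (\<lambda>t. (?X t)\<^sup>2)"
    unfolding sq by (intro integrable_mult_right integrable_poisson z)
  have "(expectation ?X)\<^sup>2 \<le> expectation (\<lambda>t. (?X t)\<^sup>2)"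
    using variance_eq[OF i1 i2] variance_positive[of ?X] by linarith
  also have "expectation (\<lambda>t. (?X t)\<^sup>2) = - Im (cauchy_transform M z) / Im z"
    unfolding sq integral_mult_right_zero Im_cauchy_transform[OF z] by simp
  finally have 1: "(expectation ?X)\<^sup>2 \<le> - Im (cauchy_transform M z) / Im z" .
  have "cmod (cauchy_transform M z) \<le> expectation ?X"
    unfolding cauchy_transform_def by (rule integral_norm_bound)
  then have "(cmod (cauchy_transform M z))\<^sup>2 \<le> (expectation ?X)\<^sup>2" by (intro power_mono) auto
  with 1 have "(cmod (cauchy_transform M z))\<^sup>2 \<le> - Im (cauchy_transform M z) / Im z" by linarith
  then show ?thesis using z by (simp add: field_simps)
qed

lemma cauchy_transform_nonzero: "Im z > 0 \<Longrightarrow> cauchy_transform M z \<noteq> 0"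
  using Im_cauchy_transform_neg[of z] by auto

lemma Im_F_transform_eq:
  "Im (F_transform M z) = - Im (cauchy_transform M z) / (cmod (cauchy_transform M z))\<^sup>2"
  by (simp add: F_transform_def Im_divide cmod_power2)

lemma Im_F_transform_ge:
  assumes "Im z > 0" shows "Im (F_transform M z) \<ge> Im z"
  using norm_cauchy_transform_sq_le[OF assms] cauchy_transform_nonzero[OF assms]
  unfolding Im_F_transform_eq by (subst pos_le_divide_eq) auto

lemma Im_F_transform_pos: "Im z > 0 \<Longrightarrow> Im (F_transform M z) > 0"
  using Im_F_transform_ge[of z] by linarith

lemma norm_F_transform_le:
  assumes z: "Im z > 0"
  shows "cmod (F_transform M z) \<le> (2 * (Re z)\<^sup>2 + (Im z)\<^sup>2 + 2) / (- Im (cauchy_transform M \<i>) * Im z)"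
proof -
  let ?D = "2 * (Re z)\<^sup>2 + (Im z)\<^sup>2 + 2"
  have D: "?D > 0" by (intro add_nonneg_pos) auto
  have k: "- Im (cauchy_transform M \<i>) * Im z > 0" using cauchy_transform_at_i_neg z by (simp add: mult_neg_pos)
  define K where "K = - Im (cauchy_transform M \<i>) * Im z / ?D"
  have K: "K > 0" unfolding K_def using k D by (rule divide_pos_pos)
  have "K \<le> - Im (cauchy_transform M z)"
    using poisson_integral_ge[OF z] by (simp add: K_def)
  then have "K \<le> cmod (cauchy_transform M z)"
    using abs_Im_le_cmod[of "cauchy_transform M z"] by linarith
  then have "1 / cmod (cauchy_transform M z) \<le> 1 / K"
    by (intro divide_left_mono mult_pos_pos K) (use K in linarith)+
  then show ?thesis unfolding K_def F_transform_def norm_divide by simp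
qed

lemma holomorphic_F_transform: "F_transform M holomorphic_on upper_half_plane"
  unfolding F_transform_def
  by (intro holomorphic_intros holomorphic_cauchy_transform cauchy_transform_nonzero)
     (auto simp: upper_half_plane_def)

end

lemma cauchy_transform_tendsto:
  assumes "\<And>n. real_distribution (\<nu>s n)" "real_distribution \<nu>" "weak_conv_m \<nu>s \<nu>" "Im z > 0"
  shows "(\<lambda>n. cauchy_transform (\<nu>s n) z) \<longlonglongrightarrow> cauchy_transform \<nu> z"
  unfolding cauchy_transform_def
proof (rule weak_conv_imp_integral_bdd_continuous_conv[OF assms(1-3)])
  show "isCont (\<lambda>t. 1 / (z - complex_of_real t)) t" for t
    using minus_of_real_nonzero[OF assms(4)] by (intro continuous_intros) auto
  show "cmod (1 / (z - of_real t)) \<le> 1 / Im z" for t by (rule kernel_le[OF assms(4)])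
qed

lemma F_transform_tendsto:
  assumes "\<And>n. real_distribution (\<nu>s n)" "real_distribution \<nu>" "weak_conv_m \<nu>s \<nu>" "Im z > 0"
  shows "(\<lambda>n. F_transform (\<nu>s n) z) \<longlonglongrightarrow> F_transform \<nu> z"
  unfolding F_transform_def
  by (intro tendsto_intros cauchy_transform_tendsto assms real_distribution.cauchy_transform_nonzero)

section \<open>Voiculescu transforms on truncated cones\<close>

lemma holomorphic_on_compose_fun: "f holomorphic_on S \<Longrightarrow> g holomorphic_on T \<Longrightarrow> f ` S \<subseteq> T \<Longrightarrow> (\<lambda>z. g (f z)) holomorphic_on S"
  using holomorphic_on_compose_gen[of f S g T] by (simp add: o_def)

text \<open>An open version of the regions \<open>Gamma_region \<alpha> \<beta>\<close> with a single parameter. These convex sets increase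
to the upper half-plane as \<open>\<epsilon>\<close> decreases to \<open>0\<close>.\<close>

definition trunc_cone :: "real \<Rightarrow> complex set" where
  "trunc_cone \<epsilon> = {z. Im z > \<epsilon> \<and> Im z > \<epsilon> * \<bar>Re z\<bar>}"

lemma open_trunc_cone: "open (trunc_cone \<epsilon>)"
  unfolding trunc_cone_def by (intro open_Collect_conj open_Collect_less continuous_intros)

lemma convex_trunc_cone: "convex (trunc_cone \<epsilon>)" if "\<epsilon> > 0"
proof -
  have "trunc_cone \<epsilon> = {z. Im z > \<epsilon>} \<inter> {z. \<epsilon> * Re z - Im z < 0} \<inter> {z. - \<epsilon> * Re z - Im z < 0}"
  proof -
    have "\<epsilon> * \<bar>r\<bar> < m \<longleftrightarrow> \<epsilon> * r < m \<and> - (\<epsilon> * r) < m" for r m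
      using that by (metis abs_less_iff abs_mult abs_of_pos)
    then show ?thesis by (auto simp: trunc_cone_def)
  qed
  also have "\<dots> = {z. Im z > \<epsilon>} \<inter> {z. inner (Complex \<epsilon> (-1)) z < 0} \<inter> {z. inner (Complex (-\<epsilon>) (-1)) z < 0}"
    by (simp add: inner_complex_def)
  also have "convex \<dots>"
    by (intro convex_Int convex_halfspace_Im_gt convex_halfspace_lt)
  finally show ?thesis .
qed

lemma connected_trunc_cone: "\<epsilon> > 0 \<Longrightarrow> connected (trunc_cone \<epsilon>)"
  by (intro convex_connected convex_trunc_cone)

lemma trunc_cone_mono: assumes "\<epsilon> \<le> \<epsilon>'" shows "trunc_cone \<epsilon>' \<subseteq> trunc_cone \<epsilon>"
proof
  fix z assume z: "z \<in> trunc_cone \<epsilon>'"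
  have "\<epsilon> * \<bar>Re z\<bar> \<le> \<epsilon>' * \<bar>Re z\<bar>" using assms by (intro mult_right_mono) auto
  then show "z \<in> trunc_cone \<epsilon>" using z assms by (auto simp: trunc_cone_def)
qed

lemma trunc_cone_subset_upper: "\<epsilon> > 0 \<Longrightarrow> trunc_cone \<epsilon> \<subseteq> upper_half_plane"
  by (auto simp: trunc_cone_def upper_half_plane_def)

lemma trunc_cone_subset_Gamma:
  assumes "\<alpha> \<le> \<epsilon>" "\<beta> \<le> \<epsilon>" shows "trunc_cone \<epsilon> \<subseteq> Gamma_region \<alpha> \<beta>"
proof
  fix z assume z: "z \<in> trunc_cone \<epsilon>"
  have "\<alpha> * \<bar>Re z\<bar> \<le> \<epsilon> * \<bar>Re z\<bar>" using assms by (intro mult_right_mono) auto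
  then show "z \<in> Gamma_region \<alpha> \<beta>" using z assms by (auto simp: trunc_cone_def Gamma_region_def)
qed

lemma compact_subset_cone:
  assumes K: "compact K" "K \<subseteq> upper_half_plane"
  obtains \<epsilon>0 where "\<epsilon>0 > 0" "\<And>\<epsilon>. 0 < \<epsilon> \<Longrightarrow> \<epsilon> < \<epsilon>0 \<Longrightarrow> K \<subseteq> trunc_cone \<epsilon>"
proof (cases "K = {}")
  case True
  then show ?thesis using that[of 1] by auto
next
  case False
  obtain w where w: "w \<in> K" "\<And>z. z \<in> K \<Longrightarrow> Im w \<le> Im z"
    using continuous_attains_inf[OF K(1) False continuous_on_Im[OF continuous_on_id]] by auto
  obtain B where B: "B > 0" "\<And>z. z \<in> K \<Longrightarrow> cmod z \<le> B"
    using compact_imp_bounded[OF K(1)] by (auto simp: bounded_pos)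
  have m: "Im w > 0" using w K by (auto simp: upper_half_plane_def)
  have "K \<subseteq> trunc_cone \<epsilon>" if e: "0 < \<epsilon>" "\<epsilon> < min (Im w) (Im w / B)" for \<epsilon>
  proof
    fix z assume z: "z \<in> K"
    have "\<epsilon> * \<bar>Re z\<bar> \<le> \<epsilon> * B"
      using B(2)[OF z] abs_Re_le_cmod[of z] e by (intro mult_left_mono) auto
    also have "\<dots> < Im w" using e B by (simp add: pos_less_divide_eq)
    finally show "z \<in> trunc_cone \<epsilon>" using w(2)[OF z] e by (auto simp: trunc_cone_def)
  qed
  then show ?thesis using m B by (intro that[of "min (Im w) (Im w / B)"]) auto
qed

context real_distribution
begin

text \<open>On a cone \<open>Im z\<close> is comparable with \<open>cmod z\<close>. As \<open>F\<close> raises imaginary parts and \<open>cmod (F z)\<close> is at most a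
multiple of \<open>Im z\<close> there, \<open>F\<close> maps the cone into a wider one that depends only on \<open>\<epsilon>'\<close> and \<open>\<kappa>\<close>.\<close>

lemma F_transform_cone:
  assumes \<kappa>: "0 < \<kappa>" "\<kappa> \<le> - Im (cauchy_transform M \<i>)" and e': "0 < \<epsilon>'"
    and e: "\<epsilon> \<le> \<epsilon>'" "0 < \<epsilon>" "\<epsilon> * ((4 / \<epsilon>'\<^sup>2 + 1) / \<kappa>) < 1" and z: "z \<in> trunc_cone \<epsilon>'"
  shows "F_transform M z \<in> trunc_cone \<epsilon>"
proof -
  define x y where "x = Re z" and "y = Im z"
  have y: "y > \<epsilon>'" "y > \<epsilon>' * \<bar>x\<bar>" using z by (auto simp: trunc_cone_def x_def y_def)
  have y0: "y > 0" using y e' by linarith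
  have "x\<^sup>2 \<le> (y / \<epsilon>')\<^sup>2"
    using y(2) e' y0 by (intro power2_le_iff_abs_le[THEN iffD2]) (auto simp: field_simps)
  moreover have "1\<^sup>2 \<le> (y / \<epsilon>')\<^sup>2" using y e' by (intro power_mono) auto
  ultimately have "2 * x\<^sup>2 + y\<^sup>2 + 2 \<le> 4 * (y / \<epsilon>')\<^sup>2 + y\<^sup>2" by simp
  also have "\<dots> = (4 / \<epsilon>'\<^sup>2 + 1) * y\<^sup>2" using e' by (simp add: field_simps)
  finally have 1: "2 * x\<^sup>2 + y\<^sup>2 + 2 \<le> (4 / \<epsilon>'\<^sup>2 + 1) * y\<^sup>2" .
  have "cmod (F_transform M z) \<le> (2 * x\<^sup>2 + y\<^sup>2 + 2) / (- Im (cauchy_transform M \<i>) * y)"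
    using norm_F_transform_le[of z] y0 by (simp add: x_def y_def)
  also have "\<dots> \<le> ((4 / \<epsilon>'\<^sup>2 + 1) * y\<^sup>2) / (\<kappa> * y)"
    using 1 \<kappa> y0 by (intro frac_le mult_right_mono) auto
  also have "\<dots> = ((4 / \<epsilon>'\<^sup>2 + 1) / \<kappa>) * y" using y0 by (simp add: power2_eq_square)
  finally have "\<bar>Re (F_transform M z)\<bar> \<le> ((4 / \<epsilon>'\<^sup>2 + 1) / \<kappa>) * y"
    using abs_Re_le_cmod order_trans by blast
  then have "\<epsilon> * \<bar>Re (F_transform M z)\<bar> \<le> \<epsilon> * (((4 / \<epsilon>'\<^sup>2 + 1) / \<kappa>) * y)"
    using e by (intro mult_left_mono) auto
  also have "\<dots> < 1 * y" unfolding mult.assoc[symmetric] using e(3) y0 by (intro mult_strict_right_mono) auto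
  finally have 2: "\<epsilon> * \<bar>Re (F_transform M z)\<bar> < y" by simp
  have "Im (F_transform M z) \<ge> y" using Im_F_transform_ge[of z] y0 by (simp add: y_def)
  then show ?thesis using 2 y e by (auto simp: trunc_cone_def)
qed

text \<open>The normalised right inverse \<open>H\<close> of \<open>F\<close> is injective, hence open, so that \<open>F\<close> is also a left inverse of
\<open>H\<close> on the open set \<open>H ` trunc_cone \<tau>\<close>. The normalisation at infinity makes this set meet
the cone, and the identity theorem does the rest.\<close>

lemma voiculescu_transform_F:
  assumes voic: "is_voiculescu_transform M \<epsilon> \<epsilon> \<phi>" and e: "0 < \<epsilon>" "0 < \<epsilon>'" "\<epsilon>' \<le> 1"
    and F: "F_transform M ` trunc_cone \<epsilon>' \<subseteq> trunc_cone \<epsilon>" and z: "z \<in> trunc_cone \<epsilon>'"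
  shows "\<phi> (F_transform M z) = z - F_transform M z"
proof -
  obtain \<alpha>0 \<beta>0 H where a0: "\<alpha>0 > 0" "\<beta>0 > 0" and H: "is_F_inverse M \<alpha>0 \<beta>0 H"
    and \<phi>H: "\<And>z. z \<in> Gamma_region \<alpha>0 \<beta>0 \<Longrightarrow> z \<in> Gamma_region \<epsilon> \<epsilon> \<Longrightarrow> \<phi> z = H z - z"
    using voic unfolding is_voiculescu_transform_def by blast
  define \<tau> where "\<tau> = max \<epsilon> (max \<alpha>0 \<beta>0)"
  have \<tau>: "\<tau> > 0" "trunc_cone \<tau> \<subseteq> Gamma_region \<alpha>0 \<beta>0" "trunc_cone \<tau> \<subseteq> Gamma_region \<epsilon> \<epsilon>"
    using e unfolding \<tau>_def by (simp, intro trunc_cone_subset_Gamma, simp, simp, intro trunc_cone_subset_Gamma, auto)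
  have FH: "F_transform M (H w) = w" if "w \<in> trunc_cone \<tau>" for w
    using H that \<tau> unfolding is_F_inverse_def by blast
  have holH: "H holomorphic_on trunc_cone \<tau>"
    using H \<tau> unfolding is_F_inverse_def by (meson analytic_imp_holomorphic holomorphic_on_subset)
  have "inj_on H (trunc_cone \<tau>)" by (rule inj_on_inverseI[of _ "F_transform M"]) (rule FH)
  then have opH: "open (H ` trunc_cone \<tau>)" using open_mapping_thm3[OF holH open_trunc_cone] by blast
  have "eventually (\<lambda>z. dist (H z / z) 1 < 1/4) (inf at_infinity (principal (Gamma_region \<alpha>0 \<beta>0)))"
    using H unfolding is_F_inverse_def by (intro tendstoD) auto
  then obtain b where b: "\<And>z. cmod z \<ge> b \<Longrightarrow> z \<in> Gamma_region \<alpha>0 \<beta>0 \<Longrightarrow> cmod (H z / z - 1) < 1/4"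
    unfolding eventually_inf_principal eventually_at_infinity dist_norm by blast
  \<comment> \<open>The bound \<open>t \<ge> 2\<close> makes \<open>3 * t / 4\<close> exceed \<open>\<epsilon>' \<le> 1\<close>.\<close>
  define t where "t = max (\<bar>b\<bar>) \<tau> + 2"
  have t: "t > 0" "t > \<tau>" "t \<ge> b" "t \<ge> 2" unfolding t_def using \<tau> by auto
  have it: "\<i> * of_real t \<in> trunc_cone \<tau>" using t by (simp add: trunc_cone_def)
  define h where "h = H (\<i> * of_real t)"
  have "cmod (h / (\<i> * of_real t) - 1) < 1/4"
    unfolding h_def using it \<tau> t by (intro b) (auto simp: norm_mult)
  moreover have "h / (\<i> * of_real t) - 1 = (h - \<i> * of_real t) / (\<i> * of_real t)"
    using t by (simp add: field_simps)
  ultimately have h: "cmod (h - \<i> * of_real t) < t / 4"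
    using t by (simp add: norm_divide norm_mult field_simps)
  have "\<bar>Re h\<bar> < t / 4" using abs_Re_le_cmod[of "h - \<i> * of_real t"] h by simp
  moreover have "\<bar>Im h - t\<bar> < t / 4" using abs_Im_le_cmod[of "h - \<i> * of_real t"] h by simp
  moreover have "\<epsilon>' * \<bar>Re h\<bar> \<le> 1 * \<bar>Re h\<bar>" using e by (intro mult_right_mono) auto
  moreover from calculation have "Im h > 3 * (t / 4)" by arith
  ultimately have hc: "h \<in> trunc_cone \<epsilon>'" using t e unfolding trunc_cone_def by auto
  define O' where "O' = H ` trunc_cone \<tau> \<inter> trunc_cone \<epsilon>'"
  have O': "open O'" "O' \<noteq> {}" "O' \<subseteq> trunc_cone \<epsilon>'"
    unfolding O'_def using opH open_trunc_cone hc it by (auto simp: h_def)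
  have hol\<phi>: "\<phi> holomorphic_on trunc_cone \<epsilon>"
    using voic trunc_cone_subset_Gamma[of \<epsilon> \<epsilon> \<epsilon>] unfolding is_voiculescu_transform_def
    by (meson analytic_imp_holomorphic holomorphic_on_subset order_refl)
  have holF: "F_transform M holomorphic_on trunc_cone \<epsilon>'"
    using holomorphic_F_transform trunc_cone_subset_upper[OF e(2)] by (rule holomorphic_on_subset)
  show ?thesis
  proof (rule analytic_continuation_open[OF O'(1) open_trunc_cone O'(2) connected_trunc_cone[OF e(2)] O'(3) _ _ _ z])
    show "(\<lambda>z. \<phi> (F_transform M z)) holomorphic_on trunc_cone \<epsilon>'"
      by (rule holomorphic_on_compose_fun[OF holF hol\<phi> F])
    show "(\<lambda>z. z - F_transform M z) holomorphic_on trunc_cone \<epsilon>'"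
      by (intro holomorphic_intros holF)
    show "\<phi> (F_transform M u) = u - F_transform M u" if "u \<in> O'" for u
    proof -
      obtain w where "w \<in> trunc_cone \<tau>" "u = H w" using \<open>u \<in> O'\<close> by (auto simp: O'_def)
      then show ?thesis using FH \<phi>H \<tau> by (simp add: subset_iff)
    qed
  qed
qed

end

lemma open_image_F_transform:
  assumes "real_distribution \<nu>" "0 < \<epsilon>"
  shows "open (F_transform \<nu> ` trunc_cone \<epsilon>)"
proof -
  interpret real_distribution \<nu> by fact
  have hol: "F_transform \<nu> holomorphic_on trunc_cone \<epsilon>"
    using holomorphic_F_transform trunc_cone_subset_upper[OF assms(2)] by (rule holomorphic_on_subset)
  have "\<not> F_transform \<nu> constant_on trunc_cone \<epsilon>"
  proof
    assume "F_transform \<nu> constant_on trunc_cone \<epsilon>"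
    then obtain c where c: "\<And>z. z \<in> trunc_cone \<epsilon> \<Longrightarrow> F_transform \<nu> z = c" by (auto simp: constant_on_def)
    define t where "t = max \<epsilon> \<bar>Im c\<bar> + 1"
    have it: "\<i> * of_real t \<in> trunc_cone \<epsilon>" using assms by (auto simp: trunc_cone_def t_def)
    have "Im c \<ge> t" using Im_F_transform_ge[of "\<i> * of_real t"] c[OF it] assms(2) by (simp add: t_def)
    then show False by (simp add: t_def)
  qed
  then show ?thesis
    using open_mapping_thm[OF hol open_trunc_cone connected_trunc_cone[OF assms(2)] open_trunc_cone] by blast
qed

lemma tendsto_uniform_limit_diagonal:
  fixes f :: "nat \<Rightarrow> complex \<Rightarrow> complex"
  assumes "uniform_limit (cball a r) f g sequentially" "r > 0" "continuous_on (cball a r) g"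
    and "u \<longlonglongrightarrow> a"
  shows "(\<lambda>n. f n (u n)) \<longlonglongrightarrow> g a"
proof -
  have ev: "eventually (\<lambda>n. u n \<in> cball a r) sequentially"
    using assms(2,4) by (auto dest!: tendstoD[of _ _ _ r] simp: dist_commute elim!: eventually_mono)
  have "continuous (at a within ball a r) g"
    using assms(2,3) continuous_on_subset[OF assms(3) ball_subset_cball] by (auto simp: continuous_on_eq_continuous_within)
  then have "isCont g a" using assms(2) by (simp add: at_within_open[of a "ball a r"])
  then have 1: "(\<lambda>n. g (u n)) \<longlonglongrightarrow> g a" using assms(4) by (rule isCont_tendsto_compose)
  have 2: "(\<lambda>n. f n (u n) - g (u n)) \<longlonglongrightarrow> 0"
  proof (rule tendstoI)
    fix e :: real assume "e > 0"
    from uniform_limitD[OF assms(1) this] ev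
    show "eventually (\<lambda>n. dist (f n (u n) - g (u n)) 0 < e) sequentially"
      by eventually_elim (auto simp: dist_norm)
  qed
  from tendsto_add[OF 2 1] show ?thesis by simp
qed

text \<open>Functions with nonnegative imaginary part form a normal family after the substitution \<open>1 / (p + \<i>)\<close>.
A subsequential limit is determined by its values on the open set \<open>u' ` Z\<close>, which gives convergence of
the whole sequence. These values are prescribed only at moving points \<open>u n z\<close>, because in the
application the known identity is \<open>\<phi> (F z) = z - F z\<close>. The limit of \<open>1 / (p + \<i>)\<close> has no zeros by
Hurwitz's theorem, so no subsequence of \<open>p\<close> escapes to infinity.\<close>

lemma vitali_nonneg_Im:
  fixes p :: "nat \<Rightarrow> complex \<Rightarrow> complex" and u :: "nat \<Rightarrow> 'z \<Rightarrow> complex"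
  assumes S: "open S" "connected S"
    and hol: "\<And>n. p n holomorphic_on S" and nonneg: "\<And>n w. w \<in> S \<Longrightarrow> Im (p n w) \<ge> 0"
    and u: "\<And>z. z \<in> Z \<Longrightarrow> (\<lambda>n. u n z) \<longlonglongrightarrow> u' z"
    and p: "\<And>z. z \<in> Z \<Longrightarrow> (\<lambda>n. p n (u n z)) \<longlonglongrightarrow> q z"
    and uS: "\<And>n z. z \<in> Z \<Longrightarrow> u n z \<in> S"
    and Z: "u' ` Z \<subseteq> S" "open (u' ` Z)" "Z \<noteq> {}"
  obtains P where "P holomorphic_on S" "\<And>w. w \<in> S \<Longrightarrow> Im (P w) \<ge> 0"
    "\<And>z. z \<in> Z \<Longrightarrow> P (u' z) = q z"
    "\<And>K. compact K \<Longrightarrow> K \<subseteq> S \<Longrightarrow> uniform_limit K p P sequentially"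
proof -
  define c where "c n w = 1 / (p n w + \<i>)" for n w
  have nz: "p n w + \<i> \<noteq> 0" and c1: "cmod (c n w) \<le> 1" if "w \<in> S" for n w
  proof -
    have "cmod (p n w + \<i>) \<ge> 1" using nonneg[OF that, of n] abs_Im_le_cmod[of "p n w + \<i>"] by simp
    then show "p n w + \<i> \<noteq> 0" "cmod (c n w) \<le> 1" by (auto simp: c_def norm_divide divide_simps)
  qed
  have holc: "c n holomorphic_on S" for n
    unfolding c_def by (intro holomorphic_intros hol nz)
  have qi: "q z + \<i> \<noteq> 0" if "z \<in> Z" for z
  proof -
    have "Im (q z) \<ge> 0"
      using tendsto_Im[OF p[OF that]] by (rule LIMSEQ_le_const) (auto intro!: nonneg uS that)
    then show ?thesis by (auto simp: complex_eq_iff)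
  qed
  have sub: "\<exists>g s. strict_mono (s :: nat \<Rightarrow> nat) \<and> g holomorphic_on S \<and> (\<forall>z\<in>Z. g (u' z) = 1 / (q z + \<i>)) \<and>
      (\<forall>w\<in>S. g w \<noteq> 0) \<and> (\<forall>K. compact K \<longrightarrow> K \<subseteq> S \<longrightarrow> uniform_limit K (\<lambda>n. c (r (s n))) g sequentially)"
    if r: "strict_mono r" for r :: "nat \<Rightarrow> nat"
  proof -
    obtain g s where g: "g holomorphic_on S" and s: "strict_mono (s :: nat \<Rightarrow> nat)"
      and "\<And>K. compact K \<Longrightarrow> K \<subseteq> S \<Longrightarrow> uniform_limit K ((\<lambda>n. c (r n)) \<circ> s) g sequentially"
    proof (rule Montel[of S "range c" "\<lambda>n. c (r n)"])
      show "\<exists>B. \<forall>h\<in>range c. \<forall>z\<in>K. cmod (h z) \<le> B" if "K \<subseteq> S" for K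
        using c1 that by (intro exI[of _ 1]) auto
    qed (use S holc in auto)
    then have ul: "\<And>K. compact K \<Longrightarrow> K \<subseteq> S \<Longrightarrow> uniform_limit K (\<lambda>n. c (r (s n))) g sequentially"
      by (simp add: o_def)
    have gz: "g (u' z) = 1 / (q z + \<i>)" if z: "z \<in> Z" for z
    proof -
      obtain \<rho> where \<rho>: "\<rho> > 0" "cball (u' z) \<rho> \<subseteq> S"
        using open_contains_cball[of S] S(1) Z(1) z by blast
      have rs: "filterlim (\<lambda>n. r (s n)) sequentially sequentially"
        using r s by (intro filterlim_compose[OF filterlim_subseq filterlim_subseq])
      have "(\<lambda>n. c (r (s n)) (u (r (s n)) z)) \<longlonglongrightarrow> g (u' z)"
        by (rule tendsto_uniform_limit_diagonal[OF ul _ _ filterlim_compose[OF u[OF z] rs]])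
           (use \<rho> g in \<open>auto intro!: holomorphic_on_imp_continuous_on intro: holomorphic_on_subset\<close>)
      moreover have "(\<lambda>n. c n (u n z)) \<longlonglongrightarrow> 1 / (q z + \<i>)"
        unfolding c_def by (intro tendsto_intros p z qi)
      then have "(\<lambda>n. c (r (s n)) (u (r (s n)) z)) \<longlonglongrightarrow> 1 / (q z + \<i>)"
        by (rule filterlim_compose[OF _ rs])
      ultimately show ?thesis by (rule LIMSEQ_unique)
    qed
    have "g w \<noteq> 0" if w: "w \<in> S" for w
    proof (cases "g constant_on S")
      case True
      obtain z where z: "z \<in> Z" using Z(3) by auto
      have "g w = g (u' z)" using True w Z(1) z by (auto simp: constant_on_def)
      then show ?thesis using gz[OF z] qi[OF z] by simp
    next
      case False
      show ?thesis
      proof (rule Hurwitz_no_zeros[OF S, where \<F> = "\<lambda>n. c (r (s n))" and g = g])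
        show "\<not> g constant_on S" "w \<in> S" by (rule False, rule w)
        show "uniform_limit K (\<lambda>n. c (r (s n))) g sequentially" if "compact K" "K \<subseteq> S" for K
          using ul that by blast
      qed (use holc nz g in \<open>auto simp: c_def\<close>)
    qed
    then show ?thesis using g s gz ul by blast
  qed
  obtain g where g: "g holomorphic_on S" "\<And>z. z \<in> Z \<Longrightarrow> g (u' z) = 1 / (q z + \<i>)"
    "\<And>w. w \<in> S \<Longrightarrow> g w \<noteq> 0"
    using sub[OF strict_mono_id] by blast
  have ulc: "uniform_limit K c g sequentially" if K: "compact K" "K \<subseteq> S" for K
  proof (rule ccontr)
    assume "\<not> uniform_limit K c g sequentially"
    then obtain e where e: "e > 0" "\<not> (\<forall>\<^sub>F n in sequentially. \<forall>x\<in>K. dist (c n x) (g x) < e)"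
      by (auto simp: uniform_limit_iff)
    then have "\<exists>\<^sub>\<infinity>n. \<not> (\<forall>x\<in>K. dist (c n x) (g x) < e)"
      by (simp add: frequently_def cofinite_eq_sequentially)
    then have inf: "infinite {n. \<not> (\<forall>x\<in>K. dist (c n x) (g x) < e)}" by (simp add: INFM_iff_infinite)
    obtain r :: "nat \<Rightarrow> nat" where r: "strict_mono r" "\<And>n. \<not> (\<forall>x\<in>K. dist (c (r n) x) (g x) < e)"
      using infinite_enumerate[OF inf] by blast
    from sub[OF r(1)] obtain g' s where gs: "strict_mono (s :: nat \<Rightarrow> nat) \<and> g' holomorphic_on S \<and>
      (\<forall>z\<in>Z. g' (u' z) = 1 / (q z + \<i>)) \<and> (\<forall>w\<in>S. g' w \<noteq> 0) \<and>
      (\<forall>K. compact K \<longrightarrow> K \<subseteq> S \<longrightarrow> uniform_limit K (\<lambda>n. c (r (s n))) g' sequentially)"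
      by (elim exE)
    have g': "g' holomorphic_on S" "\<forall>z\<in>Z. g' (u' z) = 1 / (q z + \<i>)"
      using gs[THEN conjunct2, THEN conjunct1] gs[THEN conjunct2, THEN conjunct2, THEN conjunct1] by simp_all
    have ul: "uniform_limit K (\<lambda>n. c (r (s n))) g' sequentially"
      using gs K by (elim conjE) (drule spec, drule (1) mp, drule (1) mp)
    have gg': "g w = g' w" if "w \<in> S" for w
      by (rule analytic_continuation_open[OF Z(2) S(1) _ S(2) Z(1) g(1) g'(1) _ that])
         (use Z(3) g(2) g'(2) in auto)
    have "\<forall>\<^sub>F n in sequentially. \<forall>x\<in>K. dist (c (r (s n)) x) (g' x) < e"
      using uniform_limitD[OF ul e(1)] .
    then obtain n where "\<forall>x\<in>K. dist (c (r (s n)) x) (g' x) < e"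
      by (auto simp: eventually_sequentially)
    then have "\<forall>x\<in>K. dist (c (r (s n)) x) (g x) < e" using gg' K by auto
    then show False using r(2) by blast
  qed
  define P where "P w = inverse (g w) - \<i>" for w
  have ulP: "uniform_limit K p P sequentially" if K: "compact K" "K \<subseteq> S" for K
  proof -
    have "\<exists>b>0. \<forall>x\<in>K. b \<le> cmod (g x)"
    proof (cases "K = {}")
      case True then show ?thesis by (auto intro: exI[of _ 1])
    next
      case False
      have "continuous_on K (\<lambda>x. cmod (g x))"
        by (intro continuous_intros holomorphic_on_imp_continuous_on holomorphic_on_subset[OF g(1) K(2)])
      then obtain x where "x \<in> K" "\<And>y. y \<in> K \<Longrightarrow> cmod (g x) \<le> cmod (g y)"
        using continuous_attains_inf[OF K(1) False, of "\<lambda>x. cmod (g x)"] by auto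
      then show ?thesis using g(3)[of x] K by (intro exI[of _ "cmod (g x)"]) auto
    qed
    then obtain b where b: "b > 0" "\<And>x. x \<in> K \<Longrightarrow> b \<le> cmod (g x)" by blast
    have "uniform_limit K (\<lambda>n w. inverse (c n w) - \<i>) (\<lambda>w. (inverse \<circ> g) w - \<i>) sequentially"
      by (intro uniform_limit_intros uniform_lim_inverse[OF ulc[OF K] b(2) b(1)])
    then show ?thesis by (simp add: c_def P_def[abs_def] o_def)
  qed
  show ?thesis
  proof (rule that)
    show "P holomorphic_on S" unfolding P_def by (intro holomorphic_intros g)
    show "P (u' z) = q z" if "z \<in> Z" for z using g(2)[OF that] qi[OF that] by (simp add: P_def)
    show "Im (P w) \<ge> 0" if w: "w \<in> S" for w
    proof -
      have "(\<lambda>n. p n w) \<longlonglongrightarrow> P w"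
        using ulP[of "{w}"] w by (auto intro: tendsto_uniform_limitI)
      then have "(\<lambda>n. Im (p n w)) \<longlonglongrightarrow> Im (P w)" by (rule tendsto_Im)
      then show ?thesis by (rule LIMSEQ_le_const) (use nonneg w in auto)
    qed
  qed (rule ulP)
qed

section \<open>Convergence of the Voiculescu transforms\<close>

locale voiculescu_limit =
  fixes \<nu>s :: "nat \<Rightarrow> real measure" and \<nu> :: "real measure"
  assumes distr_seq: "\<And>n. real_distribution (\<nu>s n)" and distr: "real_distribution \<nu>"
    and weak: "weak_conv_m \<nu>s \<nu>"
    and voic: "\<And>\<epsilon>. \<epsilon> > 0 \<Longrightarrow> \<exists>N. \<forall>n\<ge>N. voiculescu_defined_in (\<nu>s n) \<epsilon> \<epsilon>"
begin

interpretation real_distribution \<nu> by (rule distr)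

definition "\<kappa> = - Im (cauchy_transform \<nu> \<i>) / 2"

lemma \<kappa>_pos: "\<kappa> > 0"
  using cauchy_transform_at_i_neg by (simp add: \<kappa>_def)

lemma \<kappa>_le: "\<kappa> \<le> - Im (cauchy_transform \<nu> \<i>)"
  using cauchy_transform_at_i_neg by (simp add: \<kappa>_def)

lemma eventually_\<kappa>_le: "\<exists>N. \<forall>n\<ge>N. \<kappa> \<le> - Im (cauchy_transform (\<nu>s n) \<i>)"
proof -
  have "(\<lambda>n. - Im (cauchy_transform (\<nu>s n) \<i>)) \<longlonglongrightarrow> - Im (cauchy_transform \<nu> \<i>)"
    by (intro tendsto_intros cauchy_transform_tendsto distr_seq distr weak) auto
  then have "eventually (\<lambda>n. \<kappa> < - Im (cauchy_transform (\<nu>s n) \<i>)) sequentially"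
    by (rule order_tendstoD) (use \<kappa>_pos in \<open>simp add: \<kappa>_def\<close>)
  then show ?thesis by (auto simp: eventually_sequentially intro: less_imp_le)
qed

text \<open>A cone of parameter below \<open>aperture \<epsilon>'\<close> contains the image of \<open>trunc_cone \<epsilon>'\<close> under every \<open>F\<close>-transform
with \<open>\<kappa> \<le> - Im (G \<i>)\<close>; this holds for the limit measure and almost all members of the sequence.\<close>

definition "aperture \<epsilon>' = min \<epsilon>' (1 / ((4 / \<epsilon>'\<^sup>2 + 1) / \<kappa>))"

lemma aperture_pos: "\<epsilon>' > 0 \<Longrightarrow> aperture \<epsilon>' > 0"
  using \<kappa>_pos by (simp add: aperture_def add_nonneg_pos)

lemma apertureD:
  assumes "\<epsilon> < aperture \<epsilon>'" "\<epsilon>' > 0"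
  shows "\<epsilon> \<le> \<epsilon>'" "\<epsilon> * ((4 / \<epsilon>'\<^sup>2 + 1) / \<kappa>) < 1"
proof -
  have "(4 / \<epsilon>'\<^sup>2 + 1) / \<kappa> > 0" using assms \<kappa>_pos by (simp add: add_nonneg_pos)
  moreover have "\<epsilon> < \<epsilon>'" "\<epsilon> < 1 / ((4 / \<epsilon>'\<^sup>2 + 1) / \<kappa>)"
    using assms(1) unfolding aperture_def min_less_iff_conj by blast+
  ultimately show "\<epsilon> \<le> \<epsilon>'" "\<epsilon> * ((4 / \<epsilon>'\<^sup>2 + 1) / \<kappa>) < 1"
    by (simp_all only: pos_less_divide_eq less_imp_le)
qed

text \<open>The transforms of the sequence on one fixed cone converge, because they are prescribed at the points
\<open>F z\<close> for \<open>z\<close> in \<open>trunc_cone 1\<close>, and these points converge to an open set.\<close>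

lemma limit_on_cone:
  assumes e: "0 < \<epsilon>" "\<epsilon> < aperture 1"
  shows "\<exists>\<phi> N P. (\<forall>n\<ge>N. is_voiculescu_transform (\<nu>s n) \<epsilon> \<epsilon> (\<phi> n)) \<and>
    P holomorphic_on trunc_cone \<epsilon> \<and> (\<forall>w\<in>trunc_cone \<epsilon>. Im (P w) \<ge> 0) \<and>
    (\<forall>z\<in>trunc_cone 1. P (F_transform \<nu> z) = F_transform \<nu> z - z) \<and>
    (\<forall>K. compact K \<longrightarrow> K \<subseteq> trunc_cone \<epsilon> \<longrightarrow> uniform_limit K (\<lambda>n w. - \<phi> n w) P sequentially)"
proof -
  obtain N1 where N1: "\<And>n. n \<ge> N1 \<Longrightarrow> \<kappa> \<le> - Im (cauchy_transform (\<nu>s n) \<i>)"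
    using eventually_\<kappa>_le by blast
  obtain N2 where N2: "\<And>n. n \<ge> N2 \<Longrightarrow> voiculescu_defined_in (\<nu>s n) \<epsilon> \<epsilon>"
    using voic[OF e(1)] by blast
  define N where "N = max N1 N2"
  define \<phi> where "\<phi> n = (SOME \<phi>. is_voiculescu_transform (\<nu>s n) \<epsilon> \<epsilon> \<phi>)" for n
  have \<phi>: "is_voiculescu_transform (\<nu>s n) \<epsilon> \<epsilon> (\<phi> n)" if "n \<ge> N" for n
    using N2[of n] that unfolding \<phi>_def voiculescu_defined_in_def N_def by (simp add: someI_ex)
  have hol: "\<phi> n holomorphic_on trunc_cone \<epsilon>" and neg: "w \<in> trunc_cone \<epsilon> \<Longrightarrow> Im (\<phi> n w) \<le> 0"
    if "n \<ge> N" for n w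
    using \<phi>[OF that] trunc_cone_subset_Gamma[of \<epsilon> \<epsilon> \<epsilon>] unfolding is_voiculescu_transform_def
    by (meson analytic_imp_holomorphic holomorphic_on_subset order_refl subsetD)+
  have Fn: "F_transform (\<nu>s n) z \<in> trunc_cone \<epsilon>" if "n \<ge> N" "z \<in> trunc_cone 1" for n z
    by (rule real_distribution.F_transform_cone[OF distr_seq \<kappa>_pos N1 _ _ e(1) _ that(2)])
       (use that apertureD[OF e(2)] in \<open>auto simp: N_def\<close>)
  have F: "F_transform \<nu> z \<in> trunc_cone \<epsilon>" if "z \<in> trunc_cone 1" for z
    by (rule F_transform_cone[OF \<kappa>_pos \<kappa>_le _ _ e(1) _ that]) (use apertureD[OF e(2)] in auto)
  have \<phi>F: "\<phi> n (F_transform (\<nu>s n) z) = z - F_transform (\<nu>s n) z" if "n \<ge> N" "z \<in> trunc_cone 1" for n z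
    by (rule real_distribution.voiculescu_transform_F[OF distr_seq \<phi>[OF that(1)] e(1) _ _ _ that(2)])
       (use Fn[OF that(1)] in auto)
  have ne: "trunc_cone 1 \<noteq> {}"
  proof -
    have "2 * \<i> \<in> trunc_cone 1" by (simp add: trunc_cone_def)
    then show ?thesis by blast
  qed
  have lim: "(\<lambda>n. F_transform (\<nu>s n) z) \<longlonglongrightarrow> F_transform \<nu> z" if "z \<in> trunc_cone 1" for z
    by (rule F_transform_tendsto[OF distr_seq distr weak]) (use that in \<open>simp add: trunc_cone_def\<close>)
  have lim': "(\<lambda>n. F_transform (\<nu>s (n + N)) z) \<longlonglongrightarrow> F_transform \<nu> z" if "z \<in> trunc_cone 1" for z
    by (rule LIMSEQ_ignore_initial_segment[OF lim[OF that]])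
  obtain P where P: "P holomorphic_on trunc_cone \<epsilon>" "\<And>w. w \<in> trunc_cone \<epsilon> \<Longrightarrow> Im (P w) \<ge> 0"
    "\<And>z. z \<in> trunc_cone 1 \<Longrightarrow> P (F_transform \<nu> z) = F_transform \<nu> z - z"
    and ul: "\<And>K. compact K \<Longrightarrow> K \<subseteq> trunc_cone \<epsilon> \<Longrightarrow> uniform_limit K (\<lambda>n w. - \<phi> (n + N) w) P sequentially"
  proof (rule vitali_nonneg_Im[OF open_trunc_cone connected_trunc_cone[OF e(1)],
        where p = "\<lambda>n w. - \<phi> (n + N) w" and u = "\<lambda>n. F_transform (\<nu>s (n + N))"
          and u' = "F_transform \<nu>" and q = "\<lambda>z. F_transform \<nu> z - z" and Z = "trunc_cone 1"])
    show "(\<lambda>w. - \<phi> (n + N) w) holomorphic_on trunc_cone \<epsilon>" for n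
      by (intro holomorphic_intros hol) simp
    show "0 \<le> Im (- \<phi> (n + N) w)" if "w \<in> trunc_cone \<epsilon>" for n w
      using neg[OF _ that, of "n + N"] by simp
    show "(\<lambda>n. F_transform (\<nu>s (n + N)) z) \<longlonglongrightarrow> F_transform \<nu> z" if "z \<in> trunc_cone 1" for z
      by (rule lim'[OF that])
    show "(\<lambda>n. - \<phi> (n + N) (F_transform (\<nu>s (n + N)) z)) \<longlonglongrightarrow> F_transform \<nu> z - z" if "z \<in> trunc_cone 1" for z
      using tendsto_diff[OF lim'[OF that] tendsto_const[of z]] \<phi>F[OF _ that] by simp
    show "F_transform (\<nu>s (n + N)) z \<in> trunc_cone \<epsilon>" if "z \<in> trunc_cone 1" for n z
      using Fn[OF _ that] by simp
    show "F_transform \<nu> ` trunc_cone 1 \<subseteq> trunc_cone \<epsilon>" using F by auto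
    show "open (F_transform \<nu> ` trunc_cone 1)" by (rule open_image_F_transform[OF distr]) simp
  qed (use ne in \<open>auto simp only:\<close>)
  have ul': "uniform_limit K (\<lambda>n w. - \<phi> n w) P sequentially" if K: "compact K" "K \<subseteq> trunc_cone \<epsilon>" for K
    unfolding uniform_limit_iff
  proof (intro allI impI)
    fix d :: real assume "d > 0"
    from uniform_limitD[OF ul[OF K] this]
    show "\<forall>\<^sub>F n in sequentially. \<forall>x\<in>K. dist (- \<phi> n x) (P x) < d"
      by (rule eventually_sequentially_seg[THEN iffD1])
  qed
  show ?thesis
    by (intro exI[of _ \<phi>] exI[of _ N] exI[of _ P] conjI allI ballI impI \<phi> P ul')
qed

text \<open>The limits on the different cones agree by the identity theorem and give one function \<open>P\<close> on the upper
half-plane; it is the negative of the Voiculescu transform of the limit measure. The last clause is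
phrased with an open set \<open>S\<close> and functions \<open>H\<close>, as the transforms of the \<open>n\<close>-th measure are available
only on cones that grow with \<open>n\<close>: \<open>K\<close> is where uniform convergence is wanted, and \<open>L\<close> is where \<open>H\<close> has
to be a left inverse of \<open>F\<close>.\<close>

lemma voiculescu_transforms_converge:
  obtains P where "P holomorphic_on upper_half_plane" "\<And>w. Im w > 0 \<Longrightarrow> Im (P w) \<ge> 0"
    "\<And>z. Im z > 0 \<Longrightarrow> P (F_transform \<nu> z) = F_transform \<nu> z - z"
    "\<And>K L. compact K \<Longrightarrow> K \<subseteq> upper_half_plane \<Longrightarrow> compact L \<Longrightarrow> L \<subseteq> upper_half_plane \<Longrightarrow>
      \<exists>S H N. open S \<and> K \<subseteq> S \<and>
        (\<forall>n\<ge>N. H n holomorphic_on S \<and>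
          (\<forall>z\<in>L. F_transform (\<nu>s n) z \<in> S \<and> H n (F_transform (\<nu>s n) z) = z)) \<and>
        (\<forall>K'. compact K' \<longrightarrow> K' \<subseteq> S \<longrightarrow> uniform_limit K' H (\<lambda>w. w - P w) sequentially)"
proof -
  define A where "A = {\<epsilon>. 0 < \<epsilon> \<and> \<epsilon> < aperture 1}"
  have "\<forall>\<epsilon>\<in>A. \<exists>\<phi> N P. (\<forall>n\<ge>N. is_voiculescu_transform (\<nu>s n) \<epsilon> \<epsilon> (\<phi> n)) \<and>
    P holomorphic_on trunc_cone \<epsilon> \<and> (\<forall>w\<in>trunc_cone \<epsilon>. Im (P w) \<ge> 0) \<and>
    (\<forall>z\<in>trunc_cone 1. P (F_transform \<nu> z) = F_transform \<nu> z - z) \<and>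
    (\<forall>K. compact K \<longrightarrow> K \<subseteq> trunc_cone \<epsilon> \<longrightarrow> uniform_limit K (\<lambda>n w. - \<phi> n w) P sequentially)"
    unfolding A_def using limit_on_cone by (intro ballI) auto
  from bchoice[OF this] obtain \<phi> where "\<forall>\<epsilon>\<in>A. \<exists>N P. (\<forall>n\<ge>N. is_voiculescu_transform (\<nu>s n) \<epsilon> \<epsilon> (\<phi> \<epsilon> n)) \<and>
    P holomorphic_on trunc_cone \<epsilon> \<and> (\<forall>w\<in>trunc_cone \<epsilon>. Im (P w) \<ge> 0) \<and>
    (\<forall>z\<in>trunc_cone 1. P (F_transform \<nu> z) = F_transform \<nu> z - z) \<and>
    (\<forall>K. compact K \<longrightarrow> K \<subseteq> trunc_cone \<epsilon> \<longrightarrow> uniform_limit K (\<lambda>n w. - \<phi> \<epsilon> n w) P sequentially)" ..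
  from bchoice[OF this] obtain N where "\<forall>\<epsilon>\<in>A. \<exists>P. (\<forall>n\<ge>N \<epsilon>. is_voiculescu_transform (\<nu>s n) \<epsilon> \<epsilon> (\<phi> \<epsilon> n)) \<and>
    P holomorphic_on trunc_cone \<epsilon> \<and> (\<forall>w\<in>trunc_cone \<epsilon>. Im (P w) \<ge> 0) \<and>
    (\<forall>z\<in>trunc_cone 1. P (F_transform \<nu> z) = F_transform \<nu> z - z) \<and>
    (\<forall>K. compact K \<longrightarrow> K \<subseteq> trunc_cone \<epsilon> \<longrightarrow> uniform_limit K (\<lambda>n w. - \<phi> \<epsilon> n w) P sequentially)" ..
  from bchoice[OF this] obtain p where *: "\<forall>\<epsilon>\<in>A. (\<forall>n\<ge>N \<epsilon>. is_voiculescu_transform (\<nu>s n) \<epsilon> \<epsilon> (\<phi> \<epsilon> n)) \<and>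
    p \<epsilon> holomorphic_on trunc_cone \<epsilon> \<and> (\<forall>w\<in>trunc_cone \<epsilon>. Im (p \<epsilon> w) \<ge> 0) \<and>
    (\<forall>z\<in>trunc_cone 1. p \<epsilon> (F_transform \<nu> z) = F_transform \<nu> z - z) \<and>
    (\<forall>K. compact K \<longrightarrow> K \<subseteq> trunc_cone \<epsilon> \<longrightarrow> uniform_limit K (\<lambda>n w. - \<phi> \<epsilon> n w) (p \<epsilon>) sequentially)" ..
  have \<phi>: "is_voiculescu_transform (\<nu>s n) \<epsilon> \<epsilon> (\<phi> \<epsilon> n)" if "\<epsilon> \<in> A" "n \<ge> N \<epsilon>" for \<epsilon> n
    using * that by blast
  have p: "p \<epsilon> holomorphic_on trunc_cone \<epsilon>" if "\<epsilon> \<in> A" for \<epsilon> using * that by blast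
  have p': "Im (p \<epsilon> w) \<ge> 0" if "\<epsilon> \<in> A" "w \<in> trunc_cone \<epsilon>" for \<epsilon> w using * that by blast
  have pF: "p \<epsilon> (F_transform \<nu> z) = F_transform \<nu> z - z" if "\<epsilon> \<in> A" "z \<in> trunc_cone 1" for \<epsilon> z
    using * that by blast
  have ul: "uniform_limit K (\<lambda>n w. - \<phi> \<epsilon> n w) (p \<epsilon>) sequentially"
    if "\<epsilon> \<in> A" "compact K" "K \<subseteq> trunc_cone \<epsilon>" for \<epsilon> K using * that by blast
  have F: "F_transform \<nu> ` trunc_cone 1 \<subseteq> trunc_cone \<epsilon>" if "\<epsilon> \<in> A" for \<epsilon>
    using F_transform_cone[OF \<kappa>_pos \<kappa>_le, of 1 \<epsilon>] that apertureD[of \<epsilon> 1] by (auto simp: A_def)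
  have ne: "F_transform \<nu> ` trunc_cone 1 \<noteq> {}"
  proof -
    have "2 * \<i> \<in> trunc_cone 1" by (simp add: trunc_cone_def)
    then show ?thesis by blast
  qed
  have agree': "p \<epsilon>1 w = p \<epsilon>2 w" if e: "\<epsilon>1 \<in> A" "\<epsilon>2 \<in> A" "\<epsilon>1 \<le> \<epsilon>2" and w: "w \<in> trunc_cone \<epsilon>2" for \<epsilon>1 \<epsilon>2 w
  proof (rule analytic_continuation_open[OF open_image_F_transform[OF distr] open_trunc_cone ne
        connected_trunc_cone F[OF e(2)] _ p[OF e(2)] _ w])
    show "p \<epsilon>1 holomorphic_on trunc_cone \<epsilon>2"
      by (rule holomorphic_on_subset[OF p[OF e(1)] trunc_cone_mono[OF e(3)]])
    show "p \<epsilon>1 z = p \<epsilon>2 z" if "z \<in> F_transform \<nu> ` trunc_cone 1" for z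
      using that pF e by auto
  qed (use e in \<open>auto simp: A_def\<close>)
  then have agree: "p \<epsilon>1 w = p \<epsilon>2 w"
    if "\<epsilon>1 \<in> A" "\<epsilon>2 \<in> A" "w \<in> trunc_cone \<epsilon>1" "w \<in> trunc_cone \<epsilon>2" for \<epsilon>1 \<epsilon>2 w
    using that linear[of \<epsilon>1 \<epsilon>2] by metis
  have cover: "\<exists>\<epsilon>\<in>A. w \<in> trunc_cone \<epsilon>" if w: "Im w > 0" for w
  proof -
    obtain \<epsilon>0 where e0: "\<epsilon>0 > 0" "\<And>\<epsilon>. 0 < \<epsilon> \<Longrightarrow> \<epsilon> < \<epsilon>0 \<Longrightarrow> {w} \<subseteq> trunc_cone \<epsilon>"
      using compact_subset_cone[of "{w}"] w by (auto simp: upper_half_plane_def)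
    define \<epsilon> where "\<epsilon> = min \<epsilon>0 (aperture 1) / 2"
    have "0 < \<epsilon>" "\<epsilon> < \<epsilon>0" "\<epsilon> < aperture 1" unfolding \<epsilon>_def using e0 aperture_pos[of 1] by auto
    then show ?thesis using e0(2)[of \<epsilon>] by (auto simp: A_def)
  qed
  define P where "P w = p (SOME \<epsilon>. \<epsilon> \<in> A \<and> w \<in> trunc_cone \<epsilon>) w" for w
  have Pp: "P w = p \<epsilon> w" if "\<epsilon> \<in> A" "w \<in> trunc_cone \<epsilon>" for \<epsilon> w
  proof -
    have "(SOME \<epsilon>. \<epsilon> \<in> A \<and> w \<in> trunc_cone \<epsilon>) \<in> A \<and> w \<in> trunc_cone (SOME \<epsilon>. \<epsilon> \<in> A \<and> w \<in> trunc_cone \<epsilon>)"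
      by (rule someI[of _ \<epsilon>]) (use that in simp)
    then show ?thesis unfolding P_def using agree that by blast
  qed
  have holP: "P holomorphic_on upper_half_plane"
  proof -
    have "P field_differentiable (at w)" if w: "Im w > 0" for w
    proof -
      obtain \<epsilon> where e: "\<epsilon> \<in> A" "w \<in> trunc_cone \<epsilon>" using cover[OF w] by blast
      have "P holomorphic_on trunc_cone \<epsilon>"
        by (rule holomorphic_transform[OF p[OF e(1)]]) (use Pp e in simp)
      then show ?thesis using open_trunc_cone e(2) by (rule holomorphic_on_imp_differentiable_at)
    qed
    then show ?thesis
      by (auto simp: holomorphic_on_def upper_half_plane_def intro: field_differentiable_at_within)
  qed
  have posP: "Im (P w) \<ge> 0" if w: "Im w > 0" for w
    using cover[OF w] Pp p' by fastforce
  obtain \<epsilon>A where \<epsilon>A: "\<epsilon>A \<in> A" using cover[of \<i>] by auto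
  have PF: "P (F_transform \<nu> z) = F_transform \<nu> z - z" if z: "Im z > 0" for z
  proof (rule analytic_continuation_open[where s = "trunc_cone 1" and s' = upper_half_plane
        and f = "\<lambda>z. P (F_transform \<nu> z)" and g = "\<lambda>z. F_transform \<nu> z - z" and z = z])
    show "open (trunc_cone 1)" by (rule open_trunc_cone)
    show "open upper_half_plane" "connected upper_half_plane"
      by (auto simp: upper_half_plane_def open_halfspace_Im_gt intro!: convex_connected convex_halfspace_Im_gt)
    show "trunc_cone 1 \<noteq> {}" using ne by blast
    show "trunc_cone 1 \<subseteq> upper_half_plane" by (rule trunc_cone_subset_upper) simp
    show "(\<lambda>z. P (F_transform \<nu> z)) holomorphic_on upper_half_plane"
      by (rule holomorphic_on_compose_fun[OF holomorphic_F_transform holP])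
         (auto simp: upper_half_plane_def Im_F_transform_pos)
    show "(\<lambda>z. F_transform \<nu> z - z) holomorphic_on upper_half_plane"
      by (intro holomorphic_intros holomorphic_F_transform)
    show "P (F_transform \<nu> z) = F_transform \<nu> z - z" if "z \<in> trunc_cone 1" for z
      using pF[OF \<epsilon>A that] Pp[OF \<epsilon>A] F[OF \<epsilon>A] that by (auto simp: image_subset_iff)
    show "z \<in> upper_half_plane" using z by (simp add: upper_half_plane_def)
  qed
  show ?thesis
  proof (rule that[OF holP posP PF])
    fix K L assume K: "compact K" "K \<subseteq> upper_half_plane" and L: "compact L" "L \<subseteq> upper_half_plane"
    obtain eK where eK: "eK > 0" "\<And>\<epsilon>. 0 < \<epsilon> \<Longrightarrow> \<epsilon> < eK \<Longrightarrow> K \<subseteq> trunc_cone \<epsilon>"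
      using compact_subset_cone[OF K] by blast
    obtain eL where eL: "eL > 0" "\<And>\<epsilon>. 0 < \<epsilon> \<Longrightarrow> \<epsilon> < eL \<Longrightarrow> L \<subseteq> trunc_cone \<epsilon>"
      using compact_subset_cone[OF L] by blast
    define \<epsilon>' where "\<epsilon>' = min eL 1 / 2"
    have \<epsilon>': "0 < \<epsilon>'" "\<epsilon>' \<le> 1" "L \<subseteq> trunc_cone \<epsilon>'" unfolding \<epsilon>'_def using eL by auto
    define \<epsilon> where "\<epsilon> = min eK (min (aperture 1) (aperture \<epsilon>')) / 2"
    have \<epsilon>: "0 < \<epsilon>" "\<epsilon> < eK" "\<epsilon> < aperture 1" "\<epsilon> < aperture \<epsilon>'"
      unfolding \<epsilon>_def using eK aperture_pos[of 1] aperture_pos[OF \<epsilon>'(1)] by auto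
    have eA: "\<epsilon> \<in> A" using \<epsilon> by (simp add: A_def)
    obtain N1 where N1: "\<And>n. n \<ge> N1 \<Longrightarrow> \<kappa> \<le> - Im (cauchy_transform (\<nu>s n) \<i>)"
      using eventually_\<kappa>_le by blast
    let ?H = "\<lambda>n w. w + \<phi> \<epsilon> n w"
    have a: "?H n holomorphic_on trunc_cone \<epsilon> \<and>
          (\<forall>z\<in>L. F_transform (\<nu>s n) z \<in> trunc_cone \<epsilon> \<and> ?H n (F_transform (\<nu>s n) z) = z)"
      if n: "n \<ge> max N1 (N \<epsilon>)" for n
    proof (intro conjI ballI)
      have v: "is_voiculescu_transform (\<nu>s n) \<epsilon> \<epsilon> (\<phi> \<epsilon> n)" using \<phi>[OF eA] n by simp
      then have "\<phi> \<epsilon> n holomorphic_on trunc_cone \<epsilon>"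
        using trunc_cone_subset_Gamma[of \<epsilon> \<epsilon> \<epsilon>] unfolding is_voiculescu_transform_def
        by (meson analytic_imp_holomorphic holomorphic_on_subset order_refl)
      then show "?H n holomorphic_on trunc_cone \<epsilon>" by (intro holomorphic_intros)
      have Fc: "F_transform (\<nu>s n) z \<in> trunc_cone \<epsilon>" if "z \<in> trunc_cone \<epsilon>'" for z
        by (rule real_distribution.F_transform_cone[OF distr_seq \<kappa>_pos N1 \<epsilon>'(1) _ \<epsilon>(1) _ that])
           (use n apertureD[OF \<epsilon>(4) \<epsilon>'(1)] in auto)
      fix z assume z: "z \<in> L"
      show "F_transform (\<nu>s n) z \<in> trunc_cone \<epsilon>" using Fc z \<epsilon>' by blast
      have "\<phi> \<epsilon> n (F_transform (\<nu>s n) z) = z - F_transform (\<nu>s n) z"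
        by (rule real_distribution.voiculescu_transform_F[OF distr_seq v \<epsilon>(1) \<epsilon>'(1,2)])
           (use Fc z \<epsilon>' in auto)
      then show "?H n (F_transform (\<nu>s n) z) = z" by simp
    qed
    have b: "uniform_limit K' ?H (\<lambda>w. w - P w) sequentially"
      if K': "compact K'" "K' \<subseteq> trunc_cone \<epsilon>" for K'
      unfolding uniform_limit_iff
    proof (intro allI impI)
      fix d :: real assume "d > 0"
      from uniform_limitD[OF ul[OF eA K'] this]
      show "\<forall>\<^sub>F n in sequentially. \<forall>w\<in>K'. dist (w + \<phi> \<epsilon> n w) (w - P w) < d"
      proof eventually_elim
        case (elim n)
        show ?case
        proof
          fix w assume w: "w \<in> K'"
          have "dist (w + \<phi> \<epsilon> n w) (w - P w) = dist (- \<phi> \<epsilon> n w) (p \<epsilon> w)"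
            using Pp[OF eA] w K' by (auto simp: dist_norm norm_minus_commute add.commute)
          then show "dist (w + \<phi> \<epsilon> n w) (w - P w) < d" using elim w by simp
        qed
      qed
    qed
    show "\<exists>S H N. open S \<and> K \<subseteq> S \<and>
        (\<forall>n\<ge>N. H n holomorphic_on S \<and>
          (\<forall>z\<in>L. F_transform (\<nu>s n) z \<in> S \<and> H n (F_transform (\<nu>s n) z) = z)) \<and>
        (\<forall>K'. compact K' \<longrightarrow> K' \<subseteq> S \<longrightarrow> uniform_limit K' H (\<lambda>w. w - P w) sequentially)"
      using a b open_trunc_cone eK(2)[OF \<epsilon>(1,2)]
      by (intro exI[of _ "trunc_cone \<epsilon>"] exI[of _ ?H] exI[of _ "max N1 (N \<epsilon>)"]) blast
  qed
qed

end

section \<open>Bounds for the Cauchy transform near a positive density\<close>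

lemma has_density_on_nn_integral:
  assumes "has_density_on \<mu> f U" "sets \<mu> = sets borel" "open U" "continuous_on U f"
    and h: "h \<in> borel_measurable borel"
  shows "(\<integral>\<^sup>+t. h t * indicator U t \<partial>\<mu>) = (\<integral>\<^sup>+t. h t * ennreal (f t) * indicator U t \<partial>lborel)"
proof -
  have fU: "(\<lambda>t. f t * indicator U t) \<in> borel_measurable borel"
    using borel_measurable_continuous_on_indicator[OF _ assms(4)] assms(3) by (simp add: mult.commute)
  have fU': "(\<lambda>t. ennreal (f t) * indicator U t) \<in> borel_measurable borel"
  proof -
    have "(\<lambda>t. ennreal (f t * indicator U t)) \<in> borel_measurable borel" using fU by measurable
    also have "(\<lambda>t. ennreal (f t * indicator U t)) = (\<lambda>t. ennreal (f t) * indicator U t)"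
      by (auto simp: indicator_def)
    finally show ?thesis .
  qed
  have U: "U \<in> sets borel" using assms(3) by simp
  have iU: "indicator U \<in> borel_measurable \<mu>"
    using U assms(2) by (intro borel_measurable_indicator) simp
  have hm: "h \<in> borel_measurable \<mu>" using h assms(2) by (simp cong: measurable_cong_sets)
  have eq: "density \<mu> (indicator U) = density lborel (\<lambda>t. ennreal (f t) * indicator U t)"
  proof (rule measure_eqI)
    fix A assume "A \<in> sets (density \<mu> (indicator U))"
    then have A: "A \<in> sets borel" using assms(2) by simp
    have "emeasure (density \<mu> (indicator U)) A = emeasure \<mu> (A \<inter> U)"
    proof -
      have "emeasure (density \<mu> (indicator U)) A = (\<integral>\<^sup>+t. indicator U t * indicator A t \<partial>\<mu>)"
        using A assms(2) iU by (intro emeasure_density) auto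
      also have "\<dots> = (\<integral>\<^sup>+t. indicator (A \<inter> U) t \<partial>\<mu>)"
        by (intro nn_integral_cong) (auto simp: indicator_def)
      also have "\<dots> = emeasure \<mu> (A \<inter> U)" using A U assms(2) by (intro nn_integral_indicator) auto
      finally show ?thesis .
    qed
    also have "\<dots> = (\<integral>\<^sup>+t\<in>(A \<inter> U). ennreal (f t) \<partial>lborel)"
      using assms(1) A U unfolding has_density_on_def by auto
    also have "\<dots> = (\<integral>\<^sup>+t. ennreal (f t) * indicator U t * indicator A t \<partial>lborel)"
      by (intro nn_integral_cong) (auto simp: indicator_def)
    also have "\<dots> = emeasure (density lborel (\<lambda>t. ennreal (f t) * indicator U t)) A"
      using A fU' by (intro emeasure_density[symmetric]) auto
    finally show "emeasure (density \<mu> (indicator U)) A = emeasure (density lborel (\<lambda>t. ennreal (f t) * indicator U t)) A" .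
  qed (use assms(2) in simp)
  have "(\<integral>\<^sup>+t. h t * indicator U t \<partial>\<mu>) = (\<integral>\<^sup>+t. h t \<partial>density \<mu> (indicator U))"
    using iU hm by (subst nn_integral_density) (auto simp: mult.commute)
  also have "\<dots> = (\<integral>\<^sup>+t. ennreal (f t) * indicator U t * h t \<partial>lborel)"
    unfolding eq using fU' h by (subst nn_integral_density) auto
  also have "\<dots> = (\<integral>\<^sup>+t. h t * ennreal (f t) * indicator U t \<partial>lborel)"
    by (intro nn_integral_cong) (auto simp: mult_ac)
  finally show ?thesis .
qed

lemma DERIV_arctan_poisson:
  assumes "y > 0"
  shows "((\<lambda>t. arctan ((t - x) / y)) has_real_derivative y / ((x - t)\<^sup>2 + y\<^sup>2)) (at t within S)"
proof -
  have p: "y\<^sup>2 + (t - x)\<^sup>2 > 0" using assms by (simp add: add_pos_nonneg)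
  have "((\<lambda>t. arctan ((t - x) / y)) has_real_derivative (inverse (1 + ((t - x) / y)\<^sup>2)) * (1 / y)) (at t within S)"
    using assms by (auto intro!: derivative_eq_intros)
  moreover have "inverse (1 + ((t - x) / y)\<^sup>2) * (1 / y) = y / ((x - t)\<^sup>2 + y\<^sup>2)"
  proof -
    have "1 + ((t - x) / y)\<^sup>2 = (y\<^sup>2 + (t - x)\<^sup>2) / y\<^sup>2" using assms by (simp add: power_divide field_simps)
    then have "inverse (1 + ((t - x) / y)\<^sup>2) * (1 / y) = y / (y\<^sup>2 + (t - x)\<^sup>2)"
      using assms p by (simp add: power2_eq_square)
    then show ?thesis by (simp add: power2_commute add.commute)
  qed
  ultimately show ?thesis by simp
qed

lemma nn_integral_poisson:
  assumes "y > 0" "c \<le> d"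
  shows "(\<integral>\<^sup>+t. ennreal (y / ((x - t)\<^sup>2 + y\<^sup>2)) * indicator {c..d} t \<partial>lborel)
    = ennreal (arctan ((d - x) / y) - arctan ((c - x) / y))"
  by (rule nn_integral_FTC_Icc) (use assms DERIV_arctan_poisson in auto)

text \<open>The imaginary part of the Cauchy transform is a Poisson integral, bounded below by the minimum
of the density nearby, and above by \<open>pi\<close> times its maximum plus the contribution of the distant mass.
The real part is a Hilbert transform,
for which a continuous density gives no bound at all.\<close>

lemma cauchy_transform_bounds_near_positive_density:
  fixes a b :: real
  assumes "real_distribution \<nu>" "has_density_on \<nu> f U" "open U" "continuous_on U f"
    and pos: "\<And>x. x \<in> U \<Longrightarrow> f x > 0" and ab: "a \<le> b" "{a..b} \<subseteq> U"
  obtains \<delta> c C where "\<delta> > 0" "c > 0" "C > 0"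
    "\<And>z. a - \<delta> \<le> Re z \<Longrightarrow> Re z \<le> b + \<delta> \<Longrightarrow> 0 < Im z \<Longrightarrow> Im z \<le> \<delta> \<Longrightarrow>
      c \<le> - Im (cauchy_transform \<nu> z) \<and> - Im (cauchy_transform \<nu> z) \<le> C"
proof -
  interpret real_distribution \<nu> by fact
  obtain e where e: "e > 0" "(\<Union>x\<in>{a..b}. ball x e) \<subseteq> U"
    using compact_subset_open_imp_ball_epsilon_subset[OF compact_Icc assms(3) ab(2)] by blast
  define \<delta> where "\<delta> = e / 3"
  have \<delta>: "\<delta> > 0" using e by (simp add: \<delta>_def)
  define I where "I = {a - 2 * \<delta>..b + 2 * \<delta>}"
  have IU: "I \<subseteq> U"
  proof
    fix t assume t: "t \<in> I"
    define x where "x = max a (min b t)"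
    have "x \<in> {a..b}" "dist x t < e" using t ab e by (auto simp: x_def I_def \<delta>_def dist_real_def)
    then have "t \<in> (\<Union>x\<in>{a..b}. ball x e)" by (intro UN_I[of x]) auto
    then show "t \<in> U" using e by blast
  qed
  have cI: "compact I" "I \<noteq> {}" "continuous_on I f"
    using ab \<delta> continuous_on_subset[OF assms(4) IU] by (auto simp: I_def)
  obtain t1 where t1: "t1 \<in> I" "\<And>t. t \<in> I \<Longrightarrow> f t1 \<le> f t" using continuous_attains_inf[OF cI] by auto
  obtain t2 where t2: "t2 \<in> I" "\<And>t. t \<in> I \<Longrightarrow> f t \<le> f t2" using continuous_attains_sup[OF cI] by auto
  define m where "m = f t1"
  define B where "B = f t2"
  have m: "m > 0" "\<And>t. t \<in> I \<Longrightarrow> m \<le> f t" using t1 pos IU by (auto simp: m_def)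
  have B: "B > 0" "\<And>t. t \<in> I \<Longrightarrow> f t \<le> B" using t2 pos IU by (auto simp: B_def)
  have "m \<le> - Im (cauchy_transform \<nu> z) \<and> - Im (cauchy_transform \<nu> z) \<le> B * pi + 1 / \<delta>"
    if z: "a - \<delta> \<le> Re z" "Re z \<le> b + \<delta>" "0 < Im z" "Im z \<le> \<delta>" for z
  proof
    define x y where "x = Re z" and "y = Im z"
    have y: "y > 0" "y \<le> \<delta>" using z by (auto simp: y_def)
    define k where "k t = y / ((x - t)\<^sup>2 + y\<^sup>2)" for t
    have k0: "k t \<ge> 0" for t unfolding k_def using y by (intro divide_nonneg_nonneg) auto
    have km: "k \<in> borel_measurable borel" unfolding k_def by measurable
    have ki: "integrable \<nu> k" using integrable_poisson[of z] y by (simp add: k_def[abs_def] x_def y_def)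
    have G: "- Im (cauchy_transform \<nu> z) = (\<integral>t. k t \<partial>\<nu>)"
      using Im_cauchy_transform[of z] y by (simp add: k_def x_def y_def)
    \<comment> \<open>On \<open>[x - y, x + y]\<close> the kernel is at least \<open>1 / (2 * y)\<close>, and this interval has mass at least \<open>2 * m * y\<close>.\<close>
    let ?A = "{x - y..x + y}"
    have AI: "?A \<subseteq> I" using z y by (auto simp: I_def x_def)
    have "ennreal (m * (2 * y)) = (\<integral>\<^sup>+t\<in>?A. ennreal m \<partial>lborel)"
      using y m by (subst nn_integral_cmult_indicator) (auto simp: ennreal_mult)
    also have "\<dots> \<le> (\<integral>\<^sup>+t\<in>?A. ennreal (f t) \<partial>lborel)"
      using AI m(2) by (intro nn_integral_mono) (auto simp: indicator_def intro!: ennreal_leI)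
    also have "\<dots> = emeasure \<nu> ?A"
      using assms(2) AI IU unfolding has_density_on_def by (metis atLeastAtMost_borel order_trans)
    finally have "m * (2 * y) \<le> measure \<nu> ?A"
      by (simp add: emeasure_eq_measure)
    then have "m \<le> measure \<nu> ?A * (1 / (2 * y))" using y by (simp add: field_simps)
    also have "\<dots> = (\<integral>t. indicator ?A t * (1 / (2 * y)) \<partial>\<nu>)" by simp
    also have "\<dots> \<le> (\<integral>t. k t \<partial>\<nu>)"
    proof (rule integral_mono)
      show "integrable \<nu> (\<lambda>t. indicator ?A t * (1 / (2 * y)))" by (intro integrable_mult_left integrable_real_indicator) (auto simp: emeasure_eq_measure)
      show "indicator ?A t * (1 / (2 * y)) \<le> k t" for t
      proof (cases "t \<in> ?A")
        case True
        then have "(x - t)\<^sup>2 \<le> y\<^sup>2" by (intro power2_le_iff_abs_le[THEN iffD2]) (use y in auto)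
        then have "y / (2 * y\<^sup>2) \<le> k t"
          unfolding k_def using y by (intro divide_left_mono) (auto intro!: mult_pos_pos add_nonneg_pos)
        then show ?thesis using True y by (simp add: power2_eq_square)
      qed (use k0 in simp)
    qed (rule ki)
    finally show "m \<le> - Im (cauchy_transform \<nu> z)" unfolding G .
    \<comment> \<open>Within distance \<open>\<delta>\<close> of \<open>x\<close> compare with the total mass \<open>pi\<close> of the kernel; farther away
      the kernel is at most \<open>y / \<delta>\<^sup>2 \<le> 1 / \<delta>\<close>.\<close>
    let ?E = "{x - \<delta>..x + \<delta>}"
    have EI: "?E \<subseteq> I" using z \<delta> by (auto simp: I_def x_def)
    have "(\<integral>\<^sup>+t. ennreal (k t) * indicator ?E t \<partial>\<nu>) = (\<integral>\<^sup>+t. (ennreal (k t) * indicator ?E t) * indicator U t \<partial>\<nu>)"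
      using EI IU by (intro nn_integral_cong) (auto simp: indicator_def)
    also have "\<dots> = (\<integral>\<^sup>+t. (ennreal (k t) * indicator ?E t) * ennreal (f t) * indicator U t \<partial>lborel)"
      using km by (intro has_density_on_nn_integral assms(2-4)) auto
    also have "\<dots> \<le> (\<integral>\<^sup>+t. ennreal B * (ennreal (k t) * indicator ?E t) \<partial>lborel)"
      using B EI by (intro nn_integral_mono) (auto simp: indicator_def mult.commute intro!: mult_right_mono ennreal_leI)
    also have "\<dots> = ennreal B * (\<integral>\<^sup>+t. ennreal (k t) * indicator ?E t \<partial>lborel)"
      using km by (intro nn_integral_cmult) auto
    also have "(\<integral>\<^sup>+t. ennreal (k t) * indicator ?E t \<partial>lborel) = ennreal (arctan ((x + \<delta> - x) / y) - arctan ((x - \<delta> - x) / y))"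
      unfolding k_def by (rule nn_integral_poisson) (use y \<delta> in auto)
    also have "\<dots> \<le> ennreal pi"
      using arctan_bounded[of "(x + \<delta> - x) / y"] arctan_bounded[of "(x - \<delta> - x) / y"]
      by (intro ennreal_leI) linarith
    also have "ennreal B * ennreal pi = ennreal (B * pi)" using B by (simp add: ennreal_mult)
    finally have near: "(\<integral>\<^sup>+t. ennreal (k t) * indicator ?E t \<partial>\<nu>) \<le> ennreal (B * pi)"
      by (simp add: mult_left_mono)
    have iE: "integrable \<nu> (\<lambda>t. k t * indicator ?E t)"
      by (intro integrable_mult_indicator[of _ _ k, simplified, simplified mult.commute] ki) simp
    have "(\<integral>t. k t * indicator ?E t \<partial>\<nu>) \<le> B * pi"
    proof -
      have "ennreal (\<integral>t. k t * indicator ?E t \<partial>\<nu>) = (\<integral>\<^sup>+t. ennreal (k t * indicator ?E t) \<partial>\<nu>)"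
        using k0 by (intro nn_integral_eq_integral[symmetric] iE) auto
      also have "\<dots> = (\<integral>\<^sup>+t. ennreal (k t) * indicator ?E t \<partial>\<nu>)"
        by (intro nn_integral_cong) (auto simp: indicator_def)
      finally have "ennreal (\<integral>t. k t * indicator ?E t \<partial>\<nu>) \<le> ennreal (B * pi)" using near by (simp only:)
      moreover have "B * pi \<ge> 0" using B(1) by simp
      ultimately show ?thesis by (simp only: ennreal_le_iff)
    qed
    have "(\<integral>t. k t \<partial>\<nu>) \<le> (\<integral>t. k t * indicator ?E t + 1 / \<delta> \<partial>\<nu>)"
    proof (rule integral_mono[OF ki])
      show "integrable \<nu> (\<lambda>t. k t * indicator ?E t + 1 / \<delta>)" by (intro Bochner_Integration.integrable_add iE) simp
      show "k t \<le> k t * indicator ?E t + 1 / \<delta>" for t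
      proof (cases "t \<in> ?E")
        case False
        then have "\<delta>\<^sup>2 \<le> (x - t)\<^sup>2"
          by (intro abs_le_square_iff[THEN iffD1]) (use \<delta> in auto)
        then have "k t \<le> \<delta> / \<delta>\<^sup>2"
          unfolding k_def using y \<delta> by (intro frac_le) (auto intro: add_increasing2)
        then show ?thesis using False \<delta> by (simp add: power2_eq_square)
      qed (use \<delta> in simp)
    qed
    also have "\<dots> = (\<integral>t. k t * indicator ?E t \<partial>\<nu>) + 1 / \<delta>"
      by (subst Bochner_Integration.integral_add[OF iE]) (auto simp: prob_UNIV)
    also have "\<dots> \<le> B * pi + 1 / \<delta>" using \<open>(\<integral>t. k t * indicator ?E t \<partial>\<nu>) \<le> B * pi\<close> by simp
    finally show "- Im (cauchy_transform \<nu> z) \<le> B * pi + 1 / \<delta>" unfolding G .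
  qed
  moreover have "B * pi + 1 / \<delta> > 0" using B \<delta> by (intro add_pos_pos mult_pos_pos) auto
  ultimately show ?thesis using that[OF \<delta> m(1)] by blast
qed

section \<open>Boundary values of the reciprocal Cauchy transform\<close>

text \<open>This is the heart of the matter: near an interval of positive continuous density, \<open>F\<close> stays in a compact
subset of the upper half-plane. The lower bound for \<open>- Im G\<close> bounds \<open>F = 1 / G\<close> and puts its values
\<open>w\<close> into the horodisc \<open>Im w \<ge> c * (cmod w)\<^sup>2\<close>, so \<open>F\<close> can only leave compact sets by tending to \<open>0\<close>. If \<open>w\<close>
were close to \<open>0\<close>, climb the vertical ray to the point \<open>v\<close> over \<open>w\<close> at the small height \<open>y0\<close>. By
\<open>vertical_ray_above\<close> its image \<open>h = v - P v\<close> is still near the interval, and \<open>G h = 1 / v\<close> by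
injectivity. But \<open>- Im (1 / v) = y0 / ((Re w)\<^sup>2 + y0\<^sup>2)\<close> exceeds the upper bound \<open>C\<close> unless \<open>Re w\<close> is bounded
away from \<open>0\<close>, and then the horodisc bounds \<open>Im w\<close> from below.\<close>

lemma (in subordinate_inverse) F_transform_near_positive_density:
  assumes "real_distribution \<nu>"
    and PF: "\<And>z. Im z > 0 \<Longrightarrow> P (F_transform \<nu> z) = F_transform \<nu> z - z"
    and \<delta>: "\<delta> > 0" and c: "c > 0" and C: "C > 0"
    and bd: "\<And>z. a - \<delta> \<le> Re z \<Longrightarrow> Re z \<le> b + \<delta> \<Longrightarrow> 0 < Im z \<Longrightarrow> Im z \<le> \<delta> \<Longrightarrow>
      c \<le> - Im (cauchy_transform \<nu> z) \<and> - Im (cauchy_transform \<nu> z) \<le> C"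
  obtains \<eta> R where "\<eta> > 0" "\<And>z. a - \<delta> / 2 \<le> Re z \<Longrightarrow> Re z \<le> b + \<delta> / 2 \<Longrightarrow> 0 < Im z \<Longrightarrow> Im z \<le> \<delta> / 2 \<Longrightarrow>
      \<eta> \<le> Im (F_transform \<nu> z) \<and> cmod (F_transform \<nu> z) \<le> R"
proof -
  interpret real_distribution \<nu> by fact
  \<comment> \<open>The first bound keeps \<open>h\<close>, at distance at most \<open>2 * y0\<close> from \<open>z\<close>, where \<open>- Im G \<le> C\<close> holds; the second
    gives \<open>C * y0\<^sup>2 \<le> y0 / 2\<close>.\<close>
  define y0 where "y0 = min (\<delta> / 8) (1 / (2 * C))"
  have y0: "y0 > 0" "y0 \<le> \<delta> / 8" "y0 \<le> 1 / (2 * C)" using \<delta> C by (auto simp: y0_def)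
  define \<eta> where "\<eta> = min y0 (c * (y0 / (2 * C)))"
  have "\<eta> \<le> Im (F_transform \<nu> z) \<and> cmod (F_transform \<nu> z) \<le> 1 / c"
    if z: "a - \<delta> / 2 \<le> Re z" "Re z \<le> b + \<delta> / 2" "0 < Im z" "Im z \<le> \<delta> / 2" for z
  proof -
    define w where "w = F_transform \<nu> z"
    define G where "G = cauchy_transform \<nu> z"
    have Gn: "G \<noteq> 0" unfolding G_def by (rule cauchy_transform_nonzero[OF z(3)])
    have wG: "w = 1 / G" by (simp add: w_def G_def F_transform_def)
    have cG: "c \<le> - Im G" unfolding G_def using bd[of z] z \<delta> by auto
    then have "c \<le> cmod G" using abs_Im_le_cmod[of G] by linarith
    then have R: "cmod w \<le> 1 / c" unfolding wG norm_divide using c by (simp add: frac_le)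
    have "Im w = - Im G * (cmod w)\<^sup>2"
      using Im_F_transform_eq[of z] unfolding w_def[symmetric] G_def[symmetric] by (simp add: wG norm_divide power_divide)
    then have horo: "c * (cmod w)\<^sup>2 \<le> Im w" using mult_right_mono[OF cG, of "(cmod w)\<^sup>2"] by simp
    have w0: "Im w > 0" unfolding w_def by (rule Im_F_transform_pos[OF z(3)])
    have Hw: "w - P w = z" using PF[OF z(3)] by (simp add: w_def)
    have "\<eta> \<le> Im w"
    proof (cases "Im w \<le> y0")
      case False
      then show ?thesis by (simp add: \<eta>_def)
    next
      case True
      define v where "v = Complex (Re w) y0"
      define h where "h = v - P v"
      have Imh: "Im h > 0" and dist: "cmod (h - z) \<le> 2 * y0"
        using vertical_ray_above[OF w0 _ True] z(3) unfolding h_def v_def Hw by auto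
      have "\<bar>Re h - Re z\<bar> \<le> \<delta> / 4" "\<bar>Im h - Im z\<bar> \<le> \<delta> / 4"
        using abs_Re_le_cmod[of "h - z"] abs_Im_le_cmod[of "h - z"] dist y0 by auto
      then have "a - \<delta> \<le> Re h" "Re h \<le> b + \<delta>" "Im h \<le> \<delta>" using z \<delta> by linarith+
      then have "- Im (cauchy_transform \<nu> h) \<le> C" using bd[of h] Imh by simp
      moreover have Fh: "F_transform \<nu> h = v"
      proof (rule inj_over_upper_half_plane)
        show "0 < Im (F_transform \<nu> h)" by (rule Im_F_transform_pos[OF Imh])
        show "0 < Im v" using y0 by (simp add: v_def)
        show "F_transform \<nu> h - P (F_transform \<nu> h) = v - P v" using PF[OF Imh] by (simp add: h_def)
        show "0 < Im (F_transform \<nu> h - P (F_transform \<nu> h))" using PF[OF Imh] Imh by simp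
        show "0 < Im (v - P v)" using Imh unfolding h_def .
      qed
      have "- Im (cauchy_transform \<nu> h) = y0 / ((Re w)\<^sup>2 + y0\<^sup>2)"
      proof -
        have "cauchy_transform \<nu> h = 1 / v" using Fh unfolding F_transform_def by auto
        then show ?thesis by (simp add: v_def Im_divide)
      qed
      ultimately have "y0 / ((Re w)\<^sup>2 + y0\<^sup>2) \<le> C" by simp
      then have "y0 \<le> C * ((Re w)\<^sup>2 + y0\<^sup>2)"
        using y0 by (subst (asm) pos_divide_le_eq) (auto simp: add_nonneg_pos)
      moreover have "C * y0\<^sup>2 \<le> y0 / 2"
      proof -
        have "C * y0 \<le> 1 / 2" using y0(3) C by (simp add: field_simps)
        then have "(C * y0) * y0 \<le> 1 / 2 * y0" using y0 by (intro mult_right_mono) auto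
        then show ?thesis by (simp add: power2_eq_square mult.assoc)
      qed
      ultimately have "y0 / 2 \<le> C * (Re w)\<^sup>2" by (simp add: distrib_left)
      then have "y0 / (2 * C) \<le> (Re w)\<^sup>2" using C by (simp add: field_simps)
      also have "\<dots> \<le> (cmod w)\<^sup>2" by (simp add: cmod_power2)
      finally have "c * (y0 / (2 * C)) \<le> c * (cmod w)\<^sup>2" using c by (intro mult_left_mono) auto
      also have "\<dots> \<le> Im w" by (rule horo)
      finally show ?thesis by (simp add: \<eta>_def)
    qed
    then show ?thesis using R by (simp add: w_def)
  qed
  moreover have "\<eta> > 0" using y0 c C by (simp add: \<eta>_def)
  ultimately show ?thesis by (rule that[rotated])
qed

text \<open>A cluster point \<open>w0\<close> of \<open>F\<close> along the vertical approach to \<open>x\<close> lies in the upper half-plane, because \<open>F\<close>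
stays in a compact set there, so \<open>w - P w\<close> is analytic there and takes the value \<open>x\<close>.\<close>

lemma (in subordinate_inverse) boundary_value_of_F_transform:
  assumes "real_distribution \<nu>"
    and PF: "\<And>z. Im z > 0 \<Longrightarrow> P (F_transform \<nu> z) = F_transform \<nu> z - z"
    and \<eta>: "\<eta> > 0" and d: "d > 0"
    and bd: "\<And>y. 0 < y \<Longrightarrow> y \<le> d \<Longrightarrow>
      \<eta> \<le> Im (F_transform \<nu> (Complex x y)) \<and> cmod (F_transform \<nu> (Complex x y)) \<le> R"
  obtains w0 where "Im w0 > 0" "w0 - P w0 = of_real x" "deriv (\<lambda>w. w - P w) w0 \<noteq> 0"
proof -
  interpret real_distribution \<nu> by fact
  define w where "w n = F_transform \<nu> (Complex x (d / real (Suc n)))" for n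
  define K where "K = cball 0 R \<inter> {w. Im w \<ge> \<eta>}"
  have "compact K" unfolding K_def by (intro compact_Int_closed compact_cball closed_halfspace_Im_ge)
  moreover have yn: "0 < d / real (Suc n)" "d / real (Suc n) \<le> d" for n
    using d by (auto simp: divide_simps)
  have "w n \<in> K" for n
    unfolding w_def K_def using bd[OF yn] by auto
  ultimately obtain w0 r where w0: "w0 \<in> K" and r: "strict_mono (r :: nat \<Rightarrow> nat)" "(w \<circ> r) \<longlonglongrightarrow> w0"
    using seq_compactE[of K w] by (auto simp: compact_eq_seq_compact_metric)
  have I: "Im w0 > 0" using w0 \<eta> by (auto simp: K_def)
  have "isCont P w0"
    using holomorphic_on_imp_continuous_on[OF hol] I
    by (simp add: upper_half_plane_def continuous_on_eq_continuous_at open_halfspace_Im_gt)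
  then have "(\<lambda>n. P ((w \<circ> r) n)) \<longlonglongrightarrow> P w0" using r(2) by (rule isCont_tendsto_compose)
  with r(2) have "(\<lambda>n. (w \<circ> r) n - P ((w \<circ> r) n)) \<longlonglongrightarrow> w0 - P w0" by (rule tendsto_diff)
  moreover have "(w \<circ> r) n - P ((w \<circ> r) n) = Complex x (d / real (Suc (r n)))" for n
    using PF[of "Complex x (d / real (Suc (r n)))"] yn by (simp add: w_def)
  moreover have "(\<lambda>n. Complex x (d / real (Suc (r n)))) \<longlonglongrightarrow> Complex x 0"
  proof (intro tendsto_Complex tendsto_const)
    have "(\<lambda>n. d / real (Suc n)) \<longlonglongrightarrow> 0"
      by (rule LIMSEQ_Suc[of "\<lambda>n. d / real n"]) (rule lim_const_over_n)
    from LIMSEQ_subseq_LIMSEQ[OF this r(1)] show "(\<lambda>n. d / real (Suc (r n))) \<longlonglongrightarrow> 0" by (simp add: o_def)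
  qed
  ultimately have w0x: "w0 - P w0 = of_real x"
    using LIMSEQ_unique by (fastforce simp: complex_of_real_def)
  have "P field_differentiable at w0"
    using hol I by (auto simp: upper_half_plane_def open_halfspace_Im_gt intro!: holomorphic_on_imp_differentiable_at)
  then have "deriv (\<lambda>w. w - P w) w0 = 1 - deriv P w0" by simp
  moreover have "deriv P w0 \<noteq> 1"
  proof (rule deriv_nonzero_at_real_value[OF I w0x])
    show "Im (F_transform \<nu> \<i>) > 0" by (rule Im_F_transform_pos) simp
    show "0 < Im (F_transform \<nu> \<i> - P (F_transform \<nu> \<i>))" using PF[of \<i>] by simp
  qed
  ultimately show ?thesis using that[OF I w0x] by simp
qed

section \<open>Uniform local inverses\<close>

lemma Cauchy_higher_deriv_bound_subset:
  assumes "f holomorphic_on S" "cball z r \<subseteq> S" "r > 0" "\<And>w. w \<in> cball z r \<Longrightarrow> cmod (f w) < B"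
  shows "cmod ((deriv ^^ k) f z) \<le> fact k * B / r ^ k"
proof (cases "k = 0")
  case True
  then show ?thesis using assms(4)[of z] assms(3) by simp
next
  case False
  show ?thesis
  proof (rule Cauchy_higher_deriv_bound[where y = 0])
    show "f holomorphic_on ball z r" "continuous_on (cball z r) f"
      using assms(1,2) ball_subset_cball[of z r]
      by (meson holomorphic_on_subset holomorphic_on_imp_continuous_on order_trans)+
    show "f w \<in> ball 0 B" if "w \<in> ball z r" for w using assms(4)[of w] that by simp
  qed (use False assms in auto)
qed

text \<open>Cauchy's estimate for the differences \<open>f n - g\<close>.\<close>

lemma uniform_limit_higher_deriv:
  fixes f :: "nat \<Rightarrow> complex \<Rightarrow> complex"
  assumes hol: "\<And>n. n \<ge> N \<Longrightarrow> f n holomorphic_on ball a R" "g holomorphic_on ball a R"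
    and ul: "uniform_limit (cball a r') f g sequentially" and r: "r < r'" "r' < R"
  shows "uniform_limit (cball a r) (\<lambda>n. (deriv ^^ k) (f n)) ((deriv ^^ k) g) sequentially"
  unfolding uniform_limit_iff
proof (intro allI impI)
  fix e :: real assume e: "e > 0"
  define \<rho> where "\<rho> = r' - r"
  have \<rho>: "\<rho> > 0" using r by (simp add: \<rho>_def)
  define B where "B = e * \<rho> ^ k / (2 * fact k)"
  have B: "B > 0" using e \<rho> by (simp add: B_def)
  from uniform_limitD[OF ul B] eventually_ge_at_top[of N]
  show "\<forall>\<^sub>F n in sequentially. \<forall>z\<in>cball a r. dist ((deriv ^^ k) (f n) z) ((deriv ^^ k) g z) < e"
  proof eventually_elim
    case (elim n)
    show ?case
    proof
      fix z assume z: "z \<in> cball a r"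
      have sub: "cball z \<rho> \<subseteq> cball a r'"
      proof
        fix w assume "w \<in> cball z \<rho>"
        then show "w \<in> cball a r'" using z dist_triangle[of a w z] by (simp add: \<rho>_def)
      qed
      then have sub': "cball z \<rho> \<subseteq> ball a R" using r by (auto simp: subset_iff)
      have zR: "z \<in> ball a R" using z r by simp
      have "cmod ((deriv ^^ k) (\<lambda>w. f n w - g w) z) \<le> fact k * B / \<rho> ^ k"
      proof (rule Cauchy_higher_deriv_bound_subset[OF _ sub' \<rho>])
        show "(\<lambda>w. f n w - g w) holomorphic_on ball a R"
          by (intro holomorphic_intros hol elim)
        show "cmod (f n w - g w) < B" if "w \<in> cball z \<rho>" for w
          using elim(1) sub that by (auto simp: dist_norm)
      qed
      also have "fact k * B / \<rho> ^ k = e / 2" using \<rho> by (simp add: B_def)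
      also have "(deriv ^^ k) (\<lambda>w. f n w - g w) z = (deriv ^^ k) (f n) z - (deriv ^^ k) g z"
        by (rule higher_deriv_diff[OF hol(1)[OF elim(2)] hol(2) open_ball zR])
      finally show "dist ((deriv ^^ k) (f n) z) ((deriv ^^ k) g z) < e" using e by (simp add: dist_norm)
    qed
  qed
qed

text \<open>A derivative within \<open>cmod D / 2\<close> of \<open>D\<close> on a disc makes the map expand distances by at least the factor \<open>cmod D / 2\<close>.
This gives injectivity, and an image that covers a disc of a radius known in advance. The radii and
constants do not depend on the map, which is what makes the inverses below live on a common disc.\<close>

lemma quantitative_inverse:
  assumes hol: "q holomorphic_on ball w0 r" and cont: "continuous_on (cball w0 r) q"
    and r: "r > 0" and D: "D \<noteq> 0"
    and d: "\<And>w. w \<in> ball w0 r \<Longrightarrow> cmod (deriv q w - D) \<le> cmod D / 2"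
    and near: "cmod (q w0 - x) \<le> cmod D * r / 8"
  shows "\<And>u v. u \<in> ball w0 r \<Longrightarrow> v \<in> ball w0 r \<Longrightarrow> cmod D / 2 * cmod (u - v) \<le> cmod (q u - q v)"
    and "\<exists>\<psi>. \<psi> holomorphic_on ball x (cmod D * r / 8) \<and> (\<forall>z\<in>ball x (cmod D * r / 8). \<psi> z \<in> ball w0 r \<and> q (\<psi> z) = z)"
proof -
  show expand: "cmod D / 2 * cmod (u - v) \<le> cmod (q u - q v)"
    if u: "u \<in> ball w0 r" and v: "v \<in> ball w0 r" for u v
  proof -
    have "cmod ((q u - D * u) - (q v - D * v)) \<le> cmod D / 2 * cmod (u - v)"
    proof (rule field_differentiable_bound[where S = "ball w0 r" and f' = "\<lambda>w. deriv q w - D"])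
      show "((\<lambda>w. q w - D * w) has_field_derivative deriv q w - D) (at w within ball w0 r)" if "w \<in> ball w0 r" for w
        using holomorphic_derivI[OF hol open_ball that, of "ball w0 r"]
        by (auto intro!: derivative_eq_intros)
    qed (use u v d in auto)
    moreover have "(q u - D * u) - (q v - D * v) = (q u - q v) - D * (u - v)" by (simp add: algebra_simps)
    ultimately have "cmod ((q u - q v) - D * (u - v)) \<le> cmod D / 2 * cmod (u - v)" by simp
    moreover have "cmod (D * (u - v)) \<le> cmod (q u - q v) + cmod ((q u - q v) - D * (u - v))"
      using norm_triangle_sub[of "D * (u - v)" "q u - q v"] by (simp add: norm_minus_commute)
    ultimately show ?thesis by (simp add: norm_mult)
  qed
  have inj: "inj_on q (ball w0 r)"
  proof (rule inj_onI)
    fix u v assume "u \<in> ball w0 r" "v \<in> ball w0 r" "q u = q v"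
    then have "cmod D / 2 * cmod (u - v) \<le> 0" using expand[of u v] by simp
    then show "u = v" using D by (simp add: mult_le_0_iff)
  qed
  have sphere: "cmod D / 2 * r \<le> cmod (q z - q w0)" if z: "z \<in> sphere w0 r" for z
  proof -
    have "z \<in> closure (ball w0 r)" using z r by simp
    then obtain s where s: "\<And>n. s n \<in> ball w0 r" "s \<longlonglongrightarrow> z" unfolding closure_sequential by blast
    have "(\<lambda>n. q (s n)) \<longlonglongrightarrow> q z"
    proof -
      have "(q \<circ> s) \<longlonglongrightarrow> q z"
        by (rule cont[unfolded continuous_on_sequentially, rule_format])
           (use s z in \<open>auto intro: less_imp_le\<close>)
      then show ?thesis by (simp add: o_def)
    qed
    then have 1: "(\<lambda>n. cmod (q (s n) - q w0)) \<longlonglongrightarrow> cmod (q z - q w0)" by (intro tendsto_intros)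
    have 2: "(\<lambda>n. cmod D / 2 * cmod (s n - w0)) \<longlonglongrightarrow> cmod D / 2 * cmod (z - w0)" by (intro tendsto_intros s)
    have "cmod D / 2 * cmod (z - w0) \<le> cmod (q z - q w0)"
      by (rule LIMSEQ_le[OF 2 1]) (use expand s(1) r in auto)
    moreover have "cmod (z - w0) = r" using z by (simp add: dist_norm norm_minus_commute)
    ultimately show ?thesis by simp
  qed
  have op: "open (q ` ball w0 r)" using open_mapping_thm3[OF hol open_ball inj] .
  have "ball (q w0) (cmod D / 2 * r) \<subseteq> q ` ball w0 r"
  proof (rule ball_subset_open_map_image)
    show "continuous_on (closure (ball w0 r)) q" using cont r by simp
    show "open (q ` interior (ball w0 r))" using op by (simp add: interior_open)
    show "cmod D / 2 * r \<le> cmod (q z - q w0)" if "z \<in> frontier (ball w0 r)" for z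
      using sphere that r by simp
  qed (use r D in auto)
  moreover have "ball x (cmod D * r / 8) \<subseteq> ball (q w0) (cmod D / 2 * r)"
  proof
    fix z assume z: "z \<in> ball x (cmod D * r / 8)"
    have "dist (q w0) z \<le> dist (q w0) x + dist x z" by (rule dist_triangle)
    also have "\<dots> < cmod D * r / 8 + cmod D * r / 8"
      by (rule add_le_less_mono) (use near z in \<open>simp_all add: dist_norm\<close>)
    also have "\<dots> = (cmod D * r) / 4" by simp
    also have "\<dots> \<le> (cmod D * r) / 2" using r by (intro divide_left_mono) auto
    also have "\<dots> = cmod D / 2 * r" by simp
    finally show "z \<in> ball (q w0) (cmod D / 2 * r)" by simp
  qed
  ultimately have sub: "ball x (cmod D * r / 8) \<subseteq> q ` ball w0 r" by blast
  obtain \<psi> where \<psi>: "\<psi> holomorphic_on (q ` ball w0 r)" "\<And>z. z \<in> ball w0 r \<Longrightarrow> \<psi> (q z) = z"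
    using holomorphic_has_inverse[OF hol open_ball inj] by metis
  show "\<exists>\<psi>. \<psi> holomorphic_on ball x (cmod D * r / 8) \<and> (\<forall>z\<in>ball x (cmod D * r / 8). \<psi> z \<in> ball w0 r \<and> q (\<psi> z) = z)"
  proof (intro exI[of _ \<psi>] conjI ballI)
    show "\<psi> holomorphic_on ball x (cmod D * r / 8)" by (rule holomorphic_on_subset[OF \<psi>(1) sub])
  qed (use sub \<psi>(2) in force)+
qed

text \<open>The discs are chosen from the limit function \<open>h\<close> alone; they then serve every sequence \<open>H\<close> that
converges to \<open>h\<close>. The order matters for the application, where the sequence is picked after the radius \<open>s\<close>.\<close>

lemma uniform_local_inverse:
  assumes S: "open S" "w0 \<in> S" and holh: "h holomorphic_on S" and D: "deriv h w0 \<noteq> 0"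
    and \<rho>: "\<rho> > 0"
  obtains r s \<psi> where "0 < r" "r \<le> \<rho>" "s > 0" "ball w0 r \<subseteq> S"
    "\<psi> holomorphic_on ball (h w0) s" "\<And>z. z \<in> ball (h w0) s \<Longrightarrow> \<psi> z \<in> ball w0 r \<and> h (\<psi> z) = z"
    "\<And>H N. (\<And>n. n \<ge> N \<Longrightarrow> H n holomorphic_on S) \<Longrightarrow>
      (\<And>K. compact K \<Longrightarrow> K \<subseteq> S \<Longrightarrow> uniform_limit K H h sequentially) \<Longrightarrow>
      \<exists>N' \<Psi>. N' \<ge> N \<and> (\<forall>n\<ge>N'. \<Psi> n holomorphic_on ball (h w0) s \<and>
          (\<forall>z\<in>ball (h w0) s. \<Psi> n z \<in> ball w0 r \<and> H n (\<Psi> n z) = z) \<and> inj_on (H n) (ball w0 r)) \<and>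
        uniform_limit (ball (h w0) s) \<Psi> \<psi> sequentially"
proof -
  define d where "d = cmod (deriv h w0)"
  have d: "d > 0" using D by (simp add: d_def)
  obtain r0 where r0: "r0 > 0" "cball w0 r0 \<subseteq> S" using S open_contains_cball by blast
  have "isCont (deriv h) w0"
    using holomorphic_on_imp_continuous_on[OF holomorphic_deriv[OF holh S(1)]] S
    by (simp add: continuous_on_eq_continuous_at)
  then obtain r1 where r1: "r1 > 0" "\<And>w. dist w w0 < r1 \<Longrightarrow> dist (deriv h w) (deriv h w0) < d / 4"
    unfolding continuous_at_eps_delta using d by (metis zero_less_divide_iff zero_less_numeral)
  define r where "r = min (r0 / 3) (min (r1 / 2) \<rho>)"
  have r: "r > 0" "r \<le> \<rho>" "r < r1" "r < 2 * r0 / 3" "r \<le> r0 / 3" using r0 r1 \<rho> by (auto simp: r_def)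
  have cb: "cball w0 r \<subseteq> S" using r r0 by (auto simp: subset_iff)
  have bR: "ball w0 r0 \<subseteq> S" using r0 by (auto simp: subset_iff)
  have dh: "cmod (deriv h w - deriv h w0) \<le> d / 4" if "w \<in> ball w0 r" for w
    using r1(2)[of w] that r by (simp add: dist_norm norm_minus_commute)
  define s where "s = d * r / 8"
  have s: "s > 0" using d r by (simp add: s_def)
  have hb: "h holomorphic_on ball w0 r" "continuous_on (cball w0 r) h"
    using holh cb ball_subset_cball[of w0 r]
    by (meson holomorphic_on_subset holomorphic_on_imp_continuous_on order_trans)+
  have "\<exists>\<psi>. \<psi> holomorphic_on ball (h w0) s \<and> (\<forall>z\<in>ball (h w0) s. \<psi> z \<in> ball w0 r \<and> h (\<psi> z) = z)"
    unfolding s_def d_def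
  proof (rule quantitative_inverse(2)[OF hb r(1) D])
    show "cmod (deriv h w - deriv h w0) \<le> cmod (deriv h w0) / 2" if "w \<in> ball w0 r" for w
      using dh[OF that] d unfolding d_def by linarith
  qed (use r in simp)
  then obtain \<psi> where \<psi>: "\<psi> holomorphic_on ball (h w0) s"
    "\<And>z. z \<in> ball (h w0) s \<Longrightarrow> \<psi> z \<in> ball w0 r \<and> h (\<psi> z) = z" by blast
  show ?thesis
  proof (rule that[OF r(1,2) s _ \<psi>])
    show "ball w0 r \<subseteq> S" using cb ball_subset_cball[of w0 r] by blast
    fix H :: "nat \<Rightarrow> complex \<Rightarrow> complex" and N
    assume holH: "\<And>n. n \<ge> N \<Longrightarrow> H n holomorphic_on S"
      and ul: "\<And>K. compact K \<Longrightarrow> K \<subseteq> S \<Longrightarrow> uniform_limit K H h sequentially"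
    have "uniform_limit (cball w0 r) (\<lambda>n. (deriv ^^ 1) (H n)) ((deriv ^^ 1) h) sequentially"
    proof (rule uniform_limit_higher_deriv[where R = r0 and r' = "2 * r0 / 3" and N = N])
      show "uniform_limit (cball w0 (2 * r0 / 3)) H h sequentially"
        by (rule ul) (use r0 in \<open>auto simp: subset_iff\<close>)
    qed (use holH holh bR r r0 in \<open>auto intro: holomorphic_on_subset\<close>)
    then have uld: "uniform_limit (cball w0 r) (\<lambda>n. deriv (H n)) (deriv h) sequentially" by simp
    have ul0: "uniform_limit (cball w0 r) H h sequentially" by (rule ul) (use cb in auto)
    have "d / 4 > 0" "d * r / 8 > 0" using d r by auto
    from uniform_limitD[OF uld this(1)] uniform_limitD[OF ul0 this(2)]
    have "eventually (\<lambda>n. (\<forall>w\<in>cball w0 r. dist (deriv (H n) w) (deriv h w) < d / 4) \<and>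
        (\<forall>w\<in>cball w0 r. dist (H n w) (h w) < d * r / 8)) sequentially"
      by (rule eventually_conj)
    then obtain N1 where N1: "\<And>n w. n \<ge> N1 \<Longrightarrow> w \<in> cball w0 r \<Longrightarrow> dist (deriv (H n) w) (deriv h w) < d / 4"
       "\<And>n w. n \<ge> N1 \<Longrightarrow> w \<in> cball w0 r \<Longrightarrow> dist (H n w) (h w) < d * r / 8"
      unfolding eventually_sequentially by blast
    define N' where "N' = max N N1"
    have dH: "cmod (deriv (H n) w - deriv h w0) \<le> d / 2" if "w \<in> ball w0 r" "n \<ge> N'" for n w
    proof -
      have "cmod (deriv (H n) w - deriv h w) < d / 4" using N1(1)[of n w] that by (simp add: dist_norm N'_def)
      then show ?thesis
        using dh[OF that(1)] norm_triangle_ineq[of "deriv (H n) w - deriv h w" "deriv h w - deriv h w0"] by simp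
    qed
    have Hb: "H n holomorphic_on ball w0 r" "continuous_on (cball w0 r) (H n)" if "n \<ge> N'" for n
    proof -
      have hol: "H n holomorphic_on cball w0 r" by (rule holomorphic_on_subset[OF holH cb]) (use that in \<open>simp add: N'_def\<close>)
      show "H n holomorphic_on ball w0 r" by (rule holomorphic_on_subset[OF hol ball_subset_cball])
      show "continuous_on (cball w0 r) (H n)" by (rule holomorphic_on_imp_continuous_on[OF hol])
    qed
    have near: "cmod (H n w0 - h w0) \<le> cmod (deriv h w0) * r / 8" if "n \<ge> N'" for n
      using N1(2)[of n w0] that r by (simp add: dist_norm N'_def d_def)
    have expH: "cmod (deriv h w0) / 2 * cmod (u - v) \<le> cmod (H n u - H n v)"
      if "n \<ge> N'" "u \<in> ball w0 r" "v \<in> ball w0 r" for n u v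
      by (rule quantitative_inverse(1)[OF Hb[OF that(1)] r(1) D _ near[OF that(1)] that(2,3)])
         (use dH that in \<open>auto simp: d_def\<close>)
    have "\<forall>n. \<exists>\<Psi>. n \<ge> N' \<longrightarrow> \<Psi> holomorphic_on ball (h w0) s \<and> (\<forall>z\<in>ball (h w0) s. \<Psi> z \<in> ball w0 r \<and> H n (\<Psi> z) = z)"
    proof
      fix n
      show "\<exists>\<Psi>. n \<ge> N' \<longrightarrow> \<Psi> holomorphic_on ball (h w0) s \<and> (\<forall>z\<in>ball (h w0) s. \<Psi> z \<in> ball w0 r \<and> H n (\<Psi> z) = z)"
      proof (cases "n \<ge> N'")
        case True
        have "\<exists>\<Psi>. \<Psi> holomorphic_on ball (h w0) s \<and> (\<forall>z\<in>ball (h w0) s. \<Psi> z \<in> ball w0 r \<and> H n (\<Psi> z) = z)"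
          unfolding s_def d_def
          by (rule quantitative_inverse(2)[OF Hb[OF True] r(1) D _ near[OF True]]) (use dH True in \<open>auto simp: d_def\<close>)
        then show ?thesis by blast
      qed blast
    qed
    from choice[OF this] obtain \<Psi> where \<Psi>: "\<And>n. n \<ge> N' \<Longrightarrow> \<Psi> n holomorphic_on ball (h w0) s"
      "\<And>n z. n \<ge> N' \<Longrightarrow> z \<in> ball (h w0) s \<Longrightarrow> \<Psi> n z \<in> ball w0 r \<and> H n (\<Psi> n z) = z" by metis
    have ul\<Psi>: "uniform_limit (ball (h w0) s) \<Psi> \<psi> sequentially"
      unfolding uniform_limit_iff
    proof (intro allI impI)
      fix e :: real assume e: "e > 0"
      then have "d / 2 * e > 0" using d by simp
      from uniform_limitD[OF ul0 this] eventually_ge_at_top[of N']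
      show "\<forall>\<^sub>F n in sequentially. \<forall>z\<in>ball (h w0) s. dist (\<Psi> n z) (\<psi> z) < e"
      proof eventually_elim
        case (elim n)
        show ?case
        proof
          fix z assume z: "z \<in> ball (h w0) s"
          have "d / 2 * cmod (\<Psi> n z - \<psi> z) \<le> cmod (H n (\<Psi> n z) - H n (\<psi> z))"
            unfolding d_def using expH[OF elim(2)] \<Psi>(2)[OF elim(2) z] \<psi>(2)[OF z] by blast
          also have "H n (\<Psi> n z) - H n (\<psi> z) = h (\<psi> z) - H n (\<psi> z)"
            using \<Psi>(2)[OF elim(2) z] \<psi>(2)[OF z] by simp
          also have "cmod \<dots> < d / 2 * e"
          proof -
            have "dist (H n (\<psi> z)) (h (\<psi> z)) < d / 2 * e"
              by (rule elim(1)[rule_format]) (use \<psi>(2)[OF z] in simp)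
            then show ?thesis by (simp only: dist_norm norm_minus_commute)
          qed
          finally show "dist (\<Psi> n z) (\<psi> z) < e" using d by (simp add: dist_norm)
        qed
      qed
    qed
    have inj: "inj_on (H n) (ball w0 r)" if "n \<ge> N'" for n
    proof (rule inj_onI)
      fix u v assume "u \<in> ball w0 r" "v \<in> ball w0 r" "H n u = H n v"
      then have "cmod (deriv h w0) / 2 * cmod (u - v) \<le> 0" using expH[OF that, of u v] by simp
      then show "u = v" using D by (simp add: mult_le_0_iff)
    qed
    show "\<exists>N' \<Psi>. N' \<ge> N \<and> (\<forall>n\<ge>N'. \<Psi> n holomorphic_on ball (h w0) s \<and>
          (\<forall>z\<in>ball (h w0) s. \<Psi> n z \<in> ball w0 r \<and> H n (\<Psi> n z) = z) \<and> inj_on (H n) (ball w0 r)) \<and>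
        uniform_limit (ball (h w0) s) \<Psi> \<psi> sequentially"
      using \<Psi> inj ul\<Psi> by (intro exI[of _ N'] exI[of _ \<Psi>] conjI allI impI ballI) (auto simp: N'_def)
  qed
qed

section \<open>Stieltjes inversion\<close>

lemma has_density_on_subset: "has_density_on \<mu> f U \<Longrightarrow> V \<subseteq> U \<Longrightarrow> has_density_on \<mu> f V"
  unfolding has_density_on_def by blast

text \<open>Densities are glued over finitely many intervals; continuity of \<open>f\<close> supplies measurability on the union,
as nothing is assumed about \<open>f\<close> elsewhere.\<close>

lemma has_density_on_Un:
  assumes "has_density_on \<mu> f U" "has_density_on \<mu> f V" "open U" "open V" "sets \<mu> = sets borel"
    and cont: "continuous_on (U \<union> V) f"
  shows "has_density_on \<mu> f (U \<union> V)"
  unfolding has_density_on_def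
proof (intro conjI ballI impI)
  show "0 \<le> f x" if "x \<in> U \<union> V" for x using assms that by (auto simp: has_density_on_def)
  fix B :: "real set" assume B: "B \<in> sets borel" "B \<subseteq> U \<union> V"
  have B1: "B \<inter> U \<in> sets borel" "B - U \<in> sets borel" using B assms(3) by auto
  define h where "h t = ennreal (indicator (U \<union> V) t * f t)" for t
  have m: "h \<in> borel_measurable borel"
    unfolding h_def using borel_measurable_continuous_on_indicator[OF _ cont] assms(3,4) by simp
  have h: "(\<lambda>t. h t * indicator A t) = (\<lambda>t. ennreal (f t) * indicator A t)" if "A \<subseteq> U \<union> V" for A
  proof
    fix t show "h t * indicator A t = ennreal (f t) * indicator A t"
      using that by (cases "t \<in> A") (auto simp: h_def)
  qed
  have "emeasure \<mu> B = emeasure \<mu> (B \<inter> U) + emeasure \<mu> (B - U)"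
    using B1 assms(5) by (subst plus_emeasure) (auto simp: Int_Diff_Un)
  also have "emeasure \<mu> (B \<inter> U) = (\<integral>\<^sup>+x\<in>B \<inter> U. h x \<partial>lborel)"
    using assms(1) B1 by (subst h) (auto simp: has_density_on_def)
  also have "emeasure \<mu> (B - U) = (\<integral>\<^sup>+x\<in>B - U. h x \<partial>lborel)"
    using assms(2) B1 B by (subst h) (auto simp: has_density_on_def)
  also have "(\<integral>\<^sup>+x\<in>B \<inter> U. h x \<partial>lborel) + (\<integral>\<^sup>+x\<in>B - U. h x \<partial>lborel)
      = (\<integral>\<^sup>+x. h x * indicator (B \<inter> U) x + h x * indicator (B - U) x \<partial>lborel)"
    using m B1 by (intro nn_integral_add[symmetric]) auto
  also have "\<dots> = (\<integral>\<^sup>+x\<in>B. h x \<partial>lborel)"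
    by (intro nn_integral_cong) (auto simp: indicator_def)
  finally show "emeasure \<mu> B = (\<integral>\<^sup>+x\<in>B. ennreal (f x) \<partial>lborel)" unfolding h[OF B(2)] .
qed

lemma has_density_on_UN:
  assumes "finite T" "sets \<mu> = sets borel"
    "\<And>i. i \<in> T \<Longrightarrow> open (A i) \<and> has_density_on \<mu> f (A i) \<and> continuous_on (A i) f"
  shows "has_density_on \<mu> f (\<Union>i\<in>T. A i)"
  using assms(1,3)
proof (induction T)
  case empty
  then show ?case by (auto simp: has_density_on_def)
next
  case (insert i T)
  have "continuous_on (\<Union>j\<in>insert i T. A j) f"
    by (rule continuous_on_open_UN) (use insert.prems in auto)
  then have "has_density_on \<mu> f (A i \<union> (\<Union>j\<in>T. A j))"
    using insert by (intro has_density_on_Un assms(2)) auto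
  then show ?case by simp
qed

text \<open>If \<open>f x < g x\<close>, two constants separate \<open>f\<close> from \<open>g\<close> on a short interval about \<open>x\<close>, which would then have two
different masses. Used in both directions, this shows that a continuous density is unique.\<close>

lemma continuous_density_le:
  assumes "has_density_on \<mu> f U" "has_density_on \<mu> g U" "open U"
    "continuous_on U f" "continuous_on U g" "x \<in> U"
  shows "g x \<le> f x"
proof (rule ccontr)
  assume "\<not> g x \<le> f x"
  define m1 m2 where "m1 = f x + (g x - f x) / 3" and "m2 = f x + (g x - f x) * (2 / 3)"
  have m: "f x < m1" "m1 < m2" "m2 < g x" using \<open>\<not> g x \<le> f x\<close> by (auto simp: m1_def m2_def field_simps)
  have fx: "f x \<ge> 0" using assms by (auto simp: has_density_on_def)
  have m0: "m1 > 0" "m2 > 0" using m fx by linarith+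
  have "isCont f x" "isCont g x" using assms by (auto simp: continuous_on_eq_continuous_at)
  then have "eventually (\<lambda>t. f t < m1) (nhds x)" "eventually (\<lambda>t. m2 < g t) (nhds x)"
    unfolding isCont_def tendsto_at_iff_tendsto_nhds using m by (auto intro: order_tendstoD)
  moreover have "eventually (\<lambda>t. t \<in> U) (nhds x)" using assms by (intro eventually_nhds_in_open)
  ultimately have "eventually (\<lambda>t. f t < m1 \<and> m2 < g t \<and> t \<in> U) (nhds x)"
    by eventually_elim simp
  then obtain e where e: "e > 0" "\<And>t. dist t x < e \<Longrightarrow> f t < m1 \<and> m2 < g t \<and> t \<in> U"
    unfolding eventually_nhds_metric by blast
  define B where "B = {x - e / 2..x + e / 2}"
  have B: "B \<in> sets borel" "B \<subseteq> U" using e by (auto simp: B_def dist_real_def)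
  have Bfg: "f t < m1 \<and> m2 < g t" if "t \<in> B" for t using e that by (auto simp: B_def dist_real_def)
  have len: "emeasure lborel B = ennreal e" using e by (simp add: B_def)
  have "ennreal (m2 * e) = (\<integral>\<^sup>+t\<in>B. ennreal m2 \<partial>lborel)"
    using B m0 e by (subst nn_integral_cmult_indicator) (auto simp: len ennreal_mult)
  also have "\<dots> \<le> (\<integral>\<^sup>+t\<in>B. ennreal (g t) \<partial>lborel)"
    using Bfg by (intro nn_integral_mono) (auto simp: indicator_def less_imp_le intro!: ennreal_leI)
  also have "\<dots> = (\<integral>\<^sup>+t\<in>B. ennreal (f t) \<partial>lborel)"
    using assms(1,2) B unfolding has_density_on_def by metis
  also have "\<dots> \<le> (\<integral>\<^sup>+t\<in>B. ennreal m1 \<partial>lborel)"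
    using Bfg by (intro nn_integral_mono) (auto simp: indicator_def less_imp_le intro!: ennreal_leI)
  also have "\<dots> = ennreal (m1 * e)"
    using B m0 e by (subst nn_integral_cmult_indicator) (auto simp: len ennreal_mult)
  finally have "m2 * e \<le> m1 * e" using m0 e by (subst (asm) ennreal_le_iff) auto
  then show False using m e by simp
qed

lemma tendsto_arctan_div_0:
  assumes "y \<longlonglongrightarrow> 0" "\<And>n::nat. y n > (0::real)"
  shows "(\<lambda>n. arctan (u / y n)) \<longlonglongrightarrow> pi / 2 * sgn u"
proof -
  have inf: "filterlim (\<lambda>n. 1 / y n) at_top sequentially"
    using filterlim_inverse_at_top[OF assms(1)] assms(2) by (simp add: inverse_eq_divide)
  consider "u > 0" | "u = 0" | "u < 0" by linarith
  then show ?thesis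
  proof cases
    case 1
    have "filterlim (\<lambda>n. u * (1 / y n)) at_top sequentially"
      by (rule filterlim_tendsto_pos_mult_at_top[OF tendsto_const 1 inf])
    from filterlim_compose[OF tendsto_arctan_at_top this] 1 show ?thesis by simp
  next
    case 3
    have "filterlim (\<lambda>n. u * (1 / y n)) at_bot sequentially"
      by (rule filterlim_tendsto_neg_mult_at_bot[OF tendsto_const 3 inf])
    from filterlim_compose[OF tendsto_arctan_at_bot this] 3 show ?thesis by simp
  qed simp
qed

context real_distribution
begin

text \<open>Fubini's theorem; the inner integral of the Poisson kernel is a difference of arctangents.\<close>

lemma integral_Im_cauchy_transform:
  assumes y: "y > 0" and cd: "c \<le> d"
    and cont: "continuous_on {c..d} (\<lambda>x. Im (cauchy_transform M (Complex x y)))"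
  shows "(\<integral>x. indicator {c..d} x * - Im (cauchy_transform M (Complex x y)) \<partial>lborel)
    = (\<integral>t. arctan ((d - t) / y) - arctan ((c - t) / y) \<partial>M)"
proof -
  let ?k = "\<lambda>x t. y / ((x - t)\<^sup>2 + y\<^sup>2)"
  let ?g = "\<lambda>x. - Im (cauchy_transform M (Complex x y))"
  have g: "ennreal (?g x) = (\<integral>\<^sup>+t. ennreal (?k x t) \<partial>M)" for x
    using Im_cauchy_transform[of "Complex x y"] integrable_poisson[of "Complex x y"] y
    by (subst nn_integral_eq_integral) auto
  have g0: "?g x \<ge> 0" for x using Im_cauchy_transform_neg[of "Complex x y"] y by simp
  interpret P: pair_sigma_finite lborel M
    by (intro pair_sigma_finite.intro sigma_finite_measure_axioms lborel.sigma_finite_measure_axioms)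
  have meas: "(\<lambda>(x, t). indicator {c..d} x * ennreal (?k x t)) \<in> borel_measurable (lborel \<Otimes>\<^sub>M M)"
    by measurable
  have "(\<integral>\<^sup>+x. indicator {c..d} x * ennreal (?g x) \<partial>lborel)
      = (\<integral>\<^sup>+x. (\<integral>\<^sup>+t. indicator {c..d} x * ennreal (?k x t) \<partial>M) \<partial>lborel)"
    unfolding g by (intro nn_integral_cong nn_integral_cmult[symmetric]) simp
  also have "\<dots> = (\<integral>\<^sup>+t. (\<integral>\<^sup>+x. indicator {c..d} x * ennreal (?k x t) \<partial>lborel) \<partial>M)"
    by (rule P.Fubini'[OF meas, symmetric])
  also have "\<dots> = (\<integral>\<^sup>+t. ennreal (arctan ((d - t) / y) - arctan ((c - t) / y)) \<partial>M)"
  proof (intro nn_integral_cong)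
    fix t
    have "(\<integral>\<^sup>+x. indicator {c..d} x * ennreal (?k x t) \<partial>lborel)
        = (\<integral>\<^sup>+x. ennreal (y / ((t - x)\<^sup>2 + y\<^sup>2)) * indicator {c..d} x \<partial>lborel)"
      by (intro nn_integral_cong) (simp add: mult.commute power2_commute)
    then show "(\<integral>\<^sup>+x. indicator {c..d} x * ennreal (?k x t) \<partial>lborel)
        = ennreal (arctan ((d - t) / y) - arctan ((c - t) / y))"
      using nn_integral_poisson[OF y cd] by simp
  qed
  finally have eq0: "(\<integral>\<^sup>+x. indicator {c..d} x * ennreal (?g x) \<partial>lborel) = (\<integral>\<^sup>+t. ennreal (arctan ((d - t) / y) - arctan ((c - t) / y)) \<partial>M)" .
  have eq: "(\<integral>\<^sup>+x. ennreal (indicator {c..d} x * ?g x) \<partial>lborel)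
      = (\<integral>\<^sup>+t. ennreal (arctan ((d - t) / y) - arctan ((c - t) / y)) \<partial>M)"
  proof -
    have "ennreal (indicator {c..d} x * ?g x) = indicator {c..d} x * ennreal (?g x)" for x
      by (simp add: indicator_def)
    then show ?thesis using eq0 by (simp only:)
  qed
  have int: "integrable lborel (\<lambda>x. indicator {c..d} x * ?g x)"
    using borel_integrable_compact[OF compact_Icc continuous_on_minus[OF cont]] by simp
  have pos: "arctan ((d - t) / y) - arctan ((c - t) / y) \<ge> 0" for t
    using cd y by (simp add: arctan_le_iff divide_right_mono)
  have int2: "integrable M (\<lambda>t. arctan ((d - t) / y) - arctan ((c - t) / y))"
  proof (rule integrable_const_bound[where B = pi])
    show "AE t in M. norm (arctan ((d - t) / y) - arctan ((c - t) / y)) \<le> pi"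
    proof (intro AE_I2)
      fix t
      show "norm (arctan ((d - t) / y) - arctan ((c - t) / y)) \<le> pi"
        using arctan_bounded[of "(d - t) / y"] arctan_bounded[of "(c - t) / y"] by (simp add: abs_le_iff)
    qed
  qed measurable
  have "ennreal (\<integral>x. indicator {c..d} x * ?g x \<partial>lborel) = ennreal (\<integral>t. arctan ((d - t) / y) - arctan ((c - t) / y) \<partial>M)"
  proof -
    have "(\<integral>\<^sup>+x. ennreal (indicator {c..d} x * ?g x) \<partial>lborel) = ennreal (\<integral>x. indicator {c..d} x * ?g x \<partial>lborel)"
      by (intro nn_integral_eq_integral int AE_I2 mult_nonneg_nonneg g0) simp
    moreover have "(\<integral>\<^sup>+t. ennreal (arctan ((d - t) / y) - arctan ((c - t) / y)) \<partial>M)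
        = ennreal (\<integral>t. arctan ((d - t) / y) - arctan ((c - t) / y) \<partial>M)"
      by (intro nn_integral_eq_integral int2 AE_I2 pos)
    ultimately show ?thesis using eq by (simp only:)
  qed
  moreover have "(\<integral>x. indicator {c..d} x * ?g x \<partial>lborel) \<ge> 0"
    by (intro integral_nonneg_AE AE_I2 mult_nonneg_nonneg g0) simp
  moreover have "(\<integral>t. arctan ((d - t) / y) - arctan ((c - t) / y) \<partial>M) \<ge> 0"
    by (intro integral_nonneg_AE AE_I2 pos)
  ultimately show ?thesis by (simp only: ennreal_inj)
qed

text \<open>As the height tends to \<open>0\<close>, the differences of arctangents tend, for \<open>c < d\<close>, to \<open>pi\<close> inside the interval, to \<open>pi / 2\<close> at
its endpoints and to \<open>0\<close> outside. The formula with \<open>sgn\<close> states this without case distinctions.\<close>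

lemma stieltjes_inversion_interval:
  assumes cd: "c \<le> d" and \<rho>: "\<rho> > 0"
    and Q: "continuous_on (cbox (Complex c 0) (Complex d \<rho>)) Q"
    and QG: "\<And>z. z \<in> cbox (Complex c 0) (Complex d \<rho>) \<Longrightarrow> Im z > 0 \<Longrightarrow> Q z = cauchy_transform M z"
  shows "(\<integral>x. indicator {c..d} x * - Im (Q (of_real x)) \<partial>lborel) = (\<integral>t. pi / 2 * (sgn (d - t) - sgn (c - t)) \<partial>M)"
proof -
  define y where "y n = \<rho> / real (Suc n)" for n
  have y: "y n > 0" "y n \<le> \<rho>" for n using \<rho> by (auto simp: y_def divide_simps)
  have y0: "y \<longlonglongrightarrow> 0"
    unfolding y_def by (rule LIMSEQ_Suc[of "\<lambda>n. \<rho> / real n"]) (rule lim_const_over_n)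
  have mem: "Complex x v \<in> cbox (Complex c 0) (Complex d \<rho>)" if "x \<in> {c..d}" "0 \<le> v" "v \<le> \<rho>" for x v
    using that by (simp add: in_cbox_complex_iff)
  have contC: "continuous_on {c..d} (\<lambda>x. Complex x v)" for v
    by (intro continuous_on_Complex continuous_intros)
  have contQ: "continuous_on {c..d} (\<lambda>x. Im (Q (Complex x v)))" if v: "0 \<le> v" "v \<le> \<rho>" for v
    by (intro continuous_intros continuous_on_compose2[OF Q contC[of v]]) (use mem v in auto)
  obtain B where B: "\<And>z. z \<in> cbox (Complex c 0) (Complex d \<rho>) \<Longrightarrow> cmod (Q z) \<le> B"
    using compact_imp_bounded[OF compact_continuous_image[OF Q compact_cbox]] by (auto simp: bounded_iff)
  have L1: "(\<lambda>n. \<integral>x. indicator {c..d} x * - Im (Q (Complex x (y n))) \<partial>lborel)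
      \<longlonglongrightarrow> (\<integral>x. indicator {c..d} x * - Im (Q (of_real x)) \<partial>lborel)"
  proof (rule integral_dominated_convergence[where w = "\<lambda>x. indicator {c..d} x * B"])
    have m: "(\<lambda>x. indicator {c..d} x * - Im (Q (Complex x v))) \<in> borel_measurable lborel" if "0 \<le> v" "v \<le> \<rho>" for v
      using borel_measurable_continuous_on_indicator[OF _ continuous_on_minus[OF contQ[OF that]]] by simp
    show "(\<lambda>x. indicator {c..d} x * - Im (Q (of_real x))) \<in> borel_measurable lborel"
      using m[of 0] \<rho> by (simp add: complex_of_real_def)
    show "(\<lambda>x. indicator {c..d} x * - Im (Q (Complex x (y n)))) \<in> borel_measurable lborel" for n
      using m[of "y n"] y[of n] by (simp add: less_imp_le)
    show "integrable lborel (\<lambda>x. indicator {c..d} x * B)"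
      by (intro integrable_mult_left integrable_real_indicator) (use cd in auto)
    show "AE x in lborel. (\<lambda>n. indicator {c..d} x * - Im (Q (Complex x (y n)))) \<longlonglongrightarrow> indicator {c..d} x * - Im (Q (of_real x))"
    proof (intro AE_I2)
      fix x
      show "(\<lambda>n. indicator {c..d} x * - Im (Q (Complex x (y n)))) \<longlonglongrightarrow> indicator {c..d} x * - Im (Q (of_real x))"
      proof (cases "x \<in> {c..d}")
        case True
        have "(\<lambda>n. Q (Complex x (y n))) \<longlonglongrightarrow> Q (Complex x 0)"
        proof -
          have "(Q \<circ> (\<lambda>n. Complex x (y n))) \<longlonglongrightarrow> Q (Complex x 0)"
            by (rule Q[unfolded continuous_on_sequentially, rule_format])
               (use mem[OF True] y y0 \<rho> in \<open>auto intro!: tendsto_Complex simp: less_imp_le\<close>)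
          then show ?thesis by (simp add: o_def)
        qed
        then show ?thesis using True unfolding complex_of_real_def by (intro tendsto_intros)
      qed simp
    qed
    show "AE x in lborel. norm (indicator {c..d} x * - Im (Q (Complex x (y n)))) \<le> indicator {c..d} x * B" for n
    proof (intro AE_I2)
      fix x
      show "norm (indicator {c..d} x * - Im (Q (Complex x (y n)))) \<le> indicator {c..d} x * B"
      proof (cases "x \<in> {c..d}")
        case True
        have "cmod (Q (Complex x (y n))) \<le> B" using B mem[OF True] y[of n] by (simp add: less_imp_le)
        then show ?thesis using True abs_Im_le_cmod[of "Q (Complex x (y n))"] by simp
      qed simp
    qed
  qed
  have L2: "(\<integral>x. indicator {c..d} x * - Im (Q (Complex x (y n))) \<partial>lborel)
      = (\<integral>t. arctan ((d - t) / y n) - arctan ((c - t) / y n) \<partial>M)" for n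
  proof -
    have QGn: "Q (Complex x (y n)) = cauchy_transform M (Complex x (y n))" if "x \<in> {c..d}" for x
      by (rule QG[OF mem[OF that]]) (use y[of n] in \<open>auto simp: less_imp_le\<close>)
    have "(\<integral>x. indicator {c..d} x * - Im (Q (Complex x (y n))) \<partial>lborel)
        = (\<integral>x. indicator {c..d} x * - Im (cauchy_transform M (Complex x (y n))) \<partial>lborel)"
      by (intro Bochner_Integration.integral_cong) (auto simp: indicator_def QGn)
    also have "\<dots> = (\<integral>t. arctan ((d - t) / y n) - arctan ((c - t) / y n) \<partial>M)"
    proof (rule integral_Im_cauchy_transform[OF y(1) cd])
      have "continuous_on {c..d} (\<lambda>x. Im (Q (Complex x (y n))))"
        using contQ[of "y n"] y[of n] by simp
      then show "continuous_on {c..d} (\<lambda>x. Im (cauchy_transform M (Complex x (y n))))"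
        by (rule continuous_on_eq) (simp only: QGn)
    qed
    finally show ?thesis .
  qed
  have L3: "(\<lambda>n. \<integral>t. arctan ((d - t) / y n) - arctan ((c - t) / y n) \<partial>M) \<longlonglongrightarrow> (\<integral>t. pi / 2 * (sgn (d - t) - sgn (c - t)) \<partial>M)"
  proof (rule integral_dominated_convergence[where w = "\<lambda>_. pi"])
    show "AE t in M. (\<lambda>n. arctan ((d - t) / y n) - arctan ((c - t) / y n)) \<longlonglongrightarrow> pi / 2 * (sgn (d - t) - sgn (c - t))"
      unfolding right_diff_distrib by (intro AE_I2 tendsto_diff tendsto_arctan_div_0 y0 y)
    show "AE t in M. norm (arctan ((d - t) / y n) - arctan ((c - t) / y n)) \<le> pi" for n
    proof (intro AE_I2)
      fix t
      show "norm (arctan ((d - t) / y n) - arctan ((c - t) / y n)) \<le> pi"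
        using arctan_bounded[of "(d - t) / y n"] arctan_bounded[of "(c - t) / y n"] by (simp add: abs_le_iff)
    qed
  qed measurable
  show ?thesis by (rule LIMSEQ_unique[OF L1[unfolded L2] L3])
qed

text \<open>Stieltjes inversion: a continuous extension of the Cauchy transform to a real interval excludes atoms there
and identifies the measure on all subintervals, hence on all Borel subsets.\<close>

lemma has_density_on_boundary_values:
  assumes r: "r > 0" and Q: "continuous_on (ball (of_real x0) r) Q"
    and QG: "\<And>z. z \<in> ball (of_real x0) r \<Longrightarrow> Im z > 0 \<Longrightarrow> Q z = cauchy_transform M z"
    and g: "\<And>t. \<bar>t - x0\<bar> < r \<Longrightarrow> g t = - Im (Q (of_real t)) / pi"
  shows "has_density_on M g {x0 - r / 2<..<x0 + r / 2}"
proof -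
  define p q where "p = x0 - r / 2" and "q = x0 + r / 2"
  have box: "cbox (Complex c 0) (Complex d (r / 4)) \<subseteq> ball (of_real x0) r" if "p \<le> c" "d \<le> q" for c d
  proof
    fix z assume z: "z \<in> cbox (Complex c 0) (Complex d (r / 4))"
    have "cmod (z - of_real x0) \<le> \<bar>Re z - x0\<bar> + \<bar>Im z\<bar>" using cmod_le[of "z - of_real x0"] by simp
    also have "\<dots> \<le> r / 2 + r / 4"
    proof -
      have "x0 - r / 2 \<le> Re z" "Re z \<le> x0 + r / 2" "0 \<le> Im z" "Im z \<le> r / 4"
        using z that by (auto simp: in_cbox_complex_iff p_def q_def)
      then show ?thesis by arith
    qed
    also have "\<dots> < r" using r by simp
    finally show "z \<in> ball (of_real x0) r" by (simp add: dist_norm norm_minus_commute)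
  qed
  have S: "(\<integral>x. indicator {c..d} x * - Im (Q (of_real x)) \<partial>lborel) = (\<integral>t. pi / 2 * (sgn (d - t) - sgn (c - t)) \<partial>M)"
    if "p \<le> c" "c \<le> d" "d \<le> q" for c d
  proof (rule stieltjes_inversion_interval[OF that(2), of "r / 4"])
    show "continuous_on (cbox (Complex c 0) (Complex d (r / 4))) Q"
      by (rule continuous_on_subset[OF Q box]) (use that in auto)
    show "Q z = cauchy_transform M z" if "z \<in> cbox (Complex c 0) (Complex d (r / 4))" "Im z > 0" for z
      using QG[of z] box[of c d] that \<open>p \<le> c\<close> \<open>d \<le> q\<close> by blast
  qed (use r in simp)
  have inb: "of_real t \<in> ball (of_real x0 :: complex) r" if "\<bar>t - x0\<bar> < r" for t
    using that by (simp add: dist_norm abs_minus_commute flip: of_real_diff)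
  have contI: "continuous_on {x0 - r<..<x0 + r} (\<lambda>t. - Im (Q (of_real t)))"
    by (intro continuous_intros continuous_on_compose2[OF Q]) (use inb in \<open>auto simp: abs_less_iff\<close>)
  have pq: "x0 - r < p" "q < x0 + r" "p < q" using r by (auto simp: p_def q_def)
  have contcd: "continuous_on {c..d} (\<lambda>t. - Im (Q (of_real t)))" if "p \<le> c" "d \<le> q" for c d
    by (rule continuous_on_subset[OF contI]) (use that pq in auto)
  have intcd: "integrable lborel (\<lambda>x. indicator {c..d} x * - Im (Q (of_real x)))" if "p \<le> c" "d \<le> q" for c d
    using borel_integrable_compact[OF _ contcd[OF that]] by simp
  have sgn_int: "integrable M (\<lambda>t. pi / 2 * (sgn (d - t) - sgn (c - t)))" for c d
  proof (rule integrable_const_bound[where B = pi])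
    show "AE t in M. norm (pi / 2 * (sgn (d - t) - sgn (c - t))) \<le> pi"
      by (intro AE_I2) (auto simp: sgn_if)
  qed measurable
  \<comment> \<open>An atom at an endpoint of \<open>[c, d]\<close> contributes half its mass to the inversion formula, while the
    left-hand side is of order \<open>d - c\<close>; letting the interval shrink shows that there are no atoms.\<close>
  obtain B where B: "B > 0" "\<And>t. t \<in> {p..q} \<Longrightarrow> \<bar>- Im (Q (of_real t))\<bar> \<le> B"
    using compact_imp_bounded[OF compact_continuous_image[OF contcd[of p q]]] by (auto simp: bounded_pos)
  have atom: "pi / 2 * measure M {s} \<le> B * (d - c)" if cd: "p \<le> c" "c < d" "d \<le> q" and s: "s = c \<or> s = d" for c d s
  proof -
    have "pi / 2 * measure M {s} = (\<integral>t. pi / 2 * indicator {s} t \<partial>M)" by simp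
    also have "\<dots> \<le> (\<integral>t. pi / 2 * (sgn (d - t) - sgn (c - t)) \<partial>M)"
    proof (rule integral_mono[OF _ sgn_int])
      show "integrable M (\<lambda>t. pi / 2 * indicator {s} t)"
        by (intro integrable_mult_right integrable_real_indicator) (auto simp: emeasure_eq_measure)
      show "pi / 2 * indicator {s} t \<le> pi / 2 * (sgn (d - t) - sgn (c - t))" for t
        using cd s by (intro mult_left_mono) (auto simp: indicator_def sgn_if)
    qed
    also have "\<dots> = (\<integral>x. indicator {c..d} x * - Im (Q (of_real x)) \<partial>lborel)" using S[of c d] cd by simp
    also have "\<dots> \<le> (\<integral>x. indicator {c..d} x * B \<partial>lborel)"
    proof (rule integral_mono[OF intcd])
      show "indicator {c..d} t * - Im (Q (of_real t)) \<le> indicator {c..d} t * B" for t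
        using B(2)[of t] cd by (cases "t \<in> {c..d}") (auto simp: abs_le_iff)
      show "integrable lborel (\<lambda>x. indicator {c..d} x * B)"
        by (intro integrable_mult_left integrable_real_indicator) (use cd in auto)
    qed (use cd in auto)
    also have "\<dots> = B * (d - c)" using cd by simp
    finally show ?thesis .
  qed
  have no_atom: "measure M {s} = 0" if s: "p \<le> s" "s \<le> q" for s
  proof (rule ccontr)
    assume "measure M {s} \<noteq> 0"
    then have m: "measure M {s} > 0" by (simp add: zero_less_measure_iff)
    define e where "e = min (r / 2) (pi / 2 * measure M {s} / (2 * B))"
    have e: "e > 0" "e \<le> r / 2" using r B m by (auto simp: e_def)
    have "B * e \<le> B * (pi / 2 * measure M {s} / (2 * B))" using B by (intro mult_left_mono) (auto simp: e_def)
    also have "\<dots> = pi / 2 * measure M {s} / 2" using B by simp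
    also have "\<dots> < pi / 2 * measure M {s}" using m by simp
    finally have lt: "B * e < pi / 2 * measure M {s}" .
    show False
    proof (cases "s \<le> x0")
      case True
      then have "s + e \<le> q" using e by (simp add: q_def)
      from atom[OF s(1) _ this, of s] e lt show False by simp
    next
      case False
      then have "p \<le> s - e" using e by (simp add: p_def)
      from atom[OF this _ s(2), of s] e lt show False by simp
    qed
  qed
  have meas_cd: "measure M {c<..<d} = (\<integral>x. indicator {c..d} x * g x \<partial>lborel)" if cd: "p \<le> c" "c < d" "d \<le> q" for c d
  proof -
    have null: "{c, d} \<in> null_sets M"
    proof -
      have "{c} \<in> null_sets M" "{d} \<in> null_sets M"
        using no_atom[of c] no_atom[of d] cd by (auto simp: null_sets_def emeasure_eq_measure)
      then have "{c} \<union> {d} \<in> null_sets M" by (rule null_sets.Un)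
      then show ?thesis by (simp add: insert_is_Un[of c "{d}"] del: insert_is_Un[symmetric])
    qed
    have "pi * measure M {c<..<d} = (\<integral>t. pi * indicator {c<..<d} t \<partial>M)" by simp
    also have "\<dots> = (\<integral>t. pi / 2 * (sgn (d - t) - sgn (c - t)) \<partial>M)"
    proof (rule integral_cong_AE)
      show "AE t in M. pi * indicator {c<..<d} t = pi / 2 * (sgn (d - t) - sgn (c - t))"
        using AE_not_in[OF null] by eventually_elim (use cd in \<open>auto simp: indicator_def sgn_if\<close>)
    qed measurable
    also have "\<dots> = (\<integral>x. indicator {c..d} x * - Im (Q (of_real x)) \<partial>lborel)" using S[of c d] cd by simp
    also have "\<dots> = (\<integral>x. pi * (indicator {c..d} x * g x) \<partial>lborel)"
    proof (intro Bochner_Integration.integral_cong refl)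
      fix x show "indicator {c..d} x * - Im (Q (of_real x)) = pi * (indicator {c..d} x * g x)"
        using g[of x] cd pq by (cases "x \<in> {c..d}") (auto simp: abs_less_iff)
    qed
    finally show ?thesis by simp
  qed
  have g0: "g t \<ge> 0" if t: "\<bar>t - x0\<bar> < r" for t
  proof -
    obtain e where e: "e > 0" "ball (of_real t) e \<subseteq> ball (of_real x0 :: complex) r"
      using inb[OF t] open_ball[of "of_real x0 :: complex" r] unfolding open_contains_ball by blast
    define z where "z n = Complex t (e / 2 / real (Suc n))" for n
    have zI: "Im (z n) > 0" and zb: "z n \<in> ball (of_real x0) r" for n
    proof -
      show "Im (z n) > 0" using e by (simp add: z_def)
      have "e / 2 / real (Suc n) < e" using e by (simp add: divide_simps)
      then have "z n \<in> ball (of_real t) e" using e by (simp add: z_def dist_norm cmod_def)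
      then show "z n \<in> ball (of_real x0) r" using e by blast
    qed
    have "(\<lambda>n. e / 2 / real (Suc n)) \<longlonglongrightarrow> 0"
      by (rule LIMSEQ_Suc[of "\<lambda>n. e / 2 / real n"]) (rule lim_const_over_n)
    then have "z \<longlonglongrightarrow> Complex t 0" unfolding z_def by (intro tendsto_Complex tendsto_const)
    moreover have "isCont Q (Complex t 0)"
      using Q inb[OF t] by (simp add: continuous_on_eq_continuous_at complex_of_real_def)
    ultimately have "(\<lambda>n. Q (z n)) \<longlonglongrightarrow> Q (Complex t 0)" by (rule isCont_tendsto_compose[rotated])
    then have L: "(\<lambda>n. - Im (Q (z n))) \<longlonglongrightarrow> - Im (Q (Complex t 0))" by (intro tendsto_intros)
    have "- Im (Q (z n)) \<ge> 0" for n
      using Im_cauchy_transform_neg[OF zI] QG[OF zb zI] by (simp add: less_imp_le)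
    then have "- Im (Q (Complex t 0)) \<ge> 0" by (intro LIMSEQ_le_const[OF L]) blast
    then show ?thesis using g[OF t] by (simp add: complex_of_real_def divide_nonpos_pos)
  qed
  define I where "I = {p<..<q}"
  have Iab: "\<bar>t - x0\<bar> < r" if "t \<in> I" for t using that r by (auto simp: I_def p_def q_def)
  have contg: "continuous_on I g"
  proof -
    have "continuous_on I (\<lambda>t. - Im (Q (of_real t)) / pi)"
      by (intro continuous_intros continuous_on_subset[OF contI]) (use pq in \<open>auto simp: I_def\<close>)
    then show ?thesis using g Iab by (simp cong: continuous_on_cong)
  qed
  have mg: "(\<lambda>t. ennreal (g t) * indicator I t) \<in> borel_measurable borel"
  proof -
    have "(\<lambda>t. indicator I t * g t) \<in> borel_measurable borel"
      using borel_measurable_continuous_on_indicator[OF _ contg] by (simp add: I_def)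
    then have "(\<lambda>t. ennreal (indicator I t * g t)) \<in> borel_measurable borel" by measurable
    also have "(\<lambda>t. ennreal (indicator I t * g t)) = (\<lambda>t. ennreal (g t) * indicator I t)"
      by (auto simp: indicator_def)
    finally show ?thesis .
  qed
  have emeasure_cd: "emeasure M {c<..<d} = (\<integral>\<^sup>+t\<in>{c<..<d}. ennreal (g t) \<partial>lborel)"
    if cd: "p \<le> c" "c < d" "d \<le> q" for c d
  proof -
    have gcd: "g t \<ge> 0" if "t \<in> {c..d}" for t using g0[of t] that cd pq by (auto simp: abs_less_iff)
    have "integrable lborel (\<lambda>x. indicator {c..d} x * - Im (Q (of_real x)) / pi)"
      by (intro integrable_divide intcd) (use cd in auto)
    also have "(\<lambda>x. indicator {c..d} x * - Im (Q (of_real x)) / pi) = (\<lambda>x. indicator {c..d} x * g x)"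
    proof
      fix x show "indicator {c..d} x * - Im (Q (of_real x)) / pi = indicator {c..d} x * g x"
        using g[of x] cd pq by (cases "x \<in> {c..d}") (auto simp: abs_less_iff)
    qed
    finally have gi: "integrable lborel (\<lambda>x. indicator {c..d} x * g x)" .
    have "emeasure M {c<..<d} = ennreal (\<integral>x. indicator {c..d} x * g x \<partial>lborel)"
      by (simp add: emeasure_eq_measure meas_cd[OF cd])
    also have "\<dots> = (\<integral>\<^sup>+x. ennreal (indicator {c..d} x * g x) \<partial>lborel)"
      by (rule nn_integral_eq_integral[symmetric, OF gi]) (use gcd in \<open>auto simp: indicator_def\<close>)
    also have "\<dots> = (\<integral>\<^sup>+t\<in>{c<..<d}. ennreal (g t) \<partial>lborel)"
    proof (rule nn_integral_cong_AE)
      show "AE x in lborel. ennreal (indicator {c..d} x * g x) = ennreal (g x) * indicator {c<..<d} x"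
        using AE_lborel_singleton[of c] AE_lborel_singleton[of d]
        by eventually_elim (auto simp: indicator_def)
    qed
    finally show ?thesis .
  qed
  have IM: "I \<in> sets M" "I \<in> sets borel" by (auto simp: I_def)
  have d1: "emeasure (density M (indicator I)) A = emeasure M (A \<inter> I)" if "A \<in> sets borel" for A
  proof -
    have "emeasure (density M (indicator I)) A = (\<integral>\<^sup>+t. indicator I t * indicator A t \<partial>M)"
      using that IM by (intro emeasure_density) auto
    also have "\<dots> = (\<integral>\<^sup>+t. indicator (A \<inter> I) t \<partial>M)"
      by (intro nn_integral_cong) (auto simp: indicator_def)
    also have "\<dots> = emeasure M (A \<inter> I)" using that IM by (intro nn_integral_indicator) auto
    finally show ?thesis .
  qed
  have d2: "emeasure (density lborel (\<lambda>t. ennreal (g t) * indicator I t)) A = (\<integral>\<^sup>+t\<in>A \<inter> I. ennreal (g t) \<partial>lborel)"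
    if "A \<in> sets borel" for A
  proof -
    have "emeasure (density lborel (\<lambda>t. ennreal (g t) * indicator I t)) A = (\<integral>\<^sup>+t. ennreal (g t) * indicator I t * indicator A t \<partial>lborel)"
      using that mg by (intro emeasure_density) auto
    also have "\<dots> = (\<integral>\<^sup>+t\<in>A \<inter> I. ennreal (g t) \<partial>lborel)"
      by (intro nn_integral_cong) (auto simp: indicator_def)
    finally show ?thesis .
  qed
  have eqm: "density M (indicator I) = density lborel (\<lambda>t. ennreal (g t) * indicator I t)"
  proof (rule measure_eqI_lessThan)
    fix x :: real
    show "emeasure (density M (indicator I)) {x<..} < \<infinity>"
      by (subst d1) (auto simp: emeasure_eq_measure)
    have "{x<..} \<inter> I = {max x p<..<q}" by (auto simp: I_def)
    then show "emeasure (density M (indicator I)) {x<..} = emeasure (density lborel (\<lambda>t. ennreal (g t) * indicator I t)) {x<..}"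
      using emeasure_cd[of "max x p" q] pq by (subst d1, simp, subst d2, simp) (cases "max x p < q", auto)
  qed auto
  show ?thesis
    unfolding has_density_on_def p_def[symmetric] q_def[symmetric] I_def[symmetric]
  proof (intro conjI ballI impI)
    show "0 \<le> g x" if "x \<in> I" for x using g0 Iab that by blast
    fix A :: "real set" assume A: "A \<in> sets borel" "A \<subseteq> I"
    then have "A \<inter> I = A" by blast
    then show "emeasure M A = (\<integral>\<^sup>+t\<in>A. ennreal (g t) \<partial>lborel)"
      using d1[OF A(1)] d2[OF A(1)] eqm by simp
  qed
qed

end

section \<open>Analytic extension across the interval\<close>

text \<open>Taking imaginary parts on the real axis commutes with differentiation along the axis.\<close>

lemma higher_deriv_Im_of_real:
  assumes J: "open J" and D: "open D" "complex_of_real ` J \<subseteq> D" and Q: "Q holomorphic_on D"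
    and g: "\<And>t. t \<in> J \<Longrightarrow> g t = - Im (Q (of_real t)) / pi"
  shows "t \<in> J \<Longrightarrow> (deriv ^^ k) g t = - Im ((deriv ^^ k) Q (of_real t)) / pi"
    and "t \<in> J \<Longrightarrow> (deriv ^^ k) g differentiable (at t)"
proof -
  have der: "((deriv ^^ k) g has_real_derivative - Im ((deriv ^^ Suc k) Q (of_real t)) / pi) (at t)"
    if t: "t \<in> J" and eq: "\<And>u. u \<in> J \<Longrightarrow> (deriv ^^ k) g u = - Im ((deriv ^^ k) Q (of_real u)) / pi" for t k
  proof -
    have "((deriv ^^ k) Q has_field_derivative deriv ((deriv ^^ k) Q) (of_real t)) (at (of_real t))"
      using D(2) t by (intro holomorphic_derivI[OF holomorphic_higher_deriv[OF Q D(1)] D(1)]) auto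
    then have "((\<lambda>u. (deriv ^^ k) Q (of_real u)) has_vector_derivative deriv ((deriv ^^ k) Q) (of_real t)) (at t)"
      by (rule has_vector_derivative_real_field)
    then have "((\<lambda>u. Im ((deriv ^^ k) Q (of_real u))) has_vector_derivative Im (deriv ((deriv ^^ k) Q) (of_real t))) (at t)"
      by (rule bounded_linear.has_vector_derivative[OF bounded_linear_Im])
    then have "((\<lambda>u. Im ((deriv ^^ k) Q (of_real u))) has_real_derivative Im (deriv ((deriv ^^ k) Q) (of_real t))) (at t)"
      by (simp add: has_real_derivative_iff_has_vector_derivative)
    then have "((\<lambda>u. - Im ((deriv ^^ k) Q (of_real u)) / pi) has_real_derivative - Im (deriv ((deriv ^^ k) Q) (of_real t)) / pi) (at t)"
      by (intro DERIV_cdivide DERIV_minus)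
    then have "((deriv ^^ k) g has_real_derivative - Im (deriv ((deriv ^^ k) Q) (of_real t)) / pi) (at t)"
      by (rule has_field_derivative_transform_within_open[OF _ J t]) (simp add: eq)
    then show ?thesis by simp
  qed
  have eq: "\<forall>t\<in>J. (deriv ^^ k) g t = - Im ((deriv ^^ k) Q (of_real t)) / pi" for k
  proof (induction k)
    case (Suc k)
    show ?case
    proof
      fix t assume "t \<in> J"
      from DERIV_imp_deriv[OF der[OF this Suc[rule_format]]]
      show "(deriv ^^ Suc k) g t = - Im ((deriv ^^ Suc k) Q (of_real t)) / pi" by simp
    qed
  qed (simp add: g)
  then show "t \<in> J \<Longrightarrow> (deriv ^^ k) g t = - Im ((deriv ^^ k) Q (of_real t)) / pi" by blast
  show "(deriv ^^ k) g differentiable (at t)" if "t \<in> J"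
    using der[OF that eq[rule_format]] real_differentiable_def by blast
qed

lemma real_analytic_on_Im_of_real:
  assumes Q: "Q holomorphic_on ball (of_real x) s"
    and g: "\<And>t. \<bar>t - x\<bar> < s \<Longrightarrow> g t = - Im (Q (of_real t)) / pi" and t: "\<bar>t - x\<bar> < s"
  shows "\<exists>r>0. \<exists>c. \<forall>y. \<bar>y - t\<bar> < r \<longrightarrow> (\<lambda>k. c k * (y - t) ^ k) sums g y"
proof (intro exI conjI allI impI)
  define r where "r = s - \<bar>t - x\<bar>"
  show "r > 0" using t by (simp add: r_def)
  fix y assume y: "\<bar>y - t\<bar> < r"
  have sub: "ball (of_real t) r \<subseteq> ball (of_real x :: complex) s"
  proof
    fix z :: complex assume "z \<in> ball (of_real t) r"
    moreover have "dist (of_real x) z \<le> dist (of_real x) (of_real t :: complex) + dist (of_real t) z" by (rule dist_triangle)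
    moreover have "dist (of_real x) (of_real t :: complex) = \<bar>t - x\<bar>"
      by (simp add: dist_norm abs_minus_commute flip: of_real_diff)
    ultimately show "z \<in> ball (of_real x) s" by (simp add: r_def)
  qed
  have "complex_of_real y \<in> ball (of_real t) r"
    using y by (simp add: dist_norm abs_minus_commute flip: of_real_diff)
  from holomorphic_power_series[OF holomorphic_on_subset[OF Q sub] this]
  have "(\<lambda>k. (deriv ^^ k) Q (of_real t) / fact k * (of_real y - of_real t) ^ k) sums Q (of_real y)" .
  then have "(\<lambda>k. Im ((deriv ^^ k) Q (of_real t) / fact k * (of_real y - of_real t) ^ k)) sums Im (Q (of_real y))"
    by (rule sums_Im)
  moreover have "Im ((deriv ^^ k) Q (of_real t) / fact k * (of_real y - of_real t) ^ k)
      = Im ((deriv ^^ k) Q (of_real t) / fact k) * (y - t) ^ k" for k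
  proof -
    have "(of_real y - of_real t) ^ k = complex_of_real ((y - t) ^ k)" by simp
    moreover have "Im (A * complex_of_real u) = Im A * u" for A u by simp
    ultimately show ?thesis by (simp only:)
  qed
  ultimately have "(\<lambda>k. Im ((deriv ^^ k) Q (of_real t) / fact k) * (y - t) ^ k) sums Im (Q (of_real y))" by simp
  from sums_mult[OF this, of "- 1 / pi"]
  have "(\<lambda>k. (- 1 / pi) * (Im ((deriv ^^ k) Q (of_real t) / fact k) * (y - t) ^ k)) sums (- Im (Q (of_real y)) / pi)"
    by simp
  moreover have "g y = - Im (Q (of_real y)) / pi" using y by (intro g) (auto simp: r_def)
  ultimately show "(\<lambda>k. ((- 1 / pi) * Im ((deriv ^^ k) Q (of_real t) / fact k)) * (y - t) ^ k) sums g y"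
    by (simp only: mult.assoc)
qed

definition boundary_extension :: "real measure \<Rightarrow> real \<Rightarrow> real \<Rightarrow> (complex \<Rightarrow> complex) \<Rightarrow> bool" where
  "boundary_extension \<mu> x s Q \<longleftrightarrow> Q holomorphic_on ball (of_real x) s \<and>
    (\<forall>z\<in>ball (of_real x) s. Im z > 0 \<longrightarrow> Q z = cauchy_transform \<mu> z)"

context voiculescu_limit
begin

interpretation real_distribution \<nu> by (rule distr)

text \<open>Near \<open>x\<close> the extension of \<open>G = 1 / F\<close> is \<open>1 / \<psi>\<close>, where \<open>\<psi>\<close> is the local inverse of \<open>w - P w\<close> at the boundary value
\<open>w0\<close> of \<open>F\<close>. Since the corresponding functions of the approximating measures converge near \<open>w0\<close>, the same
disc about \<open>x\<close> works for almost all of them.\<close>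

lemma cauchy_transform_extension:
  assumes dens: "has_density_on \<nu> f U" "open U" "continuous_on U f" "\<And>x. x \<in> U \<Longrightarrow> f x > 0"
    and ab: "{a..b} \<subseteq> U" and x: "x \<in> {a..b}"
  shows "\<exists>s Q Qn N. s > 0 \<and> boundary_extension \<nu> x s Q \<and>
    (\<forall>n\<ge>N. boundary_extension (\<nu>s n) x s (Qn n)) \<and>
    uniform_limit (ball (of_real x) s) Qn Q sequentially"
proof -
  obtain P where P: "P holomorphic_on upper_half_plane" "\<And>w. Im w > 0 \<Longrightarrow> Im (P w) \<ge> 0"
    and PF: "\<And>z. Im z > 0 \<Longrightarrow> P (F_transform \<nu> z) = F_transform \<nu> z - z"
    and lim: "\<And>K L. compact K \<Longrightarrow> K \<subseteq> upper_half_plane \<Longrightarrow> compact L \<Longrightarrow> L \<subseteq> upper_half_plane \<Longrightarrow>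
      \<exists>S H N. open S \<and> K \<subseteq> S \<and>
        (\<forall>n\<ge>N. H n holomorphic_on S \<and>
          (\<forall>z\<in>L. F_transform (\<nu>s n) z \<in> S \<and> H n (F_transform (\<nu>s n) z) = z)) \<and>
        (\<forall>K'. compact K' \<longrightarrow> K' \<subseteq> S \<longrightarrow> uniform_limit K' H (\<lambda>w. w - P w) sequentially)"
    apply (rule voiculescu_transforms_converge; assumption?)
    subgoal premises p by (rule p(1)) (fact p)+
    done
  interpret subordinate_inverse P by unfold_locales (use P in auto)
  have "a \<le> b" using x by simp
  obtain \<delta> c C where \<delta>: "\<delta> > 0" "c > 0" "C > 0" and
    bd: "\<And>z. a - \<delta> \<le> Re z \<Longrightarrow> Re z \<le> b + \<delta> \<Longrightarrow> 0 < Im z \<Longrightarrow> Im z \<le> \<delta> \<Longrightarrow>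
      c \<le> - Im (cauchy_transform \<nu> z) \<and> - Im (cauchy_transform \<nu> z) \<le> C"
    apply (rule cauchy_transform_bounds_near_positive_density[OF distr dens \<open>a \<le> b\<close> ab]; assumption?)
    subgoal premises p by (rule p(1)) (fact p)+
    done
  obtain \<eta> R where \<eta>: "\<eta> > 0" and
    bF: "\<And>z. a - \<delta> / 2 \<le> Re z \<Longrightarrow> Re z \<le> b + \<delta> / 2 \<Longrightarrow> 0 < Im z \<Longrightarrow> Im z \<le> \<delta> / 2 \<Longrightarrow>
      \<eta> \<le> Im (F_transform \<nu> z) \<and> cmod (F_transform \<nu> z) \<le> R"
    apply (rule F_transform_near_positive_density[OF distr PF \<delta> bd]; assumption?)
    subgoal premises p by (rule p(1)) (fact p)+
    done
  have bx: "\<eta> \<le> Im (F_transform \<nu> (Complex x y)) \<and> cmod (F_transform \<nu> (Complex x y)) \<le> R"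
    if "0 < y" "y \<le> \<delta> / 2" for y
    by (rule bF) (use x \<delta> that in auto)
  define h where "h w = w - P w" for w
  have \<delta>2: "\<delta> / 2 > 0" using \<delta> by simp
  obtain w0 where w0: "Im w0 > 0" "h w0 = of_real x" "deriv h w0 \<noteq> 0"
    unfolding h_def[abs_def]
    by (rule boundary_value_of_F_transform[OF distr PF \<eta> \<delta>2 bx])
  \<comment> \<open>Half the height of \<open>w0\<close> keeps the disc about \<open>w0\<close> away from the real axis, so that reciprocals of its
    points are bounded.\<close>
  define \<rho> where "\<rho> = Im w0 / 2"
  have \<rho>: "\<rho> > 0" using w0 by (simp add: \<rho>_def)
  have Imb: "Im w \<ge> Im w0 / 2" if "w \<in> cball w0 \<rho>" for w
    using abs_Im_le_cmod[of "w0 - w"] that by (simp add: dist_norm \<rho>_def)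
  have Kup: "cball w0 \<rho> \<subseteq> upper_half_plane"
    using Imb w0 by (force simp: upper_half_plane_def)
  have holh: "h holomorphic_on ball w0 \<rho>"
    unfolding h_def using Kup ball_subset_cball[of w0 \<rho>]
    by (intro holomorphic_intros holomorphic_on_subset[OF P(1)]) auto
  obtain r s \<psi> where r: "0 < r" "r \<le> \<rho>" and s: "s > 0" and "ball w0 r \<subseteq> ball w0 \<rho>"
    and \<psi>: "\<psi> holomorphic_on ball (h w0) s" "\<And>z. z \<in> ball (h w0) s \<Longrightarrow> \<psi> z \<in> ball w0 r \<and> h (\<psi> z) = z"
    and inv: "\<And>H N. (\<And>n. n \<ge> N \<Longrightarrow> H n holomorphic_on ball w0 \<rho>) \<Longrightarrow>
      (\<And>K. compact K \<Longrightarrow> K \<subseteq> ball w0 \<rho> \<Longrightarrow> uniform_limit K H h sequentially) \<Longrightarrow>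
      \<exists>N' \<Psi>. N' \<ge> N \<and> (\<forall>n\<ge>N'. \<Psi> n holomorphic_on ball (h w0) s \<and>
          (\<forall>z\<in>ball (h w0) s. \<Psi> n z \<in> ball w0 r \<and> H n (\<Psi> n z) = z) \<and> inj_on (H n) (ball w0 r)) \<and>
        uniform_limit (ball (h w0) s) \<Psi> \<psi> sequentially"
    apply (rule uniform_local_inverse[OF open_ball centre_in_ball[THEN iffD2, OF \<rho>] holh w0(3) \<rho>]; assumption?)
    subgoal premises p by (rule p(1)) (fact p)+
    done
  define D where "D = ball (complex_of_real x) s"
  have hD: "ball (h w0) s = D" by (simp add: D_def w0)
  have \<psi>D: "\<psi> holomorphic_on D" "\<And>z. z \<in> D \<Longrightarrow> \<psi> z \<in> ball w0 r" "\<And>z. z \<in> D \<Longrightarrow> \<psi> z - P (\<psi> z) = z"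
    using \<psi> unfolding hD unfolding h_def by blast+
  define z1 where "z1 = Complex x (s / 2)"
  have z1: "z1 \<in> D" "Im z1 > 0" using s by (auto simp: D_def z1_def dist_norm cmod_def)
  define L where "L = cball z1 (s / 4)"
  have L: "compact L" "L \<subseteq> upper_half_plane"
  proof -
    show "compact L" by (simp add: L_def)
    show "L \<subseteq> upper_half_plane"
    proof
      fix z assume "z \<in> L"
      then have "\<bar>Im (z1 - z)\<bar> \<le> s / 4" using abs_Im_le_cmod[of "z1 - z"] by (simp add: L_def dist_norm)
      then have "\<bar>s / 2 - Im z\<bar> \<le> s / 4" by (simp add: z1_def)
      then have "Im z > 0" using s by arith
      then show "z \<in> upper_half_plane" by (simp add: upper_half_plane_def)
    qed
  qed
  from lim[OF compact_cball Kup L] obtain S H N where SHN: "open S \<and> cball w0 \<rho> \<subseteq> S \<and>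
        (\<forall>n\<ge>N. H n holomorphic_on S \<and>
          (\<forall>z\<in>L. F_transform (\<nu>s n) z \<in> S \<and> H n (F_transform (\<nu>s n) z) = z)) \<and>
        (\<forall>K'. compact K' \<longrightarrow> K' \<subseteq> S \<longrightarrow> uniform_limit K' H (\<lambda>w. w - P w) sequentially)"
    by (elim exE)
  have S: "open S" "cball w0 \<rho> \<subseteq> S" using SHN by simp_all
  have HN: "H n holomorphic_on S" "z \<in> L \<Longrightarrow> H n (F_transform (\<nu>s n) z) = z" if "n \<ge> N" for n z
    using SHN that by simp_all
  have ulH: "uniform_limit K' H h sequentially" if "compact K'" "K' \<subseteq> S" for K'
    using SHN that unfolding h_def[abs_def] by simp
  have bS: "ball w0 \<rho> \<subseteq> S" using S ball_subset_cball[of w0 \<rho>] by blast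
  have "\<exists>N' \<Psi>. N' \<ge> N \<and> (\<forall>n\<ge>N'. \<Psi> n holomorphic_on ball (h w0) s \<and>
          (\<forall>z\<in>ball (h w0) s. \<Psi> n z \<in> ball w0 r \<and> H n (\<Psi> n z) = z) \<and> inj_on (H n) (ball w0 r)) \<and>
        uniform_limit (ball (h w0) s) \<Psi> \<psi> sequentially"
  proof (rule inv)
    show "H n holomorphic_on ball w0 \<rho>" if "n \<ge> N" for n by (rule holomorphic_on_subset[OF HN(1)[OF that] bS])
    show "uniform_limit K H h sequentially" if "compact K" "K \<subseteq> ball w0 \<rho>" for K
      by (rule ulH) (use that bS in auto)
  qed
  then obtain N' \<Psi> where N\<Psi>: "N' \<ge> N \<and> (\<forall>n\<ge>N'. \<Psi> n holomorphic_on D \<and>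
          (\<forall>z\<in>D. \<Psi> n z \<in> ball w0 r \<and> H n (\<Psi> n z) = z) \<and> inj_on (H n) (ball w0 r)) \<and>
        uniform_limit D \<Psi> \<psi> sequentially"
    unfolding hD by (elim exE)
  have N': "N' \<ge> N"
    and \<Psi>: "\<And>n. n \<ge> N' \<Longrightarrow> \<Psi> n holomorphic_on D"
      "\<And>n z. n \<ge> N' \<Longrightarrow> z \<in> D \<Longrightarrow> \<Psi> n z \<in> ball w0 r \<and> H n (\<Psi> n z) = z"
      "\<And>n. n \<ge> N' \<Longrightarrow> inj_on (H n) (ball w0 r)"
    and ul\<Psi>: "uniform_limit D \<Psi> \<psi> sequentially"
    using N\<Psi> by (simp_all only: simp_thms)
  have ImB: "Im w \<ge> Im w0 / 2" if "w \<in> ball w0 r" for w by (rule Imb) (use that r in auto)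
  have nzB: "w \<noteq> 0" "cmod w \<ge> Im w0 / 2" if "w \<in> ball w0 r" for w
    using ImB[OF that] w0 abs_Im_le_cmod[of w] by auto
  \<comment> \<open>Both \<open>F z\<close> and \<open>\<psi> z\<close> are preimages of \<open>z\<close> under \<open>h\<close>, which is injective over the upper half-plane.\<close>
  have F\<psi>: "F_transform \<nu> z = \<psi> z" if z: "z \<in> D" "Im z > 0" for z
  proof (rule inj_over_upper_half_plane)
    have hz: "\<psi> z \<in> ball w0 r" "\<psi> z - P (\<psi> z) = z" using \<psi>D(2,3)[OF z(1)] by auto
    show "0 < Im (F_transform \<nu> z)" by (rule Im_F_transform_pos[OF z(2)])
    show "0 < Im (\<psi> z)" using ImB[OF hz(1)] w0 by simp
    show "0 < Im (F_transform \<nu> z - P (F_transform \<nu> z))" using PF[OF z(2)] z by simp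
    show "0 < Im (\<psi> z - P (\<psi> z))" unfolding hz(2) by (rule z(2))
    show "F_transform \<nu> z - P (F_transform \<nu> z) = \<psi> z - P (\<psi> z)" unfolding hz(2) using PF[OF z(2)] by simp
  qed
  \<comment> \<open>For the \<open>n\<close>-th measure, \<open>F\<close> and the local inverse \<open>\<Psi> n\<close> are compared near the single point \<open>z1\<close>, where
    pointwise convergence puts \<open>F z1\<close> into the ball on which \<open>H n\<close> is injective. The neighbourhood of
    \<open>z1\<close> may depend on \<open>n\<close>; the identity theorem extends the equality to the half-disc \<open>D'\<close>.\<close>
  have "(\<lambda>n. F_transform (\<nu>s n) z1) \<longlonglongrightarrow> F_transform \<nu> z1"
    by (rule F_transform_tendsto[OF distr_seq distr weak z1(2)])
  moreover have "F_transform \<nu> z1 \<in> ball w0 r" using F\<psi>[OF z1] \<psi>D(2)[OF z1(1)] by simp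
  ultimately have "eventually (\<lambda>n. F_transform (\<nu>s n) z1 \<in> ball w0 r) sequentially"
    by (rule topological_tendstoD[OF _ open_ball])
  then obtain N1 where N1: "\<And>n. n \<ge> N1 \<Longrightarrow> F_transform (\<nu>s n) z1 \<in> ball w0 r"
    unfolding eventually_sequentially by blast
  define D' where "D' = D \<inter> upper_half_plane"
  have D': "open D'" "connected D'"
    unfolding D'_def D_def upper_half_plane_def
    by (auto intro!: open_Int convex_connected convex_Int convex_halfspace_Im_gt simp: open_halfspace_Im_gt)
  have Fn\<Psi>: "F_transform (\<nu>s n) z = \<Psi> n z" if n: "n \<ge> max N' N1" and z: "z \<in> D'" for n z
  proof -
    have n': "n \<ge> N'" "n \<ge> N1" "n \<ge> N" using n N' by auto
    interpret n: real_distribution "\<nu>s n" by (rule distr_seq)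
    have "continuous_on upper_half_plane (F_transform (\<nu>s n))"
      by (rule holomorphic_on_imp_continuous_on[OF n.holomorphic_F_transform])
    moreover have op: "open upper_half_plane" by (simp add: upper_half_plane_def open_halfspace_Im_gt)
    ultimately have "open (F_transform (\<nu>s n) -` ball w0 r \<inter> upper_half_plane)"
      by (simp add: continuous_on_open_vimage)
    then have opB: "open (F_transform (\<nu>s n) -` ball w0 r \<inter> upper_half_plane \<inter> (ball z1 (s / 4) \<inter> D'))"
      (is "open ?B") by (rule open_Int[OF _ open_Int[OF open_ball D'(1)]])
    have z1B: "z1 \<in> ?B"
      using N1[OF n'(2)] z1 s by (auto simp: D'_def upper_half_plane_def)
    show ?thesis
    proof (rule analytic_continuation_open[where f = "F_transform (\<nu>s n)" and g = "\<Psi> n",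
          OF opB D'(1) _ D'(2) _ _ _ _ z])
      show "?B \<noteq> {}" using z1B by blast
      show "?B \<subseteq> D'" by blast
      show "F_transform (\<nu>s n) holomorphic_on D'"
        by (rule holomorphic_on_subset[OF n.holomorphic_F_transform]) (auto simp: D'_def)
      show "\<Psi> n holomorphic_on D'" by (rule holomorphic_on_subset[OF \<Psi>(1)[OF n'(1)]]) (auto simp: D'_def)
      show "F_transform (\<nu>s n) u = \<Psi> n u" if u: "u \<in> ?B" for u
      proof (rule inj_onD[OF \<Psi>(3)[OF n'(1)]])
        have uD: "u \<in> D" "u \<in> L" using u by (auto simp: D'_def L_def)
        show "F_transform (\<nu>s n) u \<in> ball w0 r" using u by simp
        show "\<Psi> n u \<in> ball w0 r" using \<Psi>(2)[OF n'(1) uD(1)] by simp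
        show "H n (F_transform (\<nu>s n) u) = H n (\<Psi> n u)"
          using HN(2)[OF n'(3)] uD(2) \<Psi>(2)[OF n'(1) uD(1)] by simp
      qed
    qed
  qed
  have A: "boundary_extension \<nu> x s (\<lambda>z. inverse (\<psi> z))"
    unfolding boundary_extension_def D_def[symmetric]
  proof (intro conjI ballI impI)
    show "(\<lambda>z. inverse (\<psi> z)) holomorphic_on D"
      by (rule holomorphic_on_inverse[OF \<psi>D(1) nzB(1)[OF \<psi>D(2)]])
    show "inverse (\<psi> z) = cauchy_transform \<nu> z" if "z \<in> D" "Im z > 0" for z
      using F\<psi>[OF that, symmetric] by (simp add: F_transform_def)
  qed
  have B: "boundary_extension (\<nu>s n) x s (\<lambda>z. inverse (\<Psi> n z))" if n: "n \<ge> max N' N1" for n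
    unfolding boundary_extension_def D_def[symmetric]
  proof (intro conjI ballI impI)
    have n': "n \<ge> N'" using n by simp
    show "(\<lambda>z. inverse (\<Psi> n z)) holomorphic_on D"
      by (rule holomorphic_on_inverse[OF \<Psi>(1)[OF n'] nzB(1)[OF \<Psi>(2)[OF n', THEN conjunct1]]])
    show "inverse (\<Psi> n z) = cauchy_transform (\<nu>s n) z" if "z \<in> D" "Im z > 0" for z
    proof -
      have "\<Psi> n z = F_transform (\<nu>s n) z"
        by (rule Fn\<Psi>[OF n, symmetric]) (use that in \<open>simp add: D'_def upper_half_plane_def\<close>)
      then show ?thesis by (simp add: F_transform_def)
    qed
  qed
  have "uniform_limit D (\<lambda>n z. inverse (\<Psi> n z)) (inverse \<circ> \<psi>) sequentially"
    by (rule uniform_lim_inverse[OF ul\<Psi>, of "Im w0 / 2"]) (use nzB(2)[OF \<psi>D(2)] w0 in auto)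
  then have C: "uniform_limit (ball (of_real x) s) (\<lambda>n z. inverse (\<Psi> n z)) (\<lambda>z. inverse (\<psi> z)) sequentially"
    by (simp add: o_def D_def)
  have B': "\<forall>n\<ge>max N' N1. boundary_extension (\<nu>s n) x s (\<lambda>z. inverse (\<Psi> n z))"
    using B by blast
  show ?thesis
    by (intro exI conjI, rule s, rule A, rule B', rule C)
qed

end

text \<open>The density is read off from the vertical limit of the Cauchy transform. This does not refer to any
particular analytic extension, so extensions about different points agree where they overlap.
Where the limit does not exist, the value of \<open>Lim\<close> is arbitrary.\<close>

definition boundary_density :: "real measure \<Rightarrow> real \<Rightarrow> real" where
  "boundary_density \<mu> t = - Im (Lim (at_right 0) (\<lambda>y. cauchy_transform \<mu> (Complex t y))) / pi"

lemma boundary_density_eq: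
  assumes ext: "boundary_extension \<mu> x s Q" and t: "\<bar>t - x\<bar> < s"
  shows "boundary_density \<mu> t = - Im (Q (of_real t)) / pi"
proof -
  have Q: "continuous_on (ball (of_real x) s) Q"
    and QG: "\<And>z. z \<in> ball (of_real x) s \<Longrightarrow> Im z > 0 \<Longrightarrow> Q z = cauchy_transform \<mu> z"
    using ext holomorphic_on_imp_continuous_on unfolding boundary_extension_def by blast+
  have tb: "of_real t \<in> ball (complex_of_real x) s"
    using t by (simp add: dist_norm abs_minus_commute flip: of_real_diff)
  have "isCont Q (Complex t 0)" using Q tb by (simp add: continuous_on_eq_continuous_at complex_of_real_def)
  moreover have lim: "((\<lambda>y. Complex t y) \<longlongrightarrow> Complex t 0) (at_right 0)"
    by (intro tendsto_Complex tendsto_const tendsto_ident_at)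
  ultimately have "((\<lambda>y. Q (Complex t y)) \<longlongrightarrow> Q (Complex t 0)) (at_right 0)" by (rule isCont_tendsto_compose)
  moreover have "eventually (\<lambda>y. Q (Complex t y) = cauchy_transform \<mu> (Complex t y)) (at_right 0)"
  proof -
    have "eventually (\<lambda>y. Complex t y \<in> ball (of_real x) s) (at_right 0)"
      by (rule topological_tendstoD[OF lim open_ball]) (use tb in \<open>simp add: complex_of_real_def\<close>)
    moreover have "eventually (\<lambda>y. y > 0) (at_right (0::real))" by (rule eventually_at_right_less)
    ultimately show ?thesis by eventually_elim (use QG in auto)
  qed
  ultimately have "((\<lambda>y. cauchy_transform \<mu> (Complex t y)) \<longlongrightarrow> Q (Complex t 0)) (at_right 0)"
    by (rule Lim_transform_eventually)
  then have "Lim (at_right 0) (\<lambda>y. cauchy_transform \<mu> (Complex t y)) = Q (Complex t 0)"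
    by (intro tendsto_Lim) auto
  then show ?thesis by (simp add: boundary_density_def complex_of_real_def)
qed

section \<open>Superconvergence of densities\<close>

theorem theorem2p3:
  fixes \<nu>s :: "nat \<Rightarrow> real measure" and \<nu> :: "real measure"
    and a b :: real and U :: "real set" and f :: "real \<Rightarrow> real"
  assumes "\<And>n. real_distribution (\<nu>s n)" and "real_distribution \<nu>"
    and "weak_conv_m \<nu>s \<nu>"
    and "freely_infinitely_divisible \<nu>"
    and "\<And>\<alpha> \<beta>. \<alpha> > 0 \<Longrightarrow> \<beta> > 0 \<Longrightarrow> \<exists>N. \<forall>n\<ge>N. voiculescu_defined_in (\<nu>s n) \<alpha> \<beta>"
    and "a \<le> b" and "open U" and "{a..b} \<subseteq> U"
    and "has_density_on \<nu> f U" and "continuous_on U f" and "\<And>x. x \<in> U \<Longrightarrow> f x > 0"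
  shows "\<exists>N V g.
    (\<forall>n\<ge>N. open (V n) \<and> {a..b} \<subseteq> V n \<and>
       has_density_on (\<nu>s n) (g n) (V n) \<and> real_analytic_on (g n) (V n)) \<and>
    (\<exists>W. open W \<and> {a..b} \<subseteq> W \<and> W \<subseteq> U \<and> smooth_real_on f W) \<and>
    (\<forall>k. uniform_limit {a..b} (\<lambda>n. (deriv ^^ k) (g n)) ((deriv ^^ k) f) sequentially)"
proof -
  interpret voiculescu_limit \<nu>s \<nu>
  proof (rule voiculescu_limit.intro)
    show "\<exists>N. \<forall>n\<ge>N. voiculescu_defined_in (\<nu>s n) \<epsilon> \<epsilon>" if "\<epsilon> > 0" for \<epsilon>
      by (rule assms(5)[OF that that])
  qed (fact assms(1) assms(2) assms(3))+
  have "\<forall>x\<in>{a..b}. \<exists>s Q Qn N. s > 0 \<and> boundary_extension \<nu> x s Q \<and>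
    (\<forall>n\<ge>N. boundary_extension (\<nu>s n) x s (Qn n)) \<and>
    uniform_limit (ball (of_real x) s) Qn Q sequentially"
    by (intro ballI cauchy_transform_extension[OF assms(9,7,10,11,8)])
  from bchoice[OF this] obtain s where
    "\<forall>x\<in>{a..b}. \<exists>Q Qn N. s x > 0 \<and> boundary_extension \<nu> x (s x) (Q) \<and>
    (\<forall>n\<ge>N. boundary_extension (\<nu>s n) x (s x) (Qn n)) \<and>
    uniform_limit (ball (of_real x) (s x)) (Qn) (Q) sequentially" ..
  from bchoice[OF this] obtain Q where
    "\<forall>x\<in>{a..b}. \<exists>Qn N. s x > 0 \<and> boundary_extension \<nu> x (s x) (Q x) \<and>
    (\<forall>n\<ge>N. boundary_extension (\<nu>s n) x (s x) (Qn n)) \<and>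
    uniform_limit (ball (of_real x) (s x)) (Qn) (Q x) sequentially" ..
  from bchoice[OF this] obtain Qn where
    "\<forall>x\<in>{a..b}. \<exists>N. s x > 0 \<and> boundary_extension \<nu> x (s x) (Q x) \<and>
    (\<forall>n\<ge>N. boundary_extension (\<nu>s n) x (s x) (Qn x n)) \<and>
    uniform_limit (ball (of_real x) (s x)) (Qn x) (Q x) sequentially" ..
  from bchoice[OF this] obtain N where *:
    "\<forall>x\<in>{a..b}. s x > 0 \<and> boundary_extension \<nu> x (s x) (Q x) \<and>
    (\<forall>n\<ge>N x. boundary_extension (\<nu>s n) x (s x) (Qn x n)) \<and>
    uniform_limit (ball (of_real x) (s x)) (Qn x) (Q x) sequentially" ..
  have s0: "s x > 0" and eQ: "boundary_extension \<nu> x (s x) (Q x)"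
    and eQn: "\<And>n. n \<ge> N x \<Longrightarrow> boundary_extension (\<nu>s n) x (s x) (Qn x n)"
    and ul: "uniform_limit (ball (of_real x) (s x)) (Qn x) (Q x) sequentially" if "x \<in> {a..b}" for x
    using bspec[OF * that] by simp_all
  note Qh = eQ[unfolded boundary_extension_def, THEN conjunct1]
    and QG = eQ[unfolded boundary_extension_def, THEN conjunct2, rule_format]
    and Qnh = eQn[unfolded boundary_extension_def, THEN conjunct1]
    and QnG = eQn[unfolded boundary_extension_def, THEN conjunct2, rule_format]
  define I where "I x = {x - s x / 2<..<x + s x / 2}" for x
  have opI: "open (I x)" for x by (simp add: I_def)
  have Is: "\<bar>t - x\<bar> < s x" if "x \<in> {a..b}" "t \<in> I x" for t x
    using that s0[OF that(1)] by (auto simp: I_def abs_less_iff)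
  have inI: "complex_of_real ` I x \<subseteq> ball (of_real x) (s x)" if "x \<in> {a..b}" for x
    using Is[OF that] by (auto simp: dist_norm abs_minus_commute simp flip: of_real_diff)
  have "{a..b} \<subseteq> (\<Union>x\<in>{a..b}. I x)" using s0 by (force simp: I_def)
  then obtain T where T: "T \<subseteq> {a..b}" "finite T" "{a..b} \<subseteq> (\<Union>x\<in>T. I x)"
    using compactE_image[OF compact_Icc, of "{a..b}" I a b] opI by metis
  define V where "V = (\<Union>x\<in>T. I x)"
  have V: "open V" "{a..b} \<subseteq> V" using T opI by (auto simp: V_def)
  define N0 where "N0 = Max (N ` T)"
  have N0: "N x \<le> n" if "x \<in> T" "n \<ge> N0" for x n
  proof -
    have "N x \<le> N0" unfolding N0_def using T(2) that(1) by (intro Max_ge) auto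
    then show ?thesis using that(2) by simp
  qed
  define g where "g n = boundary_density (\<nu>s n)" for n
  have gQ: "g n t = - Im (Qn x n (of_real t)) / pi" if "x \<in> T" "n \<ge> N0" "\<bar>t - x\<bar> < s x" for x n t
    unfolding g_def
    by (rule boundary_density_eq[OF eQn that(3)]) (use that T N0 in auto)
  have Ici: "continuous_on (I x) (\<lambda>t. - Im (q (of_real t)) / pi)" if "x \<in> {a..b}" "q holomorphic_on ball (of_real x) (s x)" for x q
    by (intro continuous_intros continuous_on_compose2[OF holomorphic_on_imp_continuous_on[OF that(2)]])
       (use inI[OF that(1)] in auto)
  have 1: "open V \<and> {a..b} \<subseteq> V \<and> has_density_on (\<nu>s n) (g n) V \<and> real_analytic_on (g n) V" if n: "n \<ge> N0" for n
  proof (intro conjI V)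
    interpret n: real_distribution "\<nu>s n" by (rule distr_seq)
    show "has_density_on (\<nu>s n) (g n) V"
      unfolding V_def
    proof (rule has_density_on_UN[OF T(2)])
      fix x assume x: "x \<in> T"
      then have xab: "x \<in> {a..b}" using T by auto
      have "has_density_on (\<nu>s n) (g n) (I x)"
        unfolding I_def
        by (rule n.has_density_on_boundary_values[OF s0[OF xab]
              holomorphic_on_imp_continuous_on[OF Qnh[OF xab N0[OF x n]]] QnG[OF xab N0[OF x n]] gQ[OF x n]])
      moreover have "continuous_on (I x) (g n)"
        using Ici[OF xab Qnh[OF xab N0[OF x n]]] by (rule continuous_on_eq) (use gQ[OF x n] Is[OF xab] in auto)
      ultimately show "open (I x) \<and> has_density_on (\<nu>s n) (g n) (I x) \<and> continuous_on (I x) (g n)" using opI by simp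
    qed simp
    show "real_analytic_on (g n) V"
      unfolding real_analytic_on_def
    proof
      fix t assume "t \<in> V"
      then obtain x where x: "x \<in> T" "t \<in> I x" by (auto simp: V_def)
      then have xab: "x \<in> {a..b}" using T by auto
      show "\<exists>r>0. \<exists>c. \<forall>y. \<bar>y - t\<bar> < r \<longrightarrow> (\<lambda>k. c k * (y - t) ^ k) sums g n y"
        by (rule real_analytic_on_Im_of_real[OF Qnh[OF xab N0[OF x(1) n]] gQ[OF x(1) n] Is[OF xab x(2)]])
    qed
  qed
  have fQ: "f t = - Im (Q x (of_real t)) / pi" if x: "x \<in> T" and t: "t \<in> I x \<inter> U" for x t
  proof -
    have xab: "x \<in> {a..b}" using x T by auto
    let ?q = "\<lambda>t. - Im (Q x (of_real t)) / pi"
    have "has_density_on \<nu> ?q (I x)"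
      unfolding I_def
      by (rule real_distribution.has_density_on_boundary_values[OF assms(2) s0[OF xab]
            holomorphic_on_imp_continuous_on[OF Qh[OF xab]] QG[OF xab]]) auto
    then have d1: "has_density_on \<nu> ?q (I x \<inter> U)" by (rule has_density_on_subset) simp
    have d2: "has_density_on \<nu> f (I x \<inter> U)" using assms(9) by (rule has_density_on_subset) simp
    have o: "open (I x \<inter> U)" using opI assms(7) by (rule open_Int)
    have c1: "continuous_on (I x \<inter> U) ?q" by (rule continuous_on_subset[OF Ici[OF xab Qh[OF xab]]]) simp
    have c2: "continuous_on (I x \<inter> U) f" by (rule continuous_on_subset[OF assms(10)]) simp
    show ?thesis
      using continuous_density_le[OF d1 d2 o c1 c2 t] continuous_density_le[OF d2 d1 o c2 c1 t] by simp
  qed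
  have fd: "(deriv ^^ k) f t = - Im ((deriv ^^ k) (Q x) (of_real t)) / pi" "(deriv ^^ k) f differentiable (at t)"
    if x: "x \<in> T" and t: "t \<in> I x \<inter> U" for x t k
  proof -
    have xab: "x \<in> {a..b}" using x T by auto
    have o: "open (I x \<inter> U)" using opI assms(7) by (rule open_Int)
    have i: "complex_of_real ` (I x \<inter> U) \<subseteq> ball (of_real x) (s x)" using inI[OF xab] by auto
    show "(deriv ^^ k) f t = - Im ((deriv ^^ k) (Q x) (of_real t)) / pi"
      by (rule higher_deriv_Im_of_real(1)[OF o open_ball i Qh[OF xab] fQ[OF x] t])
    show "(deriv ^^ k) f differentiable (at t)"
      by (rule higher_deriv_Im_of_real(2)[OF o open_ball i Qh[OF xab] fQ[OF x] t])
  qed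
  have 2: "open (V \<inter> U) \<and> {a..b} \<subseteq> V \<inter> U \<and> V \<inter> U \<subseteq> U \<and> smooth_real_on f (V \<inter> U)"
    using V assms(7,8) fd(2) by (auto simp: smooth_real_on_def V_def)
  have 3: "uniform_limit {a..b} (\<lambda>n. (deriv ^^ k) (g n)) ((deriv ^^ k) f) sequentially" for k
    unfolding uniform_limit_iff
  proof (intro allI impI)
    fix e :: real assume e: "e > 0"
    have "eventually (\<lambda>n. \<forall>z\<in>cball (of_real x) (s x / 2). dist ((deriv ^^ k) (Qn x n) z) ((deriv ^^ k) (Q x) z) < e) sequentially"
      if x: "x \<in> T" for x
    proof -
      have xab: "x \<in> {a..b}" using x T by auto
      have "uniform_limit (cball (of_real x) (s x / 2)) (\<lambda>n. (deriv ^^ k) (Qn x n)) ((deriv ^^ k) (Q x)) sequentially"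
      proof (rule uniform_limit_higher_deriv[where R = "s x" and r' = "3 * s x / 4" and N = "N x"])
        show "uniform_limit (cball (of_real x) (3 * s x / 4)) (Qn x) (Q x) sequentially"
          by (rule uniform_limit_on_subset[OF ul[OF xab]]) (use s0[OF xab] in auto)
      qed (use Qh[OF xab] Qnh[OF xab] s0[OF xab] in auto)
      then show ?thesis using e by (rule uniform_limitD)
    qed
    then have "eventually (\<lambda>n. \<forall>x\<in>T. \<forall>z\<in>cball (of_real x) (s x / 2). dist ((deriv ^^ k) (Qn x n) z) ((deriv ^^ k) (Q x) z) < e) sequentially"
      by (intro eventually_ball_finite T) auto
    then show "\<forall>\<^sub>F n in sequentially. \<forall>t\<in>{a..b}. dist ((deriv ^^ k) (g n) t) ((deriv ^^ k) f t) < e"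
      using eventually_ge_at_top[of N0]
    proof eventually_elim
      case (elim n)
      show ?case
      proof
        fix t assume t: "t \<in> {a..b}"
        then obtain x where x: "x \<in> T" "t \<in> I x" using T by blast
        then have xab: "x \<in> {a..b}" using T by auto
        let ?A = "(deriv ^^ k) (Qn x n) (of_real t)" and ?B = "(deriv ^^ k) (Q x) (of_real t)"
        have "(deriv ^^ k) (g n) t = - Im ?A / pi"
          by (rule higher_deriv_Im_of_real(1)[OF opI open_ball inI[OF xab] Qnh[OF xab N0[OF x(1) elim(2)]]
                gQ[OF x(1) elim(2) Is[OF xab]] x(2)])
        moreover have "(deriv ^^ k) f t = - Im ?B / pi"
          by (rule fd(1)[OF x(1)]) (use x t assms(8) in auto)
        ultimately have "dist ((deriv ^^ k) (g n) t) ((deriv ^^ k) f t) = \<bar>Im (?A - ?B)\<bar> / pi"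
          by (simp add: dist_real_def abs_minus_commute flip: diff_divide_distrib)
        also have "\<dots> \<le> cmod (?A - ?B) / 1"
          by (rule frac_le[OF norm_ge_zero abs_Im_le_cmod]) (use pi_gt3 in auto)
        also have "\<dots> < e"
        proof -
          have "of_real t \<in> cball (complex_of_real x) (s x / 2)"
          proof -
            have "\<bar>x - t\<bar> \<le> s x / 2" using x(2) unfolding I_def greaterThanLessThan_iff by arith
            then show ?thesis by (simp add: dist_norm flip: of_real_diff)
          qed
          then show ?thesis using elim(1) x(1) by (simp add: dist_norm)
        qed
        finally show "dist ((deriv ^^ k) (g n) t) ((deriv ^^ k) f t) < e" .
      qed
    qed
  qed
  have 1: "\<forall>n\<ge>N0. open V \<and> {a..b} \<subseteq> V \<and> has_density_on (\<nu>s n) (g n) V \<and> real_analytic_on (g n) V"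
    using 1 by blast
  have 2: "\<exists>W. open W \<and> {a..b} \<subseteq> W \<and> W \<subseteq> U \<and> smooth_real_on f W"
    using 2 by blast
  have 3: "\<forall>k. uniform_limit {a..b} (\<lambda>n. (deriv ^^ k) (g n)) ((deriv ^^ k) f) sequentially"
    using 3 by blast
  show ?thesis
    by (rule exI[of _ N0], rule exI[of _ "\<lambda>_. V"], rule exI[of _ g], rule conjI[OF 1 conjI[OF 2 3]])
qed

end
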